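(* Fix $j\in\{1,\dots,p\}$ and assume the setting in the context together with: (i) $\tilde m(\mathbf x)=\sum_{\ell=1}^p m_\ell(x^{(\ell)})$ for functions $m_\ell:[0,1]\to\mathbb R$; (ii) $\sup_{\mathbf x\in[0,1]^p}|\tilde m(\mathbf x)|\le K$ for some $K>0$; (iii) $\mathbb E[\varepsilon^4]<\infty$; (iv) $\mathrm{Var}(m_j(X^{(j)}))>0$; (v) $\gamma_n\to\infty$ and $\gamma_n/\sqrt n\to0$ as $n\to\infty$. Then $$\frac{\tilde I_{n,M}(j)-I(j)}{\sqrt{\gamma_n^2\zeta_{1,\gamma_n}/n+\zeta_{\gamma_n}/M}}\ \xrightarrow{d}\ \mathcal N(0,1)$$ as $M\to\infty$ and $n\to\infty$.
   Context: Setting. Let $p\ge 1$. Let $\mathbf X=(X^{(1)},\dots,X^{(p)})$ be uniformly distributed on $[0,1]^p$ (so its coordinates are mutually independent), and let $Y=\tilde m(\mathbf X)+\varepsilon$, where $\tilde m:[0,1]^p\to\mathbb R$ is measurable, $\varepsilon$ is independent of $\mathbf X$, $\mathbb E[\varepsilon]=0$ and $\mathrm{Var}(\varepsilon)=\sigma^2>0$. Let $\mathbf Z_i=(\mathbf X_i,Y_i)$, $i=1,\dots,n$, be i.i.d. copies of $(\mathbf X,Y)$, with $\varepsilon_i=Y_i-\tilde m(\mathbf X_i)$. Fix the feature index $j$. Permuted points and kernel. A derangement of a finite set $S$ is a bijection $\pi:S\to S$ with $\pi(i)\neq i$ for all $i$. For a derangement $\pi$ of an index set $S$ and $i\in S$,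 let $\mathbf X_i^{\pi}$ be the vector $\mathbf X_i$ with its $j$-th coordinate replaced by $X_{\pi(i)}^{(j)}$. For an integer $\gamma\ge 2$ define the random variable $$h_\gamma=h_\gamma(\mathbf Z_1,\dots,\mathbf Z_\gamma;\pi)=\frac1\gamma\sum_{i=1}^\gamma\Big\{\big(Y_i-\tilde m(\mathbf X_i^{\pi})\big)^2-\big(Y_i-\tilde m(\mathbf X_i)\big)^2\Big\},$$ where $\pi$ is a uniformly distributed random derangement of $\{1,\dots,\gamma\}$, independent of the data. Set $\zeta_{1,\gamma}=\mathrm{Var}\big(\mathbb E[h_\gamma\mid \mathbf Z_1]\big)$ and $\zeta_\gamma=\mathrm{Var}(h_\gamma)$. Target. $I(j)=\mathbb E\big[(Y_1-\tilde m(\mathbf X_{j,1}))^2\big]-\sigma^2$, where $\mathbf X_{j,1}$ is $\mathbf X_1$ with its $j$-th coordinate replaced by an independent copy of $X_1^{(j)}$ (independent of everything else). Incomplete generalized U-statistic. Let $(\gamma_n)$ be integers with $2\le\gamma_n<n$ and $M=M_n\in(0,\binom{n}{\gamma_n}]$. For each subset $S=\{i_1<\dots<i_{\gamma_n}\}\subseteq\{1,\dots,n\}$ draw, independently of each other and of the data, a Bernoulli variable $\rho_S$ with $\mathbb P(\rho_S=1)=M/\binom{n}{\gamma_n}$ and a uniformly random derangement $\pi_S$ of $S$; let $\hat M=\sum_S\rho_S$. Define $$\tilde I_{n,M}(j)=\frac{1}{\hat M}\sum_S\rho_S\,\frac1{\gamma_n}\sum_{i\in S}\Big\{\big(Y_i-\tilde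 m(\mathbf X_i^{\pi_S})\big)^2-\big(Y_i-\tilde m(\mathbf X_i)\big)^2\Big\}$$ (convention $0/0=0$), i.e. the average of the kernel $h_{\gamma_n}$ over the randomly selected subsets. *)

theory Defs
  imports "HOL-Probability.Probability"
begin

(* A covariate vector x in [0,1]^p is a function nat => real, coordinates 0..<p
   (coordinate index j < p corresponds to the paper's j+1). A data point is
   z = (x, e) with e = epsilon; the response is Y = mt x + e. *)

definition derangements :: "nat set \<Rightarrow> (nat \<Rightarrow> nat) set" where
  "derangements S = {\<pi>. \<pi> permutes S \<and> (\<forall>i\<in>S. \<pi> i \<noteq> i)}"

definition Xlaw :: "nat \<Rightarrow> (nat \<Rightarrow> real) measure" where
  "Xlaw p = PiM {..<p} (\<lambda>_. uniform_measure lborel {0..1::real})"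

definition Zlaw :: "nat \<Rightarrow> real measure \<Rightarrow> ((nat \<Rightarrow> real) \<times> real) measure" where
  "Zlaw p \<mu> = Xlaw p \<Otimes>\<^sub>M \<mu>"

definition Yof :: "((nat \<Rightarrow> real) \<Rightarrow> real) \<Rightarrow> (nat \<Rightarrow> real) \<times> real \<Rightarrow> real" where
  "Yof mt z = mt (fst z) + snd z"

definition hker :: "((nat \<Rightarrow> real) \<Rightarrow> real) \<Rightarrow> nat \<Rightarrow> nat set
    \<Rightarrow> (nat \<Rightarrow> (nat \<Rightarrow> real) \<times> real) \<Rightarrow> (nat \<Rightarrow> nat) \<Rightarrow> real" where
  "hker mt j S z \<pi> = (1 / real (card S)) *
     (\<Sum>i\<in>S. (Yof mt (z i) - mt ((fst (z i))(j := fst (z (\<pi> i)) j)))\<^sup>2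
              - (Yof mt (z i) - mt (fst (z i)))\<^sup>2)"

definition var_of :: "'a measure \<Rightarrow> ('a \<Rightarrow> real) \<Rightarrow> real" where
  "var_of M f = (\<integral>x. (f x - (\<integral>y. f y \<partial>M))\<^sup>2 \<partial>M)"

definition kernel_space :: "nat \<Rightarrow> real measure \<Rightarrow> nat
    \<Rightarrow> ((nat \<Rightarrow> (nat \<Rightarrow> real) \<times> real) \<times> (nat \<Rightarrow> nat)) measure" where
  "kernel_space p \<mu> \<gamma> = PiM {..<\<gamma>} (\<lambda>_. Zlaw p \<mu>)
      \<Otimes>\<^sub>M measure_pmf (pmf_of_set (derangements {..<\<gamma>}))"

definition zeta :: "nat \<Rightarrow> real measure \<Rightarrow> ((nat \<Rightarrow> real) \<Rightarrow> real) \<Rightarrow> nat \<Rightarrow> nat \<Rightarrow> real" where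
  "zeta p \<mu> mt j \<gamma> = var_of (kernel_space p \<mu> \<gamma>)
      (\<lambda>(z, \<pi>). hker mt j {..<\<gamma>} z \<pi>)"

(* E[h_gamma | Z_1 = z1]: integrate out Z_2..Z_gamma and pi (all independent of Z_1) *)
definition cond_h1 :: "nat \<Rightarrow> real measure \<Rightarrow> ((nat \<Rightarrow> real) \<Rightarrow> real) \<Rightarrow> nat \<Rightarrow> nat
    \<Rightarrow> (nat \<Rightarrow> real) \<times> real \<Rightarrow> real" where
  "cond_h1 p \<mu> mt j \<gamma> z1 =
     (\<integral>(zr, \<pi>). hker mt j {..<\<gamma>} (zr(0 := z1)) \<pi>
        \<partial>(PiM {1..<\<gamma>} (\<lambda>_. Zlaw p \<mu>)
           \<Otimes>\<^sub>M measure_pmf (pmf_of_set (derangements {..<\<gamma>}))))"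

definition zeta1 :: "nat \<Rightarrow> real measure \<Rightarrow> ((nat \<Rightarrow> real) \<Rightarrow> real) \<Rightarrow> nat \<Rightarrow> nat \<Rightarrow> real" where
  "zeta1 p \<mu> mt j \<gamma> = var_of (Zlaw p \<mu>) (cond_h1 p \<mu> mt j \<gamma>)"

definition Ij :: "nat \<Rightarrow> real measure \<Rightarrow> ((nat \<Rightarrow> real) \<Rightarrow> real) \<Rightarrow> nat \<Rightarrow> real" where
  "Ij p \<mu> mt j =
     (\<integral>(z, u). (Yof mt z - mt ((fst z)(j := u)))\<^sup>2
        \<partial>(Zlaw p \<mu> \<Otimes>\<^sub>M uniform_measure lborel {0..1::real}))
     - (\<integral>e. e\<^sup>2 \<partial>\<mu>)"

definition subsets_of :: "nat \<Rightarrow> nat \<Rightarrow> nat set set" where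
  "subsets_of n \<gamma> = {S. S \<subseteq> {..<n} \<and> card S = \<gamma>}"

definition incomplete_space :: "nat \<Rightarrow> real measure \<Rightarrow> nat \<Rightarrow> nat \<Rightarrow> real
    \<Rightarrow> ((nat \<Rightarrow> (nat \<Rightarrow> real) \<times> real) \<times> (nat set \<Rightarrow> bool \<times> (nat \<Rightarrow> nat))) measure" where
  "incomplete_space p \<mu> n \<gamma> M = PiM {..<n} (\<lambda>_. Zlaw p \<mu>) \<Otimes>\<^sub>M
     PiM (subsets_of n \<gamma>) (\<lambda>S. measure_pmf (pair_pmf
        (bernoulli_pmf (M / real (n choose \<gamma>))) (pmf_of_set (derangements S))))"

(* the incomplete generalized U-statistic; Isabelle's x / 0 = 0 gives 0/0 = 0 *)
definition I_incomplete :: "((nat \<Rightarrow> real) \<Rightarrow> real) \<Rightarrow> nat \<Rightarrow> nat \<Rightarrow> nat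
    \<Rightarrow> (nat \<Rightarrow> (nat \<Rightarrow> real) \<times> real) \<times> (nat set \<Rightarrow> bool \<times> (nat \<Rightarrow> nat)) \<Rightarrow> real" where
  "I_incomplete mt j n \<gamma> \<omega> =
     (\<Sum>S\<in>subsets_of n \<gamma>. if fst (snd \<omega> S) then hker mt j S (fst \<omega>) (snd (snd \<omega> S)) else 0)
     / real (card {S\<in>subsets_of n \<gamma>. fst (snd \<omega> S)})"

end

theory Submission
  imports Defs
begin

text \<open>
  Let \<open>a\<close> be the centred additive component \<open>m j\<close> evaluated at the \<open>j\<close>-th coordinate. Since a derangement is a bijection,
  the kernel splits as \<open>2 \<tau>\<^sup>2 + (1/\<gamma>) \<Sum>i. (\<psi> (Z i) + \<beta> (Z i) * \<alpha> (Z (\<pi> i)))\<close> with \<open>\<psi> = 2 a\<^sup>2 + 2 \<epsilon> a - 2 \<tau>\<^sup>2\<close>,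
  \<open>\<beta> = -2 (a + \<epsilon>)\<close>, \<open>\<alpha> = a\<close>, all of mean zero. Hence \<open>\<gamma>\<^sup>2 \<zeta>\<^sub>1 = Var \<psi>\<close> exactly, and \<open>\<zeta> \<ge> Var \<psi> / \<gamma>\<close>.

  Conditionally on the data, the Bernoulli variables and the derangements are independent over the subsets, so the
  conditional characteristic function of the Horvitz-Thompson version of the statistic is a product, which is compared with
  \<open>exp (i t L / s - t\<^sup>2 V / (2 M s\<^sup>2))\<close>; here \<open>L\<close> is the complete U-statistic averaged over the derangements and \<open>V\<close> the average
  of the squared kernels. Up to an error of smaller order than \<open>s\<close>, \<open>L\<close> is the i.i.d. mean of \<open>\<psi>\<close>, while \<open>V\<close>
  concentrates at \<open>\<zeta>\<close> because two random subsets meet with probability at most \<open>\<gamma>\<^sup>2 / n\<close>. Thus the characteristic function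
  tends to \<open>exp (- t\<^sup>2 (Var \<psi> / n + \<zeta> / M) / (2 s\<^sup>2)) = exp (- t\<^sup>2 / 2)\<close>.
\<close>

section \<open>Functions of independent coordinates\<close>

text \<open>The obstacle is that \<open>n\<close> and \<open>M\<close> grow with no relation between
  them: neither \<open>var\<psi> / n\<close> nor \<open>zt \<gamma> / M\<close> has to dominate the
  squared scale, and their ratio may oscillate. Hence every estimate is an explicit inequality for
  fixed \<open>n\<close>, \<open>\<gamma>\<close>, \<open>M\<close>, collected in
  \<open>err\<close>, and limits are taken only at the end. Dividing by the scale rests on two
  facts: its square is at least each of its two parts, and \<open>zt \<gamma>\<close> is at least
  \<open>var\<psi> / \<gamma>\<close>. The growth condition on \<open>\<gamma>\<close> is consumed
  by one term. \<open>VV\<close> fluctuates by order \<open>1 / sqrt n\<close>, and dividing by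
  \<open>M * s\<^sup>2\<close> costs a factor \<open>\<gamma>\<close>; the other terms that involve
  \<open>\<gamma>\<close> are governed by \<open>\<gamma> / n\<close>. The sampling rate
  \<open>M / N\<close> may be as large as 1, and then replacing a factor 1 + w by exp w is not cheap
  compared with the sampling variance. In that regime the sampling variance itself is negligible
  against \<open>s\<^sup>2\<close>, because \<open>N\<close> is at least
  \<open>(n / \<gamma>)\<^sup>2\<close>.\<close>

lemma integral_pair_mult:
  fixes f :: "'a \<Rightarrow> real" and g :: "'b \<Rightarrow> real"
  assumes "prob_space M1" "prob_space M2" "integrable M1 f" "integrable M2 g"
  shows "integrable (M1 \<Otimes>\<^sub>M M2) (\<lambda>z. f (fst z) * g (snd z))"
    and "(\<integral>z. f (fst z) * g (snd z) \<partial>(M1 \<Otimes>\<^sub>M M2)) = (\<integral>x. f x \<partial>M1) * (\<integral>y. g y \<partial>M2)"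
proof -
  interpret M1: prob_space M1 by fact
  interpret M2: prob_space M2 by fact
  interpret P: pair_sigma_finite M1 M2 ..
  have [measurable]: "f \<in> borel_measurable M1" "g \<in> borel_measurable M2"
    using assms by auto
  show I: "integrable (M1 \<Otimes>\<^sub>M M2) (\<lambda>z. f (fst z) * g (snd z))"
    by (rule P.Fubini_integrable) (use assms in \<open>auto simp: abs_mult\<close>)
  show "(\<integral>z. f (fst z) * g (snd z) \<partial>(M1 \<Otimes>\<^sub>M M2)) = (\<integral>x. f x \<partial>M1) * (\<integral>y. g y \<partial>M2)"
    using P.integral_fst'[OF I] by simp
qed

lemma integral_PiM_component:
  fixes f :: "'a \<Rightarrow> 'b :: {banach, second_countable_topology}"
  assumes "\<And>i. i \<in> I \<Longrightarrow> prob_space (M i)" "i \<in> I" and [measurable]: "f \<in> borel_measurable (M i)"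
  shows "(\<integral>z. f (z i) \<partial>PiM I M) = (\<integral>x. f x \<partial>M i)"
    and "integrable (PiM I M) (\<lambda>z. f (z i)) \<longleftrightarrow> integrable (M i) f"
proof -
  have [measurable]: "(\<lambda>z. z i) \<in> measurable (PiM I M) (M i)" using assms by measurable
  have "(\<integral>x. f x \<partial>distr (PiM I M) (M i) (\<lambda>z. z i)) = (\<integral>z. f (z i) \<partial>PiM I M)"
    by (rule integral_distr) auto
  then show "(\<integral>z. f (z i) \<partial>PiM I M) = (\<integral>x. f x \<partial>M i)"
    using distr_PiM_component[of I M i] assms by simp
  have "integrable (distr (PiM I M) (M i) (\<lambda>z. z i)) f \<longleftrightarrow> integrable (PiM I M) (\<lambda>z. f (z i))"
    by (rule integrable_distr_eq) auto
  then show "integrable (PiM I M) (\<lambda>z. f (z i)) \<longleftrightarrow> integrable (M i) f"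
    using distr_PiM_component[of I M i] assms by simp
qed

text \<open>A pointwise substitute for measurability with respect to the sigma-algebra of the
  coordinates in \<open>A\<close>. The restriction to \<open>\<Omega>\<close> matters because only
  points of the product space are compared.\<close>

definition depends_only :: "'i set \<Rightarrow> ('i \<Rightarrow> 'a) set \<Rightarrow> (('i \<Rightarrow> 'a) \<Rightarrow> 'b) \<Rightarrow> bool" where
  "depends_only A \<Omega> f \<longleftrightarrow> (\<forall>x\<in>\<Omega>. \<forall>y\<in>\<Omega>. (\<forall>i\<in>A. x i = y i) \<longrightarrow> f x = f y)"

text \<open>\<open>merge\<close> identifies the product over \<open>I\<close> with the product of
  the blocks \<open>A\<close> and \<open>I - A\<close>. Freezing the other block at an arbitrary
  point turns \<open>f\<close> into a function \<open>F\<close> of the first block and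
  \<open>g\<close> into a function \<open>G\<close> of the second, and Fubini separates
  them.\<close>

lemma integral_PiM_disjoint_mult:
  fixes f g :: "('i \<Rightarrow> 'a) \<Rightarrow> real"
  assumes M: "\<And>i. prob_space (M i)" and fin: "finite I"
    and A: "A \<subseteq> I" and AB: "A \<inter> B = {}"
    and f: "integrable (PiM I M) f" "depends_only A (space (PiM I M)) f"
    and g: "integrable (PiM I M) g" "depends_only B (space (PiM I M)) g"
  shows "integrable (PiM I M) (\<lambda>z. f z * g z)"
    and "(\<integral>z. f z * g z \<partial>PiM I M) = (\<integral>z. f z \<partial>PiM I M) * (\<integral>z. g z \<partial>PiM I M)"
proof -
  interpret product_prob_space M I
    by (intro product_prob_spaceI M)
  let ?K = "I - A"
  have fA: "finite A" "finite ?K" using A fin finite_subset by auto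
  have IK: "A \<union> ?K = I" using A by auto
  let ?P = "PiM A M \<Otimes>\<^sub>M PiM ?K M"
  let ?m = "merge A ?K"
  interpret PA: prob_space "PiM A M" by (intro prob_space_PiM M)
  interpret PK: prob_space "PiM ?K M" by (intro prob_space_PiM M)
  interpret PP: pair_sigma_finite "PiM A M" "PiM ?K M" ..
  have D: "distr ?P (PiM I M) ?m = PiM I M"
    using distr_merge[of A ?K] fA IK by simp
  have mm[measurable]: "?m \<in> measurable ?P (PiM I M)"
    using measurable_merge[of A ?K M] IK by simp
  obtain x0 where x0: "x0 \<in> space (PiM A M)" using PA.not_empty by blast
  obtain y0 where y0: "y0 \<in> space (PiM ?K M)" using PK.not_empty by blast
  define F where "F x = f (?m (x, y0))" for x
  define G where "G y = g (?m (x0, y))" for y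
  have sp: "?m (x, y) \<in> space (PiM I M)" if "x \<in> space (PiM A M)" "y \<in> space (PiM ?K M)" for x y
    using that measurable_space[OF mm, of "(x,y)"] by (simp add: space_pair_measure)
  have fF: "f (?m (x, y)) = F x" if "x \<in> space (PiM A M)" "y \<in> space (PiM ?K M)" for x y
    unfolding F_def
    by (rule f(2)[unfolded depends_only_def, rule_format, OF sp[OF that] sp[OF that(1) y0]]) (simp add: merge_def)
  have gG: "g (?m (x, y)) = G y" if "x \<in> space (PiM A M)" "y \<in> space (PiM ?K M)" for x y
    unfolding G_def
    by (rule g(2)[unfolded depends_only_def, rule_format, OF sp[OF that] sp[OF x0 that(2)]])
      (use AB in \<open>auto simp: merge_def\<close>)
  have [measurable]: "f \<in> borel_measurable (PiM I M)" "g \<in> borel_measurable (PiM I M)"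
    using f g by auto
  have Fm[measurable]: "F \<in> borel_measurable (PiM A M)"
    unfolding F_def using y0 by measurable
  have Gm[measurable]: "G \<in> borel_measurable (PiM ?K M)"
    unfolding G_def using x0 by measurable
  have fi: "integrable ?P (\<lambda>z. f (?m z))" "integrable ?P (\<lambda>z. g (?m z))"
    using f(1) g(1) integrable_distr_eq[of ?m ?P "PiM I M" f] integrable_distr_eq[of ?m ?P "PiM I M" g] D by simp_all
  have fi': "integrable ?P (\<lambda>z. F (fst z))"
    using fi(1) by (rule Bochner_Integration.integrable_cong[OF refl, THEN iffD1, rotated])
      (auto simp: space_pair_measure fF)
  have gi': "integrable ?P (\<lambda>z. G (snd z))"
    using fi(2) by (rule Bochner_Integration.integrable_cong[OF refl, THEN iffD1, rotated])
      (auto simp: space_pair_measure gG)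
  have Fi: "integrable (PiM A M) F"
    using PP.integrable_fst'[OF fi'] by (simp add: PK.prob_space)
  have "integrable (PiM ?K M) (\<lambda>y. \<integral>x. G y \<partial>PiM A M)"
    using PP.integrable_snd[of "\<lambda>x y. G y"] gi' by (simp add: split_beta')
  then have Gi: "integrable (PiM ?K M) G" by (simp add: PA.prob_space)
  have eq: "(\<integral>z. k z \<partial>PiM I M) = (\<integral>z. k (?m z) \<partial>?P)" if "k \<in> borel_measurable (PiM I M)" for k :: "_ \<Rightarrow> real"
    using integral_distr[OF mm that] D by simp
  note pm = integral_pair_mult[OF PA.prob_space_axioms PK.prob_space_axioms]
  have cong: "(\<integral>z. f (?m z) * g (?m z) \<partial>?P) = (\<integral>z. F (fst z) * G (snd z) \<partial>?P)"
    "(\<integral>z. f (?m z) \<partial>?P) = (\<integral>z. F (fst z) * 1 \<partial>?P)"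
    "(\<integral>z. g (?m z) \<partial>?P) = (\<integral>z. 1 * G (snd z) \<partial>?P)"
    by (intro Bochner_Integration.integral_cong; auto simp: space_pair_measure fF gG)+
  have "integrable ?P (\<lambda>z. f (?m z) * g (?m z))"
    using pm(1)[OF Fi Gi] by (rule Bochner_Integration.integrable_cong[OF refl, THEN iffD1, rotated])
      (auto simp: space_pair_measure fF gG)
  then show "integrable (PiM I M) (\<lambda>z. f z * g z)"
    using integrable_distr_eq[of ?m ?P "PiM I M" "\<lambda>z. f z * g z"] D by simp
  show "(\<integral>z. f z * g z \<partial>PiM I M) = (\<integral>z. f z \<partial>PiM I M) * (\<integral>z. g z \<partial>PiM I M)"
    unfolding eq[of f, OF \<open>f \<in> borel_measurable _\<close>] eq[of g, OF \<open>g \<in> borel_measurable _\<close>]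
    by (subst eq) (simp_all only: cong pm(2)[OF Fi Gi] pm(2)[of F "\<lambda>_. 1", OF Fi PK.integrable_const]
        pm(2)[of "\<lambda>_. 1" G, OF PA.integrable_const Gi] borel_measurable_times
        \<open>f \<in> borel_measurable _\<close> \<open>g \<in> borel_measurable _\<close>, simp add: PA.prob_space PK.prob_space)
qed

text \<open>Variance plus squared mean: off the diagonal the products factor. The means are kept
  because the Bernoulli summands to which this is applied are not always centred.\<close>

lemma integral_PiM_sum_square:
  fixes f :: "'i \<Rightarrow> 'a \<Rightarrow> real"
  assumes M: "\<And>i. prob_space (M i)" and fin: "finite I"
    and f: "\<And>i. i \<in> I \<Longrightarrow> integrable (M i) (f i)" "\<And>i. i \<in> I \<Longrightarrow> integrable (M i) (\<lambda>x. (f i x)\<^sup>2)"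
  shows "integrable (PiM I M) (\<lambda>z. (\<Sum>i\<in>I. f i (z i))\<^sup>2)"
    and "(\<integral>z. (\<Sum>i\<in>I. f i (z i))\<^sup>2 \<partial>PiM I M)
      = (\<Sum>i\<in>I. (\<integral>x. (f i x)\<^sup>2 \<partial>M i) - (\<integral>x. f i x \<partial>M i)\<^sup>2) + (\<Sum>i\<in>I. \<integral>x. f i x \<partial>M i)\<^sup>2"
proof -
  define e where "e i = (\<integral>x. f i x \<partial>M i)" for i
  define d where "d i = (\<integral>x. (f i x)\<^sup>2 \<partial>M i)" for i
  have ci: "integrable (PiM I M) (\<lambda>z. f i (z i))" "(\<integral>z. f i (z i) \<partial>PiM I M) = e i" if "i \<in> I" for i
    using integral_PiM_component[of I M i "f i"] M f(1)[OF that] that by (auto simp: e_def)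
  have ci2: "integrable (PiM I M) (\<lambda>z. (f i (z i))\<^sup>2)" "(\<integral>z. (f i (z i))\<^sup>2 \<partial>PiM I M) = d i" if "i \<in> I" for i
    using integral_PiM_component[of I M i "\<lambda>x. (f i x)\<^sup>2"] M f(2)[OF that] that by (auto simp: d_def)
  have prod: "integrable (PiM I M) (\<lambda>z. f i (z i) * f k (z k)) \<and>
      (\<integral>z. f i (z i) * f k (z k) \<partial>PiM I M) = e i * e k + (if i = k then d i - (e i)\<^sup>2 else 0)"
    if "i \<in> I" "k \<in> I" for i k
  proof (cases "i = k")
    case True then show ?thesis using ci2[OF that(1)] by (simp add: power2_eq_square)
  next
    case False
    show ?thesis
      using integral_PiM_disjoint_mult[of M I "{i}" "{k}" "\<lambda>z. f i (z i)" "\<lambda>z. f k (z k)"]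
        ci that False M fin by (auto simp: depends_only_def)
  qed
  have sq: "(\<Sum>i\<in>I. f i (z i))\<^sup>2 = (\<Sum>i\<in>I. \<Sum>k\<in>I. f i (z i) * f k (z k))" for z
    by (simp add: power2_eq_square sum_product)
  show "integrable (PiM I M) (\<lambda>z. (\<Sum>i\<in>I. f i (z i))\<^sup>2)"
    unfolding sq by (intro Bochner_Integration.integrable_sum) (use prod in blast)
  have "(\<integral>z. (\<Sum>i\<in>I. f i (z i))\<^sup>2 \<partial>PiM I M) = (\<Sum>i\<in>I. \<Sum>k\<in>I. e i * e k + (if i = k then d i - (e i)\<^sup>2 else 0))"
    unfolding sq using prod by (simp add: Bochner_Integration.integral_sum)
  also have "\<dots> = (\<Sum>i\<in>I. d i - (e i)\<^sup>2) + (\<Sum>i\<in>I. e i)\<^sup>2"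
    using fin by (simp add: sum.distrib power2_eq_square sum_product)
  finally show "(\<integral>z. (\<Sum>i\<in>I. f i (z i))\<^sup>2 \<partial>PiM I M)
      = (\<Sum>i\<in>I. (\<integral>x. (f i x)\<^sup>2 \<partial>M i) - (\<integral>x. f i x \<partial>M i)\<^sup>2) + (\<Sum>i\<in>I. \<integral>x. f i x \<partial>M i)\<^sup>2"
    by (simp add: e_def d_def)
qed

lemma (in prob_space) square_integral_le:
  fixes f :: "'a \<Rightarrow> real"
  assumes "integrable M f" "integrable M (\<lambda>x. (f x)\<^sup>2)"
  shows "(\<integral>x. f x \<partial>M)\<^sup>2 \<le> (\<integral>x. (f x)\<^sup>2 \<partial>M)"
  using variance_positive[of f] variance_eq[OF assms] by simp

section \<open>Fourth moments of sums with local dependence\<close>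

lemma pow4_add_le: "(x + y) ^ 4 \<le> 8 * (x ^ 4 + y ^ 4)" for x y :: real
proof -
  have sq: "(a + b)\<^sup>2 \<le> 2 * (a\<^sup>2 + b\<^sup>2)" for a b :: real
    using sum_squares_bound[of a b] by (simp add: power2_sum)
  have "(x + y) ^ 4 = ((x + y)\<^sup>2)\<^sup>2" by simp
  also have "\<dots> \<le> (2 * (x\<^sup>2 + y\<^sup>2))\<^sup>2" by (intro power_mono sq) auto
  also have "\<dots> = 4 * (x\<^sup>2 + y\<^sup>2)\<^sup>2" by (simp only: power_mult_distrib) simp
  also have "\<dots> \<le> 4 * (2 * ((x\<^sup>2)\<^sup>2 + (y\<^sup>2)\<^sup>2))" by (intro mult_left_mono sq) auto
  finally show ?thesis by simp
qed

lemma abs_prod4_le: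
  fixes a b c d :: real
  shows "\<bar>a * b * c * d\<bar> \<le> (a^4 + b^4 + c^4 + d^4) / 4"
proof -
  have "2 * (\<bar>a * b\<bar> * \<bar>c * d\<bar>) \<le> (a * b)\<^sup>2 + (c * d)\<^sup>2"
    using sum_squares_bound[of "\<bar>a * b\<bar>" "\<bar>c * d\<bar>"] by simp
  moreover have "2 * (a * b)\<^sup>2 \<le> a^4 + b^4" "2 * (c * d)\<^sup>2 \<le> c^4 + d^4"
    using sum_squares_bound[of "a\<^sup>2" "b\<^sup>2"] sum_squares_bound[of "c\<^sup>2" "d\<^sup>2"] by (simp_all add: power_mult_distrib)
  moreover have "u \<le> (A + B) / 4" if "2 * u \<le> p + q" "2 * p \<le> A" "2 * q \<le> B" for u p q A B :: real
    using that by simp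
  ultimately have "\<bar>a * b\<bar> * \<bar>c * d\<bar> \<le> ((a^4 + b^4) + (c^4 + d^4)) / 4"
    by blast
  then show ?thesis by (simp add: abs_mult mult.assoc add.assoc)
qed

text \<open>Everything rests on fourth moments alone. Later uses put the constant 1 for some
  factors, which yields integrability of products of two or three variables as well.\<close>

lemma integrable_prod4:
  fixes a b c d :: "'a \<Rightarrow> real"
  assumes [measurable]: "a \<in> borel_measurable M" "b \<in> borel_measurable M" "c \<in> borel_measurable M" "d \<in> borel_measurable M"
    and i: "integrable M (\<lambda>x. a x ^ 4)" "integrable M (\<lambda>x. b x ^ 4)" "integrable M (\<lambda>x. c x ^ 4)" "integrable M (\<lambda>x. d x ^ 4)"
  shows "integrable M (\<lambda>x. a x * b x * c x * d x)"
    and "\<bar>\<integral>x. a x * b x * c x * d x \<partial>M\<bar>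
      \<le> ((\<integral>x. a x ^ 4 \<partial>M) + (\<integral>x. b x ^ 4 \<partial>M) + (\<integral>x. c x ^ 4 \<partial>M) + (\<integral>x. d x ^ 4 \<partial>M)) / 4"
proof -
  have s: "integrable M (\<lambda>x. (a x ^ 4 + b x ^ 4 + c x ^ 4 + d x ^ 4) / 4)" using i by auto
  show I: "integrable M (\<lambda>x. a x * b x * c x * d x)"
    by (rule Bochner_Integration.integrable_bound[OF s]) (use abs_prod4_le in \<open>auto intro: order_trans[OF _ abs_ge_self]\<close>)
  have "\<bar>\<integral>x. a x * b x * c x * d x \<partial>M\<bar> \<le> (\<integral>x. \<bar>a x * b x * c x * d x\<bar> \<partial>M)"
    using integral_norm_bound[of M "\<lambda>x. a x * b x * c x * d x"] by simp
  also have "\<dots> \<le> (\<integral>x. (a x ^ 4 + b x ^ 4 + c x ^ 4 + d x ^ 4) / 4 \<partial>M)"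
    by (intro integral_mono s integrable_abs I abs_prod4_le)
  also have "\<dots> = ((\<integral>x. a x ^ 4 \<partial>M) + (\<integral>x. b x ^ 4 \<partial>M) + (\<integral>x. c x ^ 4 \<partial>M) + (\<integral>x. d x ^ 4 \<partial>M)) / 4"
    using i by simp
  finally show "\<bar>\<integral>x. a x * b x * c x * d x \<partial>M\<bar>
      \<le> ((\<integral>x. a x ^ 4 \<partial>M) + (\<integral>x. b x ^ 4 \<partial>M) + (\<integral>x. c x ^ 4 \<partial>M) + (\<integral>x. d x ^ 4 \<partial>M)) / 4" .
qed

text \<open>Of the \<open>card S ^ 4\<close> products in the expansion, only those survive in which
  each of the four positions is a neighbour of another one. They are counted by the three perfect
  matchings, at most \<open>(card S * d)\<^sup>2\<close> quadruples each, and the four stars, at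
  most \<open>card S * d ^ 3\<close> each; this is the origin of the coefficients 3 and 4. The order
  \<open>card S ^ 2\<close> is the one of independent centred sums.\<close>

lemma fourth_moment_dependency_graph:
  fixes T :: "'i \<Rightarrow> 'a \<Rightarrow> real" and nb :: "'i \<Rightarrow> 'i \<Rightarrow> bool"
  assumes fin: "finite S" and T[measurable]: "\<And>i. i \<in> S \<Longrightarrow> T i \<in> borel_measurable M"
    and T4: "\<And>i. i \<in> S \<Longrightarrow> integrable M (\<lambda>x. T i x ^ 4)" "\<And>i. i \<in> S \<Longrightarrow> (\<integral>x. T i x ^ 4 \<partial>M) \<le> C"
    and sym: "\<And>i k. nb i k \<Longrightarrow> nb k i"
    and d: "\<And>i. i \<in> S \<Longrightarrow> card {k\<in>S. nb i k} \<le> d"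
    and zero: "\<And>i k l m. \<lbrakk>i \<in> S; k \<in> S; l \<in> S; m \<in> S; \<not> nb i k; \<not> nb i l; \<not> nb i m\<rbrakk>
      \<Longrightarrow> (\<integral>x. T i x * T k x * T l x * T m x \<partial>M) = 0"
  shows "integrable M (\<lambda>x. (\<Sum>i\<in>S. T i x)^4)"
    and "(\<integral>x. (\<Sum>i\<in>S. T i x)^4 \<partial>M) \<le> C * (3 * real d ^ 2 + 4 * real d ^ 3) * real (card S) ^ 2"
proof -
  define b where "b i k = (of_bool (nb i k) :: real)" for i k
  define B where "B i k l m = b i k * b l m + b i l * b k m + b i m * b k l
      + b i k * b i l * b i m + b k i * b k l * b k m + b l i * b l k * b l m + b m i * b m k * b m l" for i k l m
  have b0: "b i k \<ge> 0" for i k by (simp add: b_def)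
  have B0: "B i k l m \<ge> 0" for i k l m by (simp add: B_def b0)
  have exp4: "(\<Sum>i\<in>S. T i x)^4 = (\<Sum>i\<in>S. \<Sum>k\<in>S. \<Sum>l\<in>S. \<Sum>m\<in>S. T i x * T k x * T l x * T m x)" for x
  proof -
    have "(\<Sum>i\<in>S. T i x)^4 = (\<Sum>i\<in>S. T i x) * ((\<Sum>i\<in>S. T i x) * ((\<Sum>i\<in>S. T i x) * (\<Sum>i\<in>S. T i x)))"
      by (simp add: power4_eq_xxxx)
    also have "\<dots> = (\<Sum>i\<in>S. \<Sum>k\<in>S. \<Sum>l\<in>S. \<Sum>m\<in>S. T i x * (T k x * (T l x * T m x)))"
      unfolding sum_distrib_right unfolding sum_distrib_left ..
    finally show ?thesis by (simp add: mult.assoc)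
  qed
  have I: "integrable M (\<lambda>x. T i x * T k x * T l x * T m x)"
    and bd: "\<bar>\<integral>x. T i x * T k x * T l x * T m x \<partial>M\<bar> \<le> C"
    if "i \<in> S" "k \<in> S" "l \<in> S" "m \<in> S" for i k l m
    using integrable_prod4[of "T i" M "T k" "T l" "T m"] that T4[OF that(1)] T4[OF that(2)] T4[OF that(3)] T4[OF that(4)]
    by auto
  show "integrable M (\<lambda>x. (\<Sum>i\<in>S. T i x)^4)"
    unfolding exp4 by (intro Bochner_Integration.integrable_sum I)
  show "(\<integral>x. (\<Sum>i\<in>S. T i x)^4 \<partial>M) \<le> C * (3 * real d ^ 2 + 4 * real d ^ 3) * real (card S) ^ 2"
  proof (cases "S = {}")
    case False
    then obtain i0 where "i0 \<in> S" by auto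
    have C0: "C \<ge> 0"
      using bd[of i0 i0 i0 i0] \<open>i0 \<in> S\<close> by linarith
    \<comment> \<open>A graph on four vertices without isolated vertex has a perfect matching or contains a star.\<close>
    have summand: "(\<integral>x. T i x * T k x * T l x * T m x \<partial>M) \<le> C * B i k l m"
      if S: "i \<in> S" "k \<in> S" "l \<in> S" "m \<in> S" for i k l m
    proof (cases "(nb i k \<or> nb i l \<or> nb i m) \<and> (nb k i \<or> nb k l \<or> nb k m) \<and>
        (nb l i \<or> nb l k \<or> nb l m) \<and> (nb m i \<or> nb m k \<or> nb m l)")
      case True
      have sy: "nb x y = nb y x" for x y using sym by blast
      have "B i k l m \<ge> 1"
        using True unfolding B_def b_def sy[of k i] sy[of l i] sy[of m i] sy[of l k] sy[of m k] sy[of m l]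
        by (cases "nb i k"; cases "nb i l"; cases "nb i m"; cases "nb k l"; cases "nb k m"; cases "nb l m"; simp)
      then have "C * 1 \<le> C * B i k l m" using C0 by (intro mult_left_mono)
      with bd[OF S] show ?thesis by linarith
    next
      case False
      have c: "T i x * T k x * T l x * T m x = T k x * T i x * T l x * T m x"
        "T i x * T k x * T l x * T m x = T l x * T i x * T k x * T m x"
        "T i x * T k x * T l x * T m x = T m x * T i x * T k x * T l x" for x by (simp_all add: ac_simps)
      have "(\<integral>x. T i x * T k x * T l x * T m x \<partial>M) = 0"
        using False zero[of i k l m] zero[of k i l m] zero[of l i k m] zero[of m i k l] S
        unfolding c(1)[symmetric] c(2)[symmetric] c(3)[symmetric] by blast
      then show ?thesis using C0 B0 by simp
    qed
    have row: "(\<Sum>k\<in>S. b i k) \<le> d" if "i \<in> S" for i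
      using d[OF that] fin by (simp add: b_def sum.If_cases of_bool_def Int_def conj_commute)
    have row0: "(\<Sum>k\<in>S. b i k) \<ge> 0" for i by (intro sum_nonneg b0)
    define c where "c = real (card S)"
    have c1: "c \<ge> 1" using False fin by (simp add: c_def Suc_leI card_gt_0_iff)
    have pair: "(\<Sum>i\<in>S. \<Sum>k\<in>S. b i k) \<le> c * d"
      using sum_bounded_above[of S "\<lambda>i. \<Sum>k\<in>S. b i k" "real d"] row by (simp add: c_def)
    have pair0: "(\<Sum>i\<in>S. \<Sum>k\<in>S. b i k) \<ge> 0" by (intro sum_nonneg b0)
    have m1: "(\<Sum>i\<in>S. \<Sum>k\<in>S. \<Sum>l\<in>S. \<Sum>m\<in>S. b i k * b l m) \<le> (c * d) ^ 2"
    proof -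
      have "(\<Sum>i\<in>S. \<Sum>k\<in>S. \<Sum>l\<in>S. \<Sum>m\<in>S. b i k * b l m) = (\<Sum>i\<in>S. \<Sum>k\<in>S. b i k)^2"
        by (simp add: power2_eq_square sum_distrib_left[symmetric] sum_distrib_right[symmetric])
      then show ?thesis using power_mono[OF pair pair0, of 2] by simp
    qed
    have st: "(\<Sum>i\<in>S. \<Sum>k\<in>S. \<Sum>l\<in>S. \<Sum>m\<in>S. b i k * b i l * b i m) \<le> c * d ^ 3"
    proof -
      have "(\<Sum>i\<in>S. \<Sum>k\<in>S. \<Sum>l\<in>S. \<Sum>m\<in>S. b i k * b i l * b i m) = (\<Sum>i\<in>S. (\<Sum>k\<in>S. b i k)^3)"
        by (simp add: power3_eq_cube sum_distrib_left[symmetric] sum_distrib_right[symmetric])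
      also have "\<dots> \<le> (\<Sum>i\<in>S. real d ^ 3)" by (intro sum_mono power_mono row row0)
      finally show ?thesis by (simp add: c_def)
    qed
    have m2: "(\<Sum>i\<in>S. \<Sum>k\<in>S. \<Sum>l\<in>S. \<Sum>m\<in>S. b i l * b k m) \<le> (c * d) ^ 2"
      using m1 by (subst (2) sum.swap) simp
    have m3: "(\<Sum>i\<in>S. \<Sum>k\<in>S. \<Sum>l\<in>S. \<Sum>m\<in>S. b i m * b k l) \<le> (c * d) ^ 2"
    proof -
      have "(\<Sum>i\<in>S. \<Sum>k\<in>S. \<Sum>l\<in>S. \<Sum>m\<in>S. b i m * b k l) = (\<Sum>i\<in>S. \<Sum>k\<in>S. b i k)^2"
        by (simp add: power2_eq_square sum_distrib_left[symmetric] sum_distrib_right[symmetric])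
      then show ?thesis using power_mono[OF pair pair0, of 2] by simp
    qed
    have st2: "(\<Sum>i\<in>S. \<Sum>k\<in>S. \<Sum>l\<in>S. \<Sum>m\<in>S. b k i * b k l * b k m) \<le> c * d ^ 3"
      using st by (subst sum.swap) simp
    have st3: "(\<Sum>i\<in>S. \<Sum>k\<in>S. \<Sum>l\<in>S. \<Sum>m\<in>S. b l i * b l k * b l m) \<le> c * d ^ 3"
      using st2 by (subst (2) sum.swap) simp
    have st4: "(\<Sum>i\<in>S. \<Sum>k\<in>S. \<Sum>l\<in>S. \<Sum>m\<in>S. b m i * b m k * b m l) \<le> c * d ^ 3"
    proof -
      have "(\<Sum>l\<in>S. \<Sum>m\<in>S. b m i * b m k * b m l) = (\<Sum>m\<in>S. \<Sum>l\<in>S. b m i * b m k * b m l)" for i k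
        by (rule sum.swap)
      with st3 show ?thesis by simp
    qed
    have "(\<Sum>i\<in>S. \<Sum>k\<in>S. \<Sum>l\<in>S. \<Sum>m\<in>S. B i k l m) \<le> 3 * (c * d)^2 + 4 * (c * d ^ 3)"
      unfolding B_def sum.distrib using m1 m2 m3 st st2 st3 st4 by linarith
    \<comment> \<open>The stars are of lower order in \<open>c\<close>; they are inflated to
      \<open>c ^ 2\<close> so that a single power remains.\<close>
    also have "4 * (c * d ^ 3) \<le> 4 * (c^2 * d ^ 3)"
      using c1 by (intro mult_left_mono mult_right_mono) (auto simp: power2_eq_square)
    also have "3 * (c * d)^2 + 4 * (c^2 * d ^ 3) = (3 * real d ^ 2 + 4 * real d ^ 3) * c ^ 2"
      by (simp add: algebra_simps power_mult_distrib)
    finally have B: "(\<Sum>i\<in>S. \<Sum>k\<in>S. \<Sum>l\<in>S. \<Sum>m\<in>S. B i k l m) \<le> (3 * real d ^ 2 + 4 * real d ^ 3) * c ^ 2"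
      by simp
    have "(\<integral>x. (\<Sum>i\<in>S. T i x)^4 \<partial>M) = (\<Sum>i\<in>S. \<Sum>k\<in>S. \<Sum>l\<in>S. \<Sum>m\<in>S. \<integral>x. T i x * T k x * T l x * T m x \<partial>M)"
      unfolding exp4 by (simp add: I Bochner_Integration.integral_sum)
    also have "\<dots> \<le> (\<Sum>i\<in>S. \<Sum>k\<in>S. \<Sum>l\<in>S. \<Sum>m\<in>S. C * B i k l m)"
      by (intro sum_mono summand)
    also have "\<dots> = C * (\<Sum>i\<in>S. \<Sum>k\<in>S. \<Sum>l\<in>S. \<Sum>m\<in>S. B i k l m)"
      by (simp add: sum_distrib_left)
    also have "\<dots> \<le> C * ((3 * real d ^ 2 + 4 * real d ^ 3) * c ^ 2)"
      by (intro mult_left_mono B C0)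
    finally show ?thesis by (simp add: c_def mult.assoc)
  qed simp
qed

section \<open>Ratio statistics under Bernoulli sampling\<close>

text \<open>The left half plane is convex and the derivative of exp has norm at most 1 there.
  Comparisons of characteristic functions thus reduce to comparisons of exponents.\<close>

lemma norm_exp_diff_le:
  fixes a b :: complex
  assumes "Re a \<le> 0" "Re b \<le> 0"
  shows "norm (exp a - exp b) \<le> norm (a - b)"
proof -
  have "norm (exp a - exp b) \<le> 1 * norm (a - b)"
    by (rule field_differentiable_bound[of "{z. Re z \<le> 0}" exp exp])
      (use assms in \<open>auto intro: convex_halfspace_Re_le derivative_eq_intros DERIV_subset\<close>)
  then show ?thesis by simp
qed

lemma norm_iexp_diff_le: "norm (iexp x - iexp y) \<le> \<bar>x - y\<bar>"
proof -
  have "norm (iexp x - iexp y) \<le> norm (\<i> * complex_of_real x - \<i> * complex_of_real y)"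
    by (rule norm_exp_diff_le) auto
  also have "\<i> * complex_of_real x - \<i> * complex_of_real y = \<i> * complex_of_real (x - y)"
    by (simp add: algebra_simps)
  also have "norm \<dots> = \<bar>x - y\<bar>" by (simp only: norm_mult norm_ii norm_of_real) simp
  finally show ?thesis .
qed

lemma integral_pair_bernoulli_pmf:
  fixes g :: "bool \<times> 'b \<Rightarrow> 'c :: {banach, second_countable_topology}"
  assumes q: "0 \<le> q" "q \<le> 1" and fin: "finite (set_pmf p)"
  shows "(\<integral>x. g x \<partial>measure_pmf (pair_pmf (bernoulli_pmf q) p))
    = q *\<^sub>R (\<integral>y. g (True, y) \<partial>measure_pmf p) + (1 - q) *\<^sub>R (\<integral>y. g (False, y) \<partial>measure_pmf p)"
proof -
  have "(\<integral>x. g x \<partial>measure_pmf (pair_pmf (bernoulli_pmf q) p))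
      = (\<Sum>x\<in>UNIV \<times> set_pmf p. pmf (pair_pmf (bernoulli_pmf q) p) x *\<^sub>R g x)"
    by (rule integral_measure_pmf) (use fin in auto)
  also have "\<dots> = (\<Sum>b\<in>UNIV. \<Sum>y\<in>set_pmf p. pmf (pair_pmf (bernoulli_pmf q) p) (b, y) *\<^sub>R g (b, y))"
    by (simp add: sum.cartesian_product)
  also have "\<dots> = q *\<^sub>R (\<Sum>y\<in>set_pmf p. pmf p y *\<^sub>R g (True, y)) + (1 - q) *\<^sub>R (\<Sum>y\<in>set_pmf p. pmf p y *\<^sub>R g (False, y))"
    using q by (simp add: UNIV_bool pmf_pair scaleR_sum_right)
  finally show ?thesis
    using integral_measure_pmf[OF fin, of p "\<lambda>y. g (True, y)"] integral_measure_pmf[OF fin, of p "\<lambda>y. g (False, y)"] by simp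
qed

text \<open>Trades the cubic Taylor remainder for second and fourth moments, the ones controlled for
  the kernel. The parameter is chosen later so that both parts vanish.\<close>

lemma abs_cube_le:
  fixes x \<delta> :: real
  assumes "\<delta> > 0"
  shows "\<bar>x\<bar> ^ 3 \<le> \<delta> * x\<^sup>2 + x ^ 4 / \<delta>"
proof -
  have "2 * (\<delta> * \<bar>x\<bar>) \<le> \<delta>\<^sup>2 + x\<^sup>2" using sum_squares_bound[of \<delta> "\<bar>x\<bar>"] by simp
  then have "2 * (\<delta> * \<bar>x\<bar>) * x\<^sup>2 \<le> (\<delta>\<^sup>2 + x\<^sup>2) * x\<^sup>2" by (intro mult_right_mono) auto
  moreover have "\<bar>x\<bar> ^ 3 = \<bar>x\<bar> * x\<^sup>2" by (simp add: power3_eq_cube power2_eq_square)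
  moreover have "0 \<le> \<delta> * (\<bar>x\<bar> * x\<^sup>2)" using assms by simp
  ultimately have "\<delta> * \<bar>x\<bar> ^ 3 \<le> \<delta> * (\<delta> * x\<^sup>2 + x ^ 4 / \<delta>)"
    using assms by (simp add: algebra_simps power4_eq_xxxx power2_eq_square)
  then show ?thesis using assms by simp
qed

lemma iexp_taylor2:
  "norm (iexp x - 1 - \<i> * complex_of_real x + complex_of_real (x\<^sup>2 / 2)) \<le> \<bar>x\<bar> ^ 3"
proof -
  have "norm (iexp x - (\<Sum>k\<le>2. (\<i> * complex_of_real x) ^ k / fact k)) \<le> \<bar>x\<bar> ^ Suc 2 / fact (Suc 2)"
    by (rule iexp_approx1)
  also have "(\<Sum>k\<le>2. (\<i> * complex_of_real x) ^ k / fact k) = 1 + \<i> * complex_of_real x - complex_of_real (x\<^sup>2 / 2)"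
    by (simp add: numeral_eq_Suc power_mult_distrib)
  also have "\<bar>x\<bar> ^ Suc 2 / fact (Suc 2) \<le> \<bar>x\<bar> ^ Suc 2 / 1"
    by (intro divide_left_mono) auto
  finally show ?thesis by (simp add: algebra_simps numeral_3_eq_3 numeral_2_eq_2)
qed

text \<open>The hypothesis fits the intended \<open>w\<close>: if \<open>1 + w\<close> is a value of
  a characteristic function, then \<open>Re w\<close> lies between -2 and 0. The constant is the
  exponential in the Taylor remainder.\<close>

lemma norm_one_plus_minus_exp_le:
  fixes w :: complex
  assumes "\<bar>Re w\<bar> \<le> 2"
  shows "norm (1 + w - exp w) \<le> exp 2 * (norm w)\<^sup>2"
proof -
  have "norm (exp w - (\<Sum>k\<le>1. w ^ k / fact k)) \<le> exp \<bar>Re w\<bar> * norm w ^ Suc 1 / fact 1"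
    by (rule Taylor_exp)
  also have "\<dots> \<le> exp 2 * (norm w)\<^sup>2"
    using assms by (auto intro!: mult_right_mono simp: power2_eq_square)
  finally show ?thesis by (simp add: norm_minus_commute)
qed

section \<open>Independent Bernoulli selection with random labels, the data being frozen\<close>

locale bernoulli_sampling =
  fixes J :: "'s set" and P :: "'s \<Rightarrow> 'b pmf" and q :: real
  assumes finJ: "finite J" and neJ: "J \<noteq> {}" and finP: "\<And>S. S \<in> J \<Longrightarrow> finite (set_pmf (P S))"
    and q0: "0 < q" and q1: "q \<le> 1"
begin

definition "\<Omega> = PiM J (\<lambda>S. measure_pmf (pair_pmf (bernoulli_pmf q) (P S)))"

definition mean :: "('s \<Rightarrow> 'b \<Rightarrow> real) \<Rightarrow> real" where
  "mean f = (\<Sum>S\<in>J. \<integral>y. f S y \<partial>measure_pmf (P S)) / real (card J)"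

definition ratio :: "('s \<Rightarrow> 'b \<Rightarrow> real) \<Rightarrow> ('s \<Rightarrow> bool \<times> 'b) \<Rightarrow> real" where
  "ratio f \<omega> = (\<Sum>S\<in>J. if fst (\<omega> S) then f S (snd (\<omega> S)) else 0) / real (card {S\<in>J. fst (\<omega> S)})"

abbreviation "Mq \<equiv> q * real (card J)"

lemma card_pos: "real (card J) > 0" using finJ neJ by (simp add: card_gt_0_iff)

lemma Mq_pos: "Mq > 0" using card_pos q0 by simp

lemma pair_pmf_prob: "prob_space (measure_pmf (pair_pmf (bernoulli_pmf q) (P S)))" by (rule measure_pmf.prob_space_axioms)

sublocale Om: prob_space \<Omega> unfolding \<Omega>_def by (rule prob_space_PiM[OF pair_pmf_prob])

lemma sum_expectation: "(\<Sum>S\<in>J. \<integral>y. f S y \<partial>measure_pmf (P S)) = real (card J) * mean f"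
  using card_pos by (simp add: mean_def)

lemma finPP: "S \<in> J \<Longrightarrow> finite (set_pmf (pair_pmf (bernoulli_pmf q) (P S)))"
  using finP by simp

lemma intP: "S \<in> J \<Longrightarrow> integrable (measure_pmf (P S)) (f :: _ \<Rightarrow> 'c :: {banach, second_countable_topology})"
  by (intro integrable_measure_pmf_finite finP)

lemma intPP: "S \<in> J \<Longrightarrow> integrable (measure_pmf (pair_pmf (bernoulli_pmf q) (P S))) (f :: _ \<Rightarrow> 'c :: {banach, second_countable_topology})"
  by (intro integrable_measure_pmf_finite finPP)

lemma expPP: "S \<in> J \<Longrightarrow> (\<integral>x. f x \<partial>measure_pmf (pair_pmf (bernoulli_pmf q) (P S)))
    = q *\<^sub>R (\<integral>y. f (True, y) \<partial>measure_pmf (P S)) + (1 - q) *\<^sub>R (\<integral>y. f (False, y) \<partial>measure_pmf (P S))"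
  for f :: "_ \<Rightarrow> 'c :: {banach, second_countable_topology}"
  using integral_pair_bernoulli_pmf[of q "P S" f] q0 q1 finP by simp

lemma meas_coord: "S \<in> J \<Longrightarrow> (\<lambda>\<omega>. f (\<omega> S)) \<in> borel_measurable \<Omega>"
  for f :: "_ \<Rightarrow> 'c :: topological_space"
  unfolding \<Omega>_def
  by (rule measurable_compose[OF measurable_component_singleton]) auto

lemma ratio_measurable[measurable]: "ratio f \<in> borel_measurable \<Omega>"
proof -
  have [measurable]: "(\<lambda>\<omega>. if fst (\<omega> S) then f S (snd (\<omega> S)) else 0) \<in> borel_measurable \<Omega>"
     "(\<lambda>\<omega>. if fst (\<omega> S) then 1 else 0::real) \<in> borel_measurable \<Omega>" if "S \<in> J" for S
    using meas_coord[OF that, of "\<lambda>x. if fst x then f S (snd x) else 0"]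
     meas_coord[OF that, of "\<lambda>x. if fst x then 1 else 0::real"] by auto
  have "real (card {S\<in>J. fst (\<omega> S)}) = (\<Sum>S\<in>J. if fst (\<omega> S) then 1 else 0)" for \<omega> :: "'s \<Rightarrow> bool \<times> 'b"
    using finJ by (subst sum.inter_filter[symmetric]) auto
  then show ?thesis unfolding ratio_def[abs_def] by simp
qed

text \<open>The number of selected indices is binomial with mean \<open>Mq\<close>, so its relative
  variance is (1 - q) / \<open>Mq\<close>. It is written as a sum of independent centred terms
  \<open>R\<close>.\<close>

lemma selected_fraction_variance:
  "integrable \<Omega> (\<lambda>\<omega>. (real (card {S\<in>J. fst (\<omega> S)}) / Mq - 1)\<^sup>2)"
  "(\<integral>\<omega>. (real (card {S\<in>J. fst (\<omega> S)}) / Mq - 1)\<^sup>2 \<partial>\<Omega>) \<le> 1 / Mq"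
proof -
  define R where "R x = (if fst x then 1 / Mq else 0) - 1 / real (card J)" for x :: "bool \<times> 'b"
  have eq: "real (card {S\<in>J. fst (\<omega> S)}) / Mq - 1 = (\<Sum>S\<in>J. R (\<omega> S))" for \<omega> :: "'s \<Rightarrow> bool \<times> 'b"
  proof -
    have "(\<Sum>S\<in>J. R (\<omega> S)) = (\<Sum>S\<in>J. if fst (\<omega> S) then 1 / Mq else 0) - 1"
      using card_pos by (simp add: R_def sum_subtractf)
    also have "(\<Sum>S\<in>J. if fst (\<omega> S) then 1 / Mq else 0) = real (card {S\<in>J. fst (\<omega> S)}) / Mq"
      using finJ by (subst sum.inter_filter[symmetric]) auto
    finally show ?thesis by simp
  qed
  note sq = integral_PiM_sum_square[of "\<lambda>S. measure_pmf (pair_pmf (bernoulli_pmf q) (P S))" J "\<lambda>_. R",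
      OF pair_pmf_prob finJ intPP intPP, folded \<Omega>_def]
  show "integrable \<Omega> (\<lambda>\<omega>. (real (card {S\<in>J. fst (\<omega> S)}) / Mq - 1)\<^sup>2)"
    unfolding eq by (rule sq(1))
  have m: "(\<integral>x. R x \<partial>measure_pmf (pair_pmf (bernoulli_pmf q) (P S))) = 0" if "S \<in> J" for S
    using expPP[OF that, of R] card_pos q0 by (simp add: R_def field_simps)
  have v: "(\<integral>x. (R x)\<^sup>2 \<partial>measure_pmf (pair_pmf (bernoulli_pmf q) (P S))) = (1/q - 1) / (real (card J))\<^sup>2" if "S \<in> J" for S
    using card_pos q0 by (subst expPP[OF that]) (simp add: R_def field_simps power2_eq_square)
  have "(\<integral>\<omega>. (real (card {S\<in>J. fst (\<omega> S)}) / Mq - 1)\<^sup>2 \<partial>\<Omega>) = (\<Sum>S\<in>J. (1/q - 1) / (real (card J))\<^sup>2)"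
  proof -
    have "(\<integral>\<omega>. (\<Sum>S\<in>J. R (\<omega> S))\<^sup>2 \<partial>\<Omega>) = (\<Sum>S\<in>J. (\<integral>x. (R x)\<^sup>2 \<partial>measure_pmf (pair_pmf (bernoulli_pmf q) (P S)))
        - (\<integral>x. R x \<partial>measure_pmf (pair_pmf (bernoulli_pmf q) (P S)))\<^sup>2)
     + (\<Sum>S\<in>J. \<integral>x. R x \<partial>measure_pmf (pair_pmf (bernoulli_pmf q) (P S)))\<^sup>2"
      by (rule sq(2))
    then show ?thesis unfolding eq using m v by simp
  qed
  also have "\<dots> = (1/q - 1) / real (card J)" using card_pos by (simp add: power2_eq_square)
  also have "\<dots> \<le> (1/q) / real (card J)" using card_pos by (intro divide_right_mono) auto
  finally show "(\<integral>\<omega>. (real (card {S\<in>J. fst (\<omega> S)}) / Mq - 1)\<^sup>2 \<partial>\<Omega>) \<le> 1 / Mq" by simp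
qed

section \<open>The Horvitz-Thompson statistic and its ratio version\<close>

context
  fixes h :: "'s \<Rightarrow> 'b \<Rightarrow> real" and s :: real
  assumes s: "s > 0"
begin

text \<open>Dividing by the expected count \<open>Mq\<close> instead of the random count makes this
  a sum of independent terms, whose characteristic function is a product.\<close>

definition linear_stat :: "('s \<Rightarrow> bool \<times> 'b) \<Rightarrow> real" where
  "linear_stat \<omega> = (\<Sum>S\<in>J. if fst (\<omega> S) then h S (snd (\<omega> S)) else 0) / (Mq * s)"

lemma linear_stat_eq: "linear_stat \<omega> = (\<Sum>S\<in>J. (if fst (\<omega> S) then h S (snd (\<omega> S)) / (Mq * s) else 0))"
  unfolding linear_stat_def sum_divide_distrib by (intro sum.cong) auto

lemma linear_stat_second_moment:
  "integrable \<Omega> (\<lambda>\<omega>. (linear_stat \<omega>)\<^sup>2)"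
  "(\<integral>\<omega>. (linear_stat \<omega>)\<^sup>2 \<partial>\<Omega>) \<le> mean (\<lambda>S y. (h S y)\<^sup>2) / (Mq * s\<^sup>2) + (mean h / s)\<^sup>2"
proof -
  let ?Y = "\<lambda>S x. if fst x then h S (snd x) / (Mq * s) else 0"
  note sq = integral_PiM_sum_square[of "\<lambda>S. measure_pmf (pair_pmf (bernoulli_pmf q) (P S))" J ?Y,
      OF pair_pmf_prob finJ intPP intPP, folded \<Omega>_def]
  show "integrable \<Omega> (\<lambda>\<omega>. (linear_stat \<omega>)\<^sup>2)"
    unfolding linear_stat_eq by (rule sq(1))
  have m: "(\<integral>x. ?Y S x \<partial>measure_pmf (pair_pmf (bernoulli_pmf q) (P S))) = (\<integral>y. h S y \<partial>measure_pmf (P S)) / (real (card J) * s)" if "S \<in> J" for S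
    using expPP[OF that, of "?Y S"] q0 by simp
  have v: "(\<integral>x. (?Y S x)\<^sup>2 \<partial>measure_pmf (pair_pmf (bernoulli_pmf q) (P S)))
      = (\<integral>y. (h S y)\<^sup>2 \<partial>measure_pmf (P S)) / (real (card J) * Mq * s\<^sup>2)" if "S \<in> J" for S
    using expPP[OF that, of "\<lambda>x. (?Y S x)\<^sup>2"] q0 by (simp add: power_divide power2_eq_square mult_ac)
  have "(\<integral>\<omega>. (linear_stat \<omega>)\<^sup>2 \<partial>\<Omega>) \<le> (\<Sum>S\<in>J. (\<integral>x. (?Y S x)\<^sup>2 \<partial>measure_pmf (pair_pmf (bernoulli_pmf q) (P S))))
     + (\<Sum>S\<in>J. \<integral>x. ?Y S x \<partial>measure_pmf (pair_pmf (bernoulli_pmf q) (P S)))\<^sup>2"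
  proof -
    have "(\<integral>\<omega>. (linear_stat \<omega>)\<^sup>2 \<partial>\<Omega>) = (\<Sum>S\<in>J. (\<integral>x. (?Y S x)\<^sup>2 \<partial>measure_pmf (pair_pmf (bernoulli_pmf q) (P S)))
        - (\<integral>x. ?Y S x \<partial>measure_pmf (pair_pmf (bernoulli_pmf q) (P S)))\<^sup>2)
     + (\<Sum>S\<in>J. \<integral>x. ?Y S x \<partial>measure_pmf (pair_pmf (bernoulli_pmf q) (P S)))\<^sup>2"
      unfolding linear_stat_eq by (rule sq(2))
    also have "\<dots> \<le> (\<Sum>S\<in>J. (\<integral>x. (?Y S x)\<^sup>2 \<partial>measure_pmf (pair_pmf (bernoulli_pmf q) (P S))))
     + (\<Sum>S\<in>J. \<integral>x. ?Y S x \<partial>measure_pmf (pair_pmf (bernoulli_pmf q) (P S)))\<^sup>2"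
      by (intro add_right_mono sum_mono) simp
    finally show ?thesis .
  qed
  also have "\<dots> = (\<Sum>S\<in>J. (\<integral>y. (h S y)\<^sup>2 \<partial>measure_pmf (P S)) / (real (card J) * Mq * s\<^sup>2))
     + (\<Sum>S\<in>J. (\<integral>y. h S y \<partial>measure_pmf (P S)) / (real (card J) * s))\<^sup>2"
    using m v by simp
  also have "\<dots> = mean (\<lambda>S y. (h S y)\<^sup>2) / (Mq * s\<^sup>2) + (mean h / s)\<^sup>2"
    by (simp add: mean_def sum_divide_distrib[symmetric] mult.assoc)
  finally show "(\<integral>\<omega>. (linear_stat \<omega>)\<^sup>2 \<partial>\<Omega>) \<le> mean (\<lambda>S y. (h S y)\<^sup>2) / (Mq * s\<^sup>2) + (mean h / s)\<^sup>2" .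
qed

text \<open>Two replacements are made. Passing from \<open>1 + w S\<close> to
  \<open>exp (w S)\<close> costs the sum of the squared norms of \<open>w S\<close>, which is the
  term with factor \<open>q\<close>. Passing from \<open>w S\<close> to its second-order expansion
  costs the cubic remainder, split by \<open>abs_cube_le\<close>. The exponent contains the raw
  second moment and not a variance: the squared-mean correction is of the same order as the first
  error and is absorbed in it.\<close>

lemma iexp_linear_stat_approx:
  assumes d: "\<delta> > 0"
  shows "norm ((\<integral>\<omega>. iexp (t * linear_stat \<omega>) \<partial>\<Omega>)
      - exp (\<i> * complex_of_real (t * mean h / s) - complex_of_real (t\<^sup>2 * mean (\<lambda>S y. (h S y)\<^sup>2) / (2 * Mq * s\<^sup>2))))
    \<le> (exp 2 * q + \<delta>) * t\<^sup>2 * mean (\<lambda>S y. (h S y)\<^sup>2) / (Mq * s\<^sup>2)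
      + t ^ 4 * mean (\<lambda>S y. (h S y) ^ 4) / (\<delta> * Mq ^ 3 * s ^ 4)"
proof -
  define u where "u = t / (Mq * s)"
  define E where "E S f = (\<integral>y. f y \<partial>measure_pmf (P S))" for S and f :: "'b \<Rightarrow> real"
  \<comment> \<open>\<open>1 + w S\<close> is the characteristic function of one summand, an
    unselected index contributing the value 1; \<open>v S\<close> is the second-order expansion of
    \<open>w S\<close>.\<close>
  define w where "w S = q *\<^sub>R (\<integral>y. iexp (u * h S y) - 1 \<partial>measure_pmf (P S))" for S
  define v where "v S = complex_of_real q * (\<i> * complex_of_real (u * E S (h S)) - complex_of_real (u\<^sup>2 / 2 * E S (\<lambda>y. (h S y)\<^sup>2)))" for S
  have prod: "iexp (t * linear_stat \<omega>) = (\<Prod>S\<in>J. if fst (\<omega> S) then iexp (u * h S (snd (\<omega> S))) else 1)" for \<omega>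
  proof -
    have "\<i> * complex_of_real (t * linear_stat \<omega>) = (\<Sum>S\<in>J. \<i> * complex_of_real (if fst (\<omega> S) then u * h S (snd (\<omega> S)) else 0))"
      unfolding linear_stat_eq sum_distrib_left of_real_sum by (intro sum.cong) (auto simp: u_def)
    then show ?thesis unfolding exp_sum[OF finJ, symmetric] by (simp add: exp_sum[OF finJ] if_distrib cong: if_cong prod.cong)
  qed
  interpret product_prob_space "\<lambda>S. measure_pmf (pair_pmf (bernoulli_pmf q) (P S))" J
    by (intro product_prob_spaceI pair_pmf_prob)
  have fac: "(\<integral>x. (if fst x then iexp (u * h S (snd x)) else 1) \<partial>measure_pmf (pair_pmf (bernoulli_pmf q) (P S))) = 1 + w S"
    if "S \<in> J" for S
  proof -
    have "(\<integral>y. iexp (u * h S y) - 1 \<partial>measure_pmf (P S)) = (\<integral>y. iexp (u * h S y) \<partial>measure_pmf (P S)) - 1"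
      by (subst Bochner_Integration.integral_diff[OF intP[OF that] intP[OF that]]) simp
    then show ?thesis
      unfolding expPP[OF that] w_def by (simp add: scaleR_diff_right scaleR_diff_left)
  qed
  have chQ: "(\<integral>\<omega>. iexp (t * linear_stat \<omega>) \<partial>\<Omega>) = (\<Prod>S\<in>J. 1 + w S)"
    unfolding prod \<Omega>_def
    by (subst product_integral_prod[of J "\<lambda>S x. if fst x then iexp (u * h S (snd x)) else 1"]) (auto simp: finJ fac intPP)
  \<comment> \<open>With all factors in the unit disc, the difference of two products is at most the
    sum of the differences of their factors; the same bound locates \<open>Re (w S)\<close>.\<close>
  have w1: "norm (1 + w S) \<le> 1" if "S \<in> J" for S
  proof -
    have "norm (1 + w S) \<le> (\<integral>x. norm (if fst x then iexp (u * h S (snd x)) else 1) \<partial>measure_pmf (pair_pmf (bernoulli_pmf q) (P S)))"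
      unfolding fac[OF that, symmetric] by (rule integral_norm_bound)
    also have "\<dots> = (\<integral>x. 1 \<partial>measure_pmf (pair_pmf (bernoulli_pmf q) (P S)))"
      by (intro Bochner_Integration.integral_cong) auto
    finally show ?thesis by simp
  qed
  have rew: "Re (w S) \<le> 0" "\<bar>Re (w S)\<bar> \<le> 2" if "S \<in> J" for S
  proof -
    have "Re (w S) = Re (1 + w S) - 1" by simp
    moreover have "\<bar>Re (1 + w S)\<bar> \<le> 1" using w1[OF that] abs_Re_le_cmod order_trans by blast
    ultimately show "Re (w S) \<le> 0" "\<bar>Re (w S)\<bar> \<le> 2" by linarith+
  qed
  have nw: "(norm (w S))\<^sup>2 \<le> q\<^sup>2 * u\<^sup>2 * E S (\<lambda>y. (h S y)\<^sup>2)" if "S \<in> J" for S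
  proof -
    have "norm (w S) \<le> q * (\<integral>y. norm (iexp (u * h S y) - 1) \<partial>measure_pmf (P S))"
      unfolding w_def using q0 by (simp add: integral_norm_bound)
    also have "\<dots> \<le> q * (\<integral>y. \<bar>u * h S y\<bar> \<partial>measure_pmf (P S))"
      using norm_iexp_diff_le[of "u * h S _" 0] q0
      by (intro mult_left_mono integral_mono intP[OF that]) auto
    finally have "(norm (w S))\<^sup>2 \<le> (q * (\<integral>y. \<bar>u * h S y\<bar> \<partial>measure_pmf (P S)))\<^sup>2"
      by (intro power_mono) auto
    also have "\<dots> = q\<^sup>2 * (\<integral>y. \<bar>u * h S y\<bar> \<partial>measure_pmf (P S))\<^sup>2" by (simp add: power_mult_distrib)
    also have "\<dots> \<le> q\<^sup>2 * (\<integral>y. \<bar>u * h S y\<bar>\<^sup>2 \<partial>measure_pmf (P S))"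
      by (intro mult_left_mono measure_pmf.square_integral_le intP[OF that]) auto
    finally show ?thesis by (simp add: E_def power_mult_distrib mult.assoc)
  qed
  have wv: "norm (w S - v S) \<le> q * (\<delta> * u\<^sup>2 * E S (\<lambda>y. (h S y)\<^sup>2) + u^4 * E S (\<lambda>y. (h S y)^4) / \<delta>)" if "S \<in> J" for S
  proof -
    let ?r = "\<lambda>y. iexp (u * h S y) - 1 - \<i> * complex_of_real (u * h S y) + complex_of_real ((u * h S y)\<^sup>2 / 2)"
    have "w S - v S = q *\<^sub>R (\<integral>y. ?r y \<partial>measure_pmf (P S))"
    proof -
      have "(\<integral>y. ?r y \<partial>measure_pmf (P S)) = (\<integral>y. iexp (u * h S y) - 1 \<partial>measure_pmf (P S))
          - (\<integral>y. \<i> * complex_of_real (u * h S y) \<partial>measure_pmf (P S)) + (\<integral>y. complex_of_real ((u * h S y)\<^sup>2 / 2) \<partial>measure_pmf (P S))"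
        by (simp only: Bochner_Integration.integral_add[OF intP[OF that] intP[OF that]] Bochner_Integration.integral_diff[OF intP[OF that] intP[OF that]])
      also have "(\<integral>y. \<i> * complex_of_real (u * h S y) \<partial>measure_pmf (P S)) = \<i> * complex_of_real (u * E S (h S))"
        by (simp only: integral_mult_right_zero integral_complex_of_real E_def)
      also have "(\<integral>y. complex_of_real ((u * h S y)\<^sup>2 / 2) \<partial>measure_pmf (P S)) = complex_of_real (u\<^sup>2 / 2 * E S (\<lambda>y. (h S y)\<^sup>2))"
        by (simp only: integral_complex_of_real E_def) (simp add: power_mult_distrib)
      finally have eq: "(\<integral>y. ?r y \<partial>measure_pmf (P S)) = (\<integral>y. iexp (u * h S y) - 1 \<partial>measure_pmf (P S))
          - \<i> * complex_of_real (u * E S (h S)) + complex_of_real (u\<^sup>2 / 2 * E S (\<lambda>y. (h S y)\<^sup>2))" .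
      show ?thesis unfolding w_def v_def eq scaleR_conv_of_real by (simp only: algebra_simps)
    qed
    then have "norm (w S - v S) \<le> q * (\<integral>y. norm (?r y) \<partial>measure_pmf (P S))"
      using q0 by (simp add: integral_norm_bound)
    also have "\<dots> \<le> q * (\<integral>y. \<delta> * u\<^sup>2 * (h S y)\<^sup>2 + u^4 / \<delta> * (h S y)^4 \<partial>measure_pmf (P S))"
    proof (intro mult_left_mono integral_mono intP[OF that])
      fix y
      show "norm (?r y) \<le> \<delta> * u\<^sup>2 * (h S y)\<^sup>2 + u^4 / \<delta> * (h S y)^4"
        using order_trans[OF iexp_taylor2 abs_cube_le[OF d, of "u * h S y"]]
        by (simp add: power_mult_distrib mult.assoc)
    qed (use q0 in auto)
    also have "(\<integral>y. \<delta> * u\<^sup>2 * (h S y)\<^sup>2 + u^4 / \<delta> * (h S y)^4 \<partial>measure_pmf (P S))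
        = \<delta> * u\<^sup>2 * E S (\<lambda>y. (h S y)\<^sup>2) + u^4 * E S (\<lambda>y. (h S y)^4) / \<delta>"
      by (simp add: Bochner_Integration.integral_add[OF intP[OF that] intP[OF that]] E_def)
    finally show ?thesis .
  qed
  have sE: "(\<Sum>S\<in>J. E S (f S)) = real (card J) * mean f" for f
    using sum_expectation[of f] by (simp add: E_def)
  have A1: "norm ((\<Prod>S\<in>J. 1 + w S) - (\<Prod>S\<in>J. exp (w S))) \<le> exp 2 * q * t\<^sup>2 * mean (\<lambda>S y. (h S y)\<^sup>2) / (Mq * s\<^sup>2)"
  proof -
    have "norm ((\<Prod>S\<in>J. 1 + w S) - (\<Prod>S\<in>J. exp (w S))) \<le> (\<Sum>S\<in>J. norm (1 + w S - exp (w S)))"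
      by (rule norm_prod_diff) (use w1 rew in auto)
    also have "\<dots> \<le> (\<Sum>S\<in>J. exp 2 * (q\<^sup>2 * u\<^sup>2 * E S (\<lambda>y. (h S y)\<^sup>2)))"
      by (intro sum_mono order_trans[OF norm_one_plus_minus_exp_le] mult_left_mono nw rew) auto
    also have "\<dots> = exp 2 * q\<^sup>2 * u\<^sup>2 * (\<Sum>S\<in>J. E S (\<lambda>y. (h S y)\<^sup>2))"
      by (simp add: sum_distrib_left mult.assoc)
    also have "\<dots> = exp 2 * q * t\<^sup>2 * mean (\<lambda>S y. (h S y)\<^sup>2) / (Mq * s\<^sup>2)"
      unfolding sE using card_pos q0 s by (simp add: u_def field_simps power2_eq_square)
    finally show ?thesis .
  qed
  have sumv: "(\<Sum>S\<in>J. v S) = \<i> * complex_of_real (t * mean h / s) - complex_of_real (t\<^sup>2 * mean (\<lambda>S y. (h S y)\<^sup>2) / (2 * Mq * s\<^sup>2))"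
  proof -
    have "(\<Sum>S\<in>J. v S) = complex_of_real q * (\<i> * complex_of_real (u * (\<Sum>S\<in>J. E S (h S))) - complex_of_real (u\<^sup>2 / 2 * (\<Sum>S\<in>J. E S (\<lambda>y. (h S y)\<^sup>2))))"
      by (simp add: v_def sum_distrib_left sum_subtractf right_diff_distrib)
    also have "\<dots> = \<i> * complex_of_real (q * u * (\<Sum>S\<in>J. E S (h S))) - complex_of_real (q * u\<^sup>2 / 2 * (\<Sum>S\<in>J. E S (\<lambda>y. (h S y)\<^sup>2)))"
      by (simp add: algebra_simps)
    also have "q * u * (\<Sum>S\<in>J. E S (h S)) = t * mean h / s"
      unfolding sE using card_pos q0 s by (simp add: u_def)
    also have "q * u\<^sup>2 / 2 * (\<Sum>S\<in>J. E S (\<lambda>y. (h S y)\<^sup>2)) = t\<^sup>2 * mean (\<lambda>S y. (h S y)\<^sup>2) / (2 * Mq * s\<^sup>2)"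
      unfolding sE using card_pos q0 s by (simp add: u_def field_simps power2_eq_square)
    finally show ?thesis .
  qed
  have m2: "mean (\<lambda>S y. (h S y)\<^sup>2) \<ge> 0"
    unfolding mean_def by (intro divide_nonneg_nonneg sum_nonneg) auto
  have A2: "norm ((\<Prod>S\<in>J. exp (w S)) - exp (\<Sum>S\<in>J. v S))
      \<le> \<delta> * t\<^sup>2 * mean (\<lambda>S y. (h S y)\<^sup>2) / (Mq * s\<^sup>2) + t ^ 4 * mean (\<lambda>S y. (h S y) ^ 4) / (\<delta> * Mq ^ 3 * s ^ 4)"
  proof -
    have "norm ((\<Prod>S\<in>J. exp (w S)) - exp (\<Sum>S\<in>J. v S)) = norm (exp (\<Sum>S\<in>J. w S) - exp (\<Sum>S\<in>J. v S))"
      by (simp add: exp_sum finJ)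
    also have "\<dots> \<le> norm ((\<Sum>S\<in>J. w S) - (\<Sum>S\<in>J. v S))"
    proof (rule norm_exp_diff_le)
      show "Re (\<Sum>S\<in>J. w S) \<le> 0" using rew(1) by (simp add: sum_nonpos)
      show "Re (\<Sum>S\<in>J. v S) \<le> 0" unfolding sumv using m2 Mq_pos s by simp
    qed
    also have "\<dots> \<le> (\<Sum>S\<in>J. q * (\<delta> * u\<^sup>2 * E S (\<lambda>y. (h S y)\<^sup>2) + u^4 * E S (\<lambda>y. (h S y)^4) / \<delta>))"
      unfolding sum_subtractf[symmetric] by (intro sum_norm_le wv)
    also have "\<dots> = q * (\<delta> * u\<^sup>2 * (\<Sum>S\<in>J. E S (\<lambda>y. (h S y)\<^sup>2)) + u^4 * (\<Sum>S\<in>J. E S (\<lambda>y. (h S y)^4)) / \<delta>)"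
      unfolding sum_distrib_left[symmetric] sum.distrib sum_divide_distrib[symmetric] ..
    also have "\<dots> = \<delta> * t\<^sup>2 * mean (\<lambda>S y. (h S y)\<^sup>2) / (Mq * s\<^sup>2) + t ^ 4 * mean (\<lambda>S y. (h S y) ^ 4) / (\<delta> * Mq ^ 3 * s ^ 4)"
    proof -
      have "q * (\<delta> * u\<^sup>2 * (real (card J) * a)) = \<delta> * t\<^sup>2 * a / (Mq * s\<^sup>2)" for a
        using card_pos q0 s by (simp add: u_def field_simps power2_eq_square)
      moreover have "q * (u^4 * (real (card J) * a) / \<delta>) = t ^ 4 * a / (\<delta> * Mq ^ 3 * s ^ 4)" for a
        using card_pos q0 s by (simp add: u_def power_divide power_mult_distrib) (simp add: field_simps eval_nat_numeral)
      ultimately show ?thesis unfolding sE by (simp only: distrib_left)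
    qed
    finally show ?thesis .
  qed
  show ?thesis
    using norm_triangle_ineq[of "(\<Prod>S\<in>J. 1 + w S) - (\<Prod>S\<in>J. exp (w S))" "(\<Prod>S\<in>J. exp (w S)) - exp (\<Sum>S\<in>J. v S)"] A1 A2
    unfolding chQ sumv by (simp add: distrib_right add_divide_distrib)
qed

text \<open>If the selected fraction is within \<open>\<delta>\<close> of 1, then the random count
  is at least \<open>Mq / 2\<close>, and replacing it by \<open>Mq\<close> changes the statistic by
  a factor within \<open>2 * \<delta>\<close> of 1; the elementary bound of twice the absolute value
  by 1 plus the square brings in the second moment. Otherwise the trivial bound 2 is dominated by a
  multiple of the squared deviation, as in Chebyshev's inequality. An empty selection, where the
  quotient is 0 by convention, has deviation 1 and falls into the second case.\<close>

lemma iexp_ratio_approx: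
  assumes d: "0 < \<delta>" "\<delta> \<le> 1/2"
  shows "norm ((\<integral>\<omega>. iexp (t * ((ratio (\<lambda>S y. \<theta> + h S y) \<omega> - \<theta>) / s)) \<partial>\<Omega>) - (\<integral>\<omega>. iexp (t * linear_stat \<omega>) \<partial>\<Omega>))
    \<le> \<bar>t\<bar> * \<delta> * (1 + mean (\<lambda>S y. (h S y)\<^sup>2) / (Mq * s\<^sup>2) + (mean h / s)\<^sup>2) + 2 / (\<delta>\<^sup>2 * Mq)"
proof -
  let ?T = "\<lambda>\<omega>. (ratio (\<lambda>S y. \<theta> + h S y) \<omega> - \<theta>) / s"
  let ?m = "\<lambda>\<omega>. real (card {S\<in>J. fst (\<omega> S)})"
  let ?D = "\<lambda>\<omega>. ?m \<omega> / Mq - 1"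
  have pt: "norm (iexp (t * ?T \<omega>) - iexp (t * linear_stat \<omega>)) \<le> \<bar>t\<bar> * \<delta> * (1 + (linear_stat \<omega>)\<^sup>2) + 2 / \<delta>\<^sup>2 * (?D \<omega>)\<^sup>2" for \<omega>
  proof (cases "\<bar>?D \<omega>\<bar> \<le> \<delta>")
    case True
    let ?Q = "linear_stat \<omega>"
    have D: "\<bar>?m \<omega> - Mq\<bar> \<le> \<delta> * Mq"
    proof -
      have "\<bar>?m \<omega> - Mq\<bar> = \<bar>?D \<omega> * Mq\<bar>" using card_pos q0 by (simp add: left_diff_distrib)
      also have "\<dots> = \<bar>?D \<omega>\<bar> * Mq" using card_pos q0 by (simp add: abs_mult)
      also have "\<dots> \<le> \<delta> * Mq" using True Mq_pos by (intro mult_right_mono) auto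
      finally show ?thesis .
    qed
    moreover have "\<delta> * Mq \<le> 1/2 * Mq" using d Mq_pos by (intro mult_right_mono) auto
    ultimately have half: "?m \<omega> \<ge> Mq / 2" by (auto simp: abs_le_iff)
    then have mp: "?m \<omega> > 0" using Mq_pos by linarith
    have "(\<Sum>S\<in>J. if fst (\<omega> S) then \<theta> + h S (snd (\<omega> S)) else 0)
       = (\<Sum>S\<in>J. if fst (\<omega> S) then \<theta> else 0) + (\<Sum>S\<in>J. if fst (\<omega> S) then h S (snd (\<omega> S)) else 0)"
      unfolding sum.distrib[symmetric] by (intro sum.cong) auto
    also have "(\<Sum>S\<in>J. if fst (\<omega> S) then \<theta> else 0) = ?m \<omega> * \<theta>"
      using finJ by (subst sum.inter_filter[symmetric]) auto
    also have "(\<Sum>S\<in>J. if fst (\<omega> S) then h S (snd (\<omega> S)) else 0) = ?Q * (Mq * s)"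
      using card_pos q0 s by (simp add: linear_stat_def)
    finally have "?T \<omega> = ?Q * (Mq / ?m \<omega>)"
      using mp s by (simp add: ratio_def field_simps)
    then have diff: "?T \<omega> - ?Q = ?Q * ((Mq - ?m \<omega>) / ?m \<omega>)"
      using mp by (simp add: field_simps)
    have "\<bar>(Mq - ?m \<omega>) / ?m \<omega>\<bar> \<le> (\<delta> * Mq) / (Mq / 2)"
      using D half mp Mq_pos d by (simp only: abs_divide, intro frac_le) (auto simp: abs_minus_commute)
    then have r: "\<bar>(Mq - ?m \<omega>) / ?m \<omega>\<bar> \<le> 2 * \<delta>" using card_pos q0 by simp
    have "norm (iexp (t * ?T \<omega>) - iexp (t * ?Q)) \<le> \<bar>t * ?T \<omega> - t * ?Q\<bar>" by (rule norm_iexp_diff_le)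
    also have "\<dots> = \<bar>t\<bar> * (\<bar>?Q\<bar> * \<bar>(Mq - ?m \<omega>) / ?m \<omega>\<bar>)"
      unfolding right_diff_distrib[symmetric] diff abs_mult ..
    also have "\<dots> \<le> \<bar>t\<bar> * (\<bar>?Q\<bar> * (2 * \<delta>))" by (intro mult_left_mono r) auto
    also have "\<dots> = \<bar>t\<bar> * \<delta> * (2 * \<bar>?Q\<bar>)" by simp
    also have "\<dots> \<le> \<bar>t\<bar> * \<delta> * (1 + ?Q\<^sup>2)"
      using sum_squares_bound[of 1 "\<bar>?Q\<bar>"] d by (intro mult_left_mono) auto
    finally show ?thesis by (simp add: add_increasing2)
  next
    case False
    then have "\<delta>\<^sup>2 \<le> (?D \<omega>)\<^sup>2" using d abs_le_square_iff[of \<delta> "?D \<omega>"] by simp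
    then have "1 \<le> (?D \<omega>)\<^sup>2 / \<delta>\<^sup>2" using d by (simp add: field_simps)
    then have "2 \<le> 2 / \<delta>\<^sup>2 * (?D \<omega>)\<^sup>2" by simp
    moreover have "norm (iexp (t * ?T \<omega>) - iexp (t * linear_stat \<omega>)) \<le> 2"
      using norm_triangle_ineq4[of "iexp (t * ?T \<omega>)" "iexp (t * linear_stat \<omega>)"]
      by (simp only: norm_exp_i_times)
    moreover have "0 \<le> \<bar>t\<bar> * \<delta> * (1 + (linear_stat \<omega>)\<^sup>2)" using d by simp
    ultimately show ?thesis by linarith
  qed
  have meas1[measurable]: "linear_stat \<in> borel_measurable \<Omega>"
  proof -
    have [measurable]: "(\<lambda>\<omega>. if fst (\<omega> S) then h S (snd (\<omega> S)) / (Mq * s) else 0) \<in> borel_measurable \<Omega>" if "S \<in> J" for S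
      using meas_coord[OF that, of "\<lambda>x. if fst x then h S (snd x) / (Mq * s) else 0"] .
    show ?thesis unfolding linear_stat_eq[abs_def] by measurable
  qed
  have i1: "integrable \<Omega> (\<lambda>\<omega>. iexp (t * ?T \<omega>))" "integrable \<Omega> (\<lambda>\<omega>. iexp (t * linear_stat \<omega>))"
    by (intro Om.integrable_iexp; simp)+
  have "norm ((\<integral>\<omega>. iexp (t * ?T \<omega>) \<partial>\<Omega>) - (\<integral>\<omega>. iexp (t * linear_stat \<omega>) \<partial>\<Omega>))
    = norm (\<integral>\<omega>. iexp (t * ?T \<omega>) - iexp (t * linear_stat \<omega>) \<partial>\<Omega>)"
    using i1 by simp
  also have "\<dots> \<le> (\<integral>\<omega>. norm (iexp (t * ?T \<omega>) - iexp (t * linear_stat \<omega>)) \<partial>\<Omega>)"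
    by (rule integral_norm_bound)
  also have "\<dots> \<le> (\<integral>\<omega>. \<bar>t\<bar> * \<delta> * (1 + (linear_stat \<omega>)\<^sup>2) + 2 / \<delta>\<^sup>2 * (?D \<omega>)\<^sup>2 \<partial>\<Omega>)"
    by (intro integral_mono pt) (use i1 linear_stat_second_moment(1) selected_fraction_variance(1) in auto)
  also have "\<dots> = \<bar>t\<bar> * \<delta> * (1 + (\<integral>\<omega>. (linear_stat \<omega>)\<^sup>2 \<partial>\<Omega>)) + 2 / \<delta>\<^sup>2 * (\<integral>\<omega>. (?D \<omega>)\<^sup>2 \<partial>\<Omega>)"
    using linear_stat_second_moment(1) selected_fraction_variance(1) by (simp add: Om.prob_space)
  also have "\<dots> \<le> \<bar>t\<bar> * \<delta> * (1 + (mean (\<lambda>S y. (h S y)\<^sup>2) / (Mq * s\<^sup>2) + (mean h / s)\<^sup>2)) + 2 / \<delta>\<^sup>2 * (1 / Mq)"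
    using d by (intro add_mono mult_left_mono linear_stat_second_moment(2) selected_fraction_variance(2)) auto
  finally show ?thesis by (simp add: add.assoc)
qed

end

end

section \<open>Derangements and subsets of fixed size\<close>

lemma derangementsD:
  assumes "\<pi> \<in> derangements S"
  shows "\<pi> permutes S" "i \<in> S \<Longrightarrow> \<pi> i \<noteq> i" "i \<in> S \<Longrightarrow> \<pi> i \<in> S" "inj \<pi>"
  using assms permutes_in_image[of \<pi> S i] permutes_inj[of \<pi> S] by (auto simp: derangements_def)

lemma finite_derangements: "finite S \<Longrightarrow> finite (derangements S)"
  by (rule finite_subset[OF _ finite_permutations]) (auto simp: derangements_def)

text \<open>The new point \<open>x\<close> is spliced into the cycle of \<open>y\<close>: since
  \<open>\<pi>\<close> fixes \<open>x\<close>, the composite sends \<open>y\<close> to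
  \<open>x\<close> and \<open>x\<close> to \<open>\<pi> y\<close>.\<close>

lemma derangements_insert:
  assumes "\<pi> \<in> derangements S" "x \<notin> S" "y \<in> S"
  shows "\<pi> \<circ> Transposition.transpose x y \<in> derangements (insert x S)"
proof -
  have "\<pi> permutes insert x S"
    using assms by (auto simp: derangements_def intro: permutes_subset)
  moreover have "Transposition.transpose x y permutes insert x S" using assms by (intro permutes_swap_id) auto
  ultimately have "\<pi> \<circ> Transposition.transpose x y permutes insert x S" by (intro permutes_compose)
  moreover have "\<pi> x = x" using assms by (auto simp: derangements_def permutes_def)
  ultimately show ?thesis
    using assms derangementsD[OF assms(1)] by (auto simp: derangements_def Transposition.transpose_def)
qed

text \<open>Needed for \<open>pmf_of_set\<close> to be the uniform law. Two points are swapped, and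
  further points are spliced into an existing cycle.\<close>

lemma derangements_nonempty:
  assumes "finite S" "card S \<ge> 2"
  shows "derangements S \<noteq> {}"
  using assms
proof (induction S rule: finite_induct)
  case (insert x S)
  show ?case
  proof (cases "card S \<ge> 2")
    case True
    then obtain \<pi> where "\<pi> \<in> derangements S" using insert by blast
    moreover obtain y where "y \<in> S" using True by fastforce
    ultimately show ?thesis using derangements_insert[of \<pi> S x y] insert by blast
  next
    case False
    then have "card S = 1" using insert by simp
    then obtain y where y: "S = {y}" by (auto simp: card_1_singleton_iff)
    then have "Transposition.transpose x y \<in> derangements (insert x S)"
      using insert by (auto simp: derangements_def Transposition.transpose_def intro: permutes_swap_id)
    then show ?thesis by blast
  qed
qed simp

lemma map_permutation_derangement:
  assumes b: "bij_betw b A B" and s: "\<sigma> \<in> derangements A"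
  shows "map_permutation A b \<sigma> \<in> derangements B"
proof -
  have "map_permutation A b \<sigma> permutes B"
    by (rule map_permutation_permutes[OF b]) (use s in \<open>auto simp: derangements_def\<close>)
  moreover have "map_permutation A b \<sigma> y \<noteq> y" if y: "y \<in> B" for y
  proof -
    obtain x where x: "x \<in> A" "y = b x" using y b by (auto simp: bij_betw_def)
    have "map_permutation A b \<sigma> y = b (\<sigma> x)"
      using map_permutation_apply[of b A x \<sigma>] b x by (auto simp: bij_betw_def)
    moreover have "b (\<sigma> x) \<noteq> b x"
      using derangementsD(2,3)[OF s x(1)] x b by (metis bij_betw_def inj_onD)
    ultimately show ?thesis using x by simp
  qed
  ultimately show ?thesis using b by (auto simp: derangements_def bij_betw_def)
qed

text \<open>Conjugation by a bijection preserves the absence of fixed points. This transports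
  averages over the derangements of an arbitrary subset to those of
  \<open>{..<\<gamma>}\<close>.\<close>

lemma bij_betw_derangements:
  assumes b: "bij_betw b A B"
  shows "bij_betw (map_permutation A b) (derangements A) (derangements B)"
proof (rule bij_betw_byWitness[where f' = "map_permutation B (inv_into A b)"])
  have bi: "bij_betw (inv_into A b) B A" using b by (rule bij_betw_inv_into)
  show "\<forall>\<sigma>\<in>derangements A. map_permutation B (inv_into A b) (map_permutation A b \<sigma>) = \<sigma>"
    using map_permutation_compose_inv[OF b, of _ "inv_into A b"] bij_betw_inv_into_left[OF b]
    by (auto simp: derangements_def)
  show "\<forall>\<sigma>\<in>derangements B. map_permutation A b (map_permutation B (inv_into A b) \<sigma>) = \<sigma>"
    using map_permutation_compose_inv[OF bi, of _ b] bij_betw_inv_into_right[OF b]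
    by (auto simp: derangements_def)
  show "map_permutation A b ` derangements A \<subseteq> derangements B"
    using map_permutation_derangement[OF b] by blast
  show "map_permutation B (inv_into A b) ` derangements B \<subseteq> derangements A"
    using map_permutation_derangement[OF bi] by blast
qed

lemma subsets_ofD: "S \<in> subsets_of n \<gamma> \<Longrightarrow> S \<subseteq> {..<n} \<and> card S = \<gamma> \<and> finite S"
  by (auto simp: subsets_of_def intro: finite_subset)

lemma finite_subsets_of: "finite (subsets_of n \<gamma>)"
  by (rule finite_subset[of _ "Pow {..<n}"]) (auto simp: subsets_of_def)

lemma card_subsets_of: "card (subsets_of n \<gamma>) = n choose \<gamma>"
  using n_subsets[of "{..<n}" \<gamma>] by (simp add: subsets_of_def)

lemma card_subsets_containing:
  assumes "finite A" "B \<subseteq> A" "card B \<le> k"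
  shows "card {S. S \<subseteq> A \<and> card S = k \<and> B \<subseteq> S} = (card A - card B) choose (k - card B)"
proof -
  have fB: "finite B" using assms finite_subset by blast
  have "bij_betw (\<lambda>S. S - B) {S. S \<subseteq> A \<and> card S = k \<and> B \<subseteq> S} {T. T \<subseteq> A - B \<and> card T = k - card B}"
  proof (rule bij_betw_byWitness[where f' = "\<lambda>T. T \<union> B"])
    show "(\<lambda>S. S - B) ` {S. S \<subseteq> A \<and> card S = k \<and> B \<subseteq> S} \<subseteq> {T. T \<subseteq> A - B \<and> card T = k - card B}"
      using fB by (auto simp: card_Diff_subset)
    show "(\<lambda>T. T \<union> B) ` {T. T \<subseteq> A - B \<and> card T = k - card B} \<subseteq> {S. S \<subseteq> A \<and> card S = k \<and> B \<subseteq> S}"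
    proof safe
      fix T assume T: "T \<subseteq> A - B" "card T = k - card B"
      then have "finite T" using assms finite_subset by blast
      then have "card (T \<union> B) = card T + card B" using T fB by (intro card_Un_disjoint) auto
      then show "card (T \<union> B) = k" using T assms by simp
    qed (use assms in auto)
  qed auto
  then have "card {S. S \<subseteq> A \<and> card S = k \<and> B \<subseteq> S} = card {T. T \<subseteq> A - B \<and> card T = k - card B}"
    by (rule bij_betw_same_card)
  also have "\<dots> = (card A - card B) choose (k - card B)"
    using n_subsets[of "A - B" "k - card B"] assms fB by (simp add: card_Diff_subset)
  finally show ?thesis .
qed

lemma card_subsets_of_containing1:
  assumes "i < n" "1 \<le> \<gamma>"
  shows "real n * real (card {S\<in>subsets_of n \<gamma>. i \<in> S}) = real \<gamma> * real (n choose \<gamma>)"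
proof -
  have "{S\<in>subsets_of n \<gamma>. i \<in> S} = {S. S \<subseteq> {..<n} \<and> card S = \<gamma> \<and> {i} \<subseteq> S}"
    by (auto simp: subsets_of_def)
  then have "card {S\<in>subsets_of n \<gamma>. i \<in> S} = (n - 1) choose (\<gamma> - 1)"
    using card_subsets_containing[of "{..<n}" "{i}" \<gamma>] assms by simp
  moreover have "\<gamma> * (n choose \<gamma>) = n * ((n - 1) choose (\<gamma> - 1))"
    using times_binomial_minus1_eq[of \<gamma> n] assms by simp
  ultimately show ?thesis by (metis of_nat_mult)
qed

text \<open>Two uses of the absorption identity give the exact count (n choose \<gamma>) * \<gamma>
  (\<gamma> - 1) / (n (n - 1)), and (\<gamma> - 1) / (n - 1) is at most \<gamma> / n because
  \<gamma> is at most n.\<close>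

lemma card_subsets_of_containing2:
  assumes "i < n" "l < n" "i \<noteq> l" "2 \<le> \<gamma>" "\<gamma> \<le> n"
  shows "real (card {S\<in>subsets_of n \<gamma>. i \<in> S \<and> l \<in> S}) \<le> (real \<gamma>)\<^sup>2 * real (n choose \<gamma>) / (real n)\<^sup>2"
proof -
  have "{S\<in>subsets_of n \<gamma>. i \<in> S \<and> l \<in> S} = {S. S \<subseteq> {..<n} \<and> card S = \<gamma> \<and> {i, l} \<subseteq> S}"
    by (auto simp: subsets_of_def)
  then have c: "card {S\<in>subsets_of n \<gamma>. i \<in> S \<and> l \<in> S} = (n - 2) choose (\<gamma> - 2)"
    using card_subsets_containing[of "{..<n}" "{i, l}" \<gamma>] assms by (simp add: numeral_2_eq_2)
  have 1: "\<gamma> * (n choose \<gamma>) = n * ((n - 1) choose (\<gamma> - 1))"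
    using times_binomial_minus1_eq[of \<gamma> n] assms by simp
  have 2: "(\<gamma> - 1) * ((n - 1) choose (\<gamma> - 1)) = (n - 1) * ((n - 2) choose (\<gamma> - 2))"
    using times_binomial_minus1_eq[of "\<gamma> - 1" "n - 1"] assms by (simp add: numeral_2_eq_2)
  have g: "real (\<gamma> - 1) = real \<gamma> - 1" "real (n - 1) = real n - 1" using assms by auto
  define a where "a = real ((n - 2) choose (\<gamma> - 2))"
  define b where "b = real ((n - 1) choose (\<gamma> - 1))"
  have e1: "real \<gamma> * real (n choose \<gamma>) = real n * b" using 1 unfolding b_def by (metis of_nat_mult)
  have e2: "(real \<gamma> - 1) * b = (real n - 1) * a" using 2 unfolding a_def b_def g[symmetric] by (metis of_nat_mult)
  have "real n * (real \<gamma> - 1) \<le> real \<gamma> * (real n - 1)" using assms by (simp add: algebra_simps)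
  then have "real n * (real \<gamma> - 1) * b \<le> real \<gamma> * (real n - 1) * b" by (intro mult_right_mono) (auto simp: b_def)
  moreover have "real n * (real \<gamma> - 1) * b = (real n - 1) * (real n * a)" using e2 by algebra
  ultimately have "(real n - 1) * (real n * a) \<le> real \<gamma> * (real n - 1) * b" by (simp only:)
  then have "(real n - 1) * (real n * a) \<le> (real n - 1) * (real \<gamma> * b)" by (simp only: mult_ac)
  then have "real n * a \<le> real \<gamma> * b" using assms by simp
  then have "real n * (real n * a) \<le> real n * (real \<gamma> * b)" by (intro mult_left_mono) auto
  also have "\<dots> = (real \<gamma>)\<^sup>2 * real (n choose \<gamma>)" using e1 by (simp add: power2_eq_square mult_ac)
  finally show ?thesis using assms unfolding c a_def[symmetric] by (simp add: field_simps power2_eq_square)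
qed

text \<open>Double counting: each index lies in the same fraction \<gamma> / n of the subsets.
  Consequently the linear part of the complete statistic is exactly an i.i.d. mean.\<close>

lemma sum_over_subsets:
  fixes x :: "nat \<Rightarrow> real"
  assumes "1 \<le> \<gamma>" "n > 0"
  shows "(\<Sum>S\<in>subsets_of n \<gamma>. \<Sum>i\<in>S. x i) = real \<gamma> * real (n choose \<gamma>) / real n * (\<Sum>i<n. x i)"
proof -
  have "(\<Sum>S\<in>subsets_of n \<gamma>. \<Sum>i\<in>S. x i) = (\<Sum>S\<in>subsets_of n \<gamma>. \<Sum>i<n. if i \<in> S then x i else 0)"
  proof (rule sum.cong[OF refl])
    fix S assume "S \<in> subsets_of n \<gamma>"
    then have "{..<n} \<inter> S = S" using subsets_ofD by blast
    then show "(\<Sum>i\<in>S. x i) = (\<Sum>i<n. if i \<in> S then x i else 0)"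
      by (subst sum.inter_restrict[symmetric]) auto
  qed
  also have "\<dots> = (\<Sum>i<n. \<Sum>S\<in>subsets_of n \<gamma>. if i \<in> S then x i else 0)" by (rule sum.swap)
  also have "\<dots> = (\<Sum>i<n. real \<gamma> * real (n choose \<gamma>) / real n * x i)"
  proof (intro sum.cong refl)
    fix i assume "i \<in> {..<n}"
    then have i: "i < n" by simp
    have "(\<Sum>S\<in>subsets_of n \<gamma>. if i \<in> S then x i else 0) = real (card {S\<in>subsets_of n \<gamma>. i \<in> S}) * x i"
      by (subst sum.inter_filter[symmetric]) (auto simp: finite_subsets_of)
    also have "real (card {S\<in>subsets_of n \<gamma>. i \<in> S}) = real \<gamma> * real (n choose \<gamma>) / real n"
      using card_subsets_of_containing1[OF i assms(1)] i by (simp add: field_simps)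
    finally show "(\<Sum>S\<in>subsets_of n \<gamma>. if i \<in> S then x i else 0) = real \<gamma> * real (n choose \<gamma>) / real n * x i" .
  qed
  finally show ?thesis by (simp add: sum_distrib_left)
qed

text \<open>The indicator of meeting is at most the number of common elements, and summing that
  number is double counting.\<close>

lemma card_meeting_pairs:
  assumes "1 \<le> \<gamma>" "n > 0"
  shows "(\<Sum>S\<in>subsets_of n \<gamma>. \<Sum>T\<in>subsets_of n \<gamma>. if S \<inter> T = {} then 0 else 1)
    \<le> (real \<gamma>)\<^sup>2 * (real (n choose \<gamma>))\<^sup>2 / real n"
proof -
  have "(\<Sum>S\<in>subsets_of n \<gamma>. \<Sum>T\<in>subsets_of n \<gamma>. if S \<inter> T = {} then 0 else 1 :: real)
      \<le> (\<Sum>S\<in>subsets_of n \<gamma>. \<Sum>T\<in>subsets_of n \<gamma>. \<Sum>i\<in>T. if i \<in> S then 1 else 0)"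
  proof (intro sum_mono)
    fix S T assume "T \<in> subsets_of n \<gamma>"
    then have fT: "finite T" using subsets_ofD by blast
    show "(if S \<inter> T = {} then 0 else 1 :: real) \<le> (\<Sum>i\<in>T. if i \<in> S then 1 else 0)"
    proof (cases "S \<inter> T = {}")
      case False
      then obtain i where i: "i \<in> T" "i \<in> S" by blast
      have "(if i \<in> S then 1 else 0 :: real) \<le> (\<Sum>i\<in>T. if i \<in> S then 1 else 0)"
        by (rule member_le_sum) (use i fT in auto)
      with i False show ?thesis by auto
    qed (simp add: sum_nonneg)
  qed
  also have "\<dots> = (\<Sum>S\<in>subsets_of n \<gamma>. real \<gamma> * real (n choose \<gamma>) / real n * real \<gamma>)"
  proof (intro sum.cong refl)
    fix S assume "S \<in> subsets_of n \<gamma>"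
    then have S: "S \<subseteq> {..<n}" "card S = \<gamma>" using subsets_ofD by blast+
    have "(\<Sum>i<n. if i \<in> S then 1 else 0 :: real) = real \<gamma>"
      using S by (simp add: sum.If_cases Int_absorb1)
    then show "(\<Sum>T\<in>subsets_of n \<gamma>. \<Sum>i\<in>T. if i \<in> S then 1 else 0) = real \<gamma> * real (n choose \<gamma>) / real n * real \<gamma>"
      using sum_over_subsets[OF assms, of "\<lambda>i. if i \<in> S then 1 else 0"] by simp
  qed
  also have "\<dots> = (real \<gamma>)\<^sup>2 * (real (n choose \<gamma>))\<^sup>2 / real n"
    by (simp add: card_subsets_of power2_eq_square)
  finally show ?thesis .
qed

section \<open>Moments of the centred permutation kernel\<close>

lemma (in prob_space) integrable_lower_powers:
  fixes f :: "'a \<Rightarrow> real"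
  assumes [measurable]: "f \<in> borel_measurable M" and i: "integrable M (\<lambda>x. f x ^ 4)"
  shows "integrable M f" "integrable M (\<lambda>x. (f x)\<^sup>2)" "integrable M (\<lambda>x. \<bar>f x\<bar> ^ 3)"
proof -
  have le: "y \<le> 1 + y ^ 4" "y\<^sup>2 \<le> 1 + y ^ 4" "y ^ 3 \<le> 1 + y ^ 4" if "y \<ge> 0" for y :: real
  proof -
    have "y ^ k \<le> 1 + y ^ 4" if "k \<le> 4" for k
    proof (cases "y \<le> 1")
      case True
      then have "y ^ k \<le> 1" using \<open>y \<ge> 0\<close> by (simp add: power_le_one)
      then show ?thesis by (smt (verit) zero_le_even_power even_numeral)
    next
      case False
      then have "y ^ k \<le> y ^ 4" using that by (intro power_increasing) auto
      then show ?thesis by simp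
    qed
    from this[of 1] this[of 2] this[of 3] show "y \<le> 1 + y ^ 4" "y\<^sup>2 \<le> 1 + y ^ 4" "y ^ 3 \<le> 1 + y ^ 4" by auto
  qed
  have I: "integrable M (\<lambda>x. 1 + f x ^ 4)" using i by simp
  have a: "\<bar>y\<bar> ^ 4 = y ^ 4" for y :: real by (simp add: power_even_abs)
  show "integrable M f"
    by (rule Bochner_Integration.integrable_bound[OF I]) (use le(1)[of "\<bar>f _\<bar>"] a in auto)
  show "integrable M (\<lambda>x. (f x)\<^sup>2)"
    by (rule Bochner_Integration.integrable_bound[OF I]) (use le(2)[of "\<bar>f _\<bar>"] a in auto)
  show "integrable M (\<lambda>x. \<bar>f x\<bar> ^ 3)"
    by (rule Bochner_Integration.integrable_bound[OF I]) (use le(3)[of "\<bar>f _\<bar>"] a in auto)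
qed

text \<open>The centred kernel with the regression stripped off: a linear part \<open>\<psi>\<close>
  and a coupling of \<open>\<beta>\<close> at one point with \<open>\<alpha>\<close> at another. The
  three functions may be arbitrarily dependent at the same point; the decoupling below comes from
  distinct points and vanishing means.\<close>

locale perm_kernel = prob_space Z for Z :: "'z measure" +
  fixes \<psi> \<alpha> \<beta> :: "'z \<Rightarrow> real"
  assumes psi_meas[measurable]: "\<psi> \<in> borel_measurable Z"
    and alpha_meas[measurable]: "\<alpha> \<in> borel_measurable Z"
    and beta_meas[measurable]: "\<beta> \<in> borel_measurable Z"
    and psi4: "integrable Z (\<lambda>z. \<psi> z ^ 4)" and alpha4: "integrable Z (\<lambda>z. \<alpha> z ^ 4)" and beta4: "integrable Z (\<lambda>z. \<beta> z ^ 4)"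
    and psi0: "(\<integral>z. \<psi> z \<partial>Z) = 0" and alpha0: "(\<integral>z. \<alpha> z \<partial>Z) = 0" and beta0: "(\<integral>z. \<beta> z \<partial>Z) = 0"
begin

definition "var\<psi> = (\<integral>z. (\<psi> z)\<^sup>2 \<partial>Z)"

definition kern :: "(nat \<Rightarrow> nat) \<Rightarrow> (nat \<Rightarrow> 'z) \<Rightarrow> nat \<Rightarrow> real" where
  "kern \<pi> z i = \<psi> (z i) + \<beta> (z i) * \<alpha> (z (\<pi> i))"

definition hc :: "nat set \<Rightarrow> (nat \<Rightarrow> 'z) \<Rightarrow> (nat \<Rightarrow> nat) \<Rightarrow> real" where
  "hc S z \<pi> = (\<Sum>i\<in>S. kern \<pi> z i) / real (card S)"

text \<open>The factor 8 is that of \<open>pow4_add_le\<close>. In \<open>C4\<close>, 135 is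
  \<open>3 * 3 ^ 2 + 4 * 3 ^ 3\<close>, the constant of
  \<open>fourth_moment_dependency_graph\<close> for degree 3. \<open>Cab\<close> is the bound of
  \<open>integrable_prod4\<close> for two factors \<open>\<beta>\<close> and two factors
  \<open>\<alpha>\<close>.\<close>

definition "Ckern = 8 * ((\<integral>z. \<psi> z ^ 4 \<partial>Z) + (\<integral>z. \<beta> z ^ 4 \<partial>Z) * (\<integral>z. \<alpha> z ^ 4 \<partial>Z))"
definition "C4 = Ckern * 135"
definition "Cab = ((\<integral>z. \<beta> z ^ 4 \<partial>Z) + (\<integral>z. \<alpha> z ^ 4 \<partial>Z)) / 2"

abbreviation "Pn I \<equiv> PiM I (\<lambda>_. Z)"

lemma Zp: "prob_space Z" by (rule prob_space_axioms)

lemma Pn_prob: "prob_space (Pn I)" by (intro prob_space_PiM Zp)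

lemma coord_meas[measurable (raw)]: "i \<in> I \<Longrightarrow> f \<in> borel_measurable Z \<Longrightarrow> (\<lambda>z. f (z i)) \<in> borel_measurable (Pn I)"
  for f :: "'z \<Rightarrow> real"
  by (rule measurable_compose[OF measurable_component_singleton]) auto

lemma coord_integral: "i \<in> I \<Longrightarrow> f \<in> borel_measurable Z \<Longrightarrow> (\<integral>z. f (z i) \<partial>Pn I) = (\<integral>x. f x \<partial>Z)"
  for f :: "'z \<Rightarrow> real"
  using integral_PiM_component(1)[of I "\<lambda>_. Z" i f] Zp by simp

lemma coord_integrable: "i \<in> I \<Longrightarrow> integrable Z f \<Longrightarrow> integrable (Pn I) (\<lambda>z. f (z i))"
  for f :: "'z \<Rightarrow> real"
  using integral_PiM_component(2)[of I "\<lambda>_. Z" i f] Zp by auto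

text \<open>The device that kills mixed moments: once some coordinate occurs only through a centred
  function, the whole integral vanishes.\<close>

lemma coord_factor:
  fixes f :: "'z \<Rightarrow> real" and G :: "(nat \<Rightarrow> 'z) \<Rightarrow> real"
  assumes "finite I" "i \<in> I" "integrable Z f" "integrable (Pn I) G" "depends_only B (space (Pn I)) G" "i \<notin> B"
  shows "integrable (Pn I) (\<lambda>z. f (z i) * G z)"
    and "(\<integral>z. f (z i) * G z \<partial>Pn I) = (\<integral>x. f x \<partial>Z) * (\<integral>z. G z \<partial>Pn I)"
proof -
  have d: "depends_only {i} (space (Pn I)) (\<lambda>z. f (z i))" by (simp add: depends_only_def)
  have A: "{i} \<subseteq> I" "{i} \<inter> B = {}" using assms by auto
  note * = integral_PiM_disjoint_mult[OF Zp assms(1) A coord_integrable[OF assms(2,3)] d assms(4,5)]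
  show "integrable (Pn I) (\<lambda>z. f (z i) * G z)" by (rule *(1))
  show "(\<integral>z. f (z i) * G z \<partial>Pn I) = (\<integral>x. f x \<partial>Z) * (\<integral>z. G z \<partial>Pn I)"
    using *(2) coord_integral[OF assms(2), of f] assms(3) by simp
qed

context
  fixes I S :: "nat set" and \<pi> :: "nat \<Rightarrow> nat"
  assumes finI: "finite I" and SI: "S \<subseteq> I" and der: "\<pi> \<in> derangements S"
begin

lemmas der_facts = derangementsD[OF der]

lemma inI: "i \<in> S \<Longrightarrow> i \<in> I" "i \<in> S \<Longrightarrow> \<pi> i \<in> I"
  using SI der_facts(3) by auto

lemma finS: "finite S" using finI SI finite_subset by blast

lemma kern_meas[measurable]: "i \<in> S \<Longrightarrow> (\<lambda>z. kern \<pi> z i) \<in> borel_measurable (Pn I)"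
  unfolding kern_def using inI by measurable

lemma prod_pow:
  assumes "i \<in> S"
  shows "integrable (Pn I) (\<lambda>z. (\<beta> (z i) * \<alpha> (z (\<pi> i))) ^ 4)"
    and "(\<integral>z. (\<beta> (z i) * \<alpha> (z (\<pi> i))) ^ 4 \<partial>Pn I) = (\<integral>z. \<beta> z ^ 4 \<partial>Z) * (\<integral>z. \<alpha> z ^ 4 \<partial>Z)"
proof -
  have d: "depends_only {\<pi> i} (space (Pn I)) (\<lambda>z. \<alpha> (z (\<pi> i)) ^ 4)" by (simp add: depends_only_def)
  have n: "i \<notin> {\<pi> i}" using der_facts(2)[OF assms] by auto
  note * = coord_factor[OF finI inI(1)[OF assms] beta4 coord_integrable[OF inI(2)[OF assms] alpha4] d n]
  show "integrable (Pn I) (\<lambda>z. (\<beta> (z i) * \<alpha> (z (\<pi> i))) ^ 4)"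
    using *(1) by (simp add: power_mult_distrib)
  show "(\<integral>z. (\<beta> (z i) * \<alpha> (z (\<pi> i))) ^ 4 \<partial>Pn I) = (\<integral>z. \<beta> z ^ 4 \<partial>Z) * (\<integral>z. \<alpha> z ^ 4 \<partial>Z)"
    using *(2) coord_integral[OF inI(2)[OF assms], of "\<lambda>z. \<alpha> z ^ 4"] by (simp add: power_mult_distrib)
qed

lemma prod_mean:
  assumes "i \<in> S"
  shows "(\<integral>z. \<beta> (z i) * \<alpha> (z (\<pi> i)) \<partial>Pn I) = 0"
proof -
  have d: "depends_only {\<pi> i} (space (Pn I)) (\<lambda>z. \<alpha> (z (\<pi> i)))" by (simp add: depends_only_def)
  have n: "i \<notin> {\<pi> i}" using der_facts(2)[OF assms] by auto
  show ?thesis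
    using coord_factor(2)[OF finI inI(1)[OF assms] integrable_lower_powers(1)[OF beta_meas beta4]
        coord_integrable[OF inI(2)[OF assms] integrable_lower_powers(1)[OF alpha_meas alpha4]] d n] beta0 by simp
qed

lemma kern4:
  assumes "i \<in> S"
  shows "integrable (Pn I) (\<lambda>z. kern \<pi> z i ^ 4)" "(\<integral>z. kern \<pi> z i ^ 4 \<partial>Pn I) \<le> Ckern"
proof -
  have R: "integrable (Pn I) (\<lambda>z. 8 * (\<psi> (z i) ^ 4 + (\<beta> (z i) * \<alpha> (z (\<pi> i))) ^ 4))"
    using coord_integrable[OF inI(1)[OF assms] psi4] prod_pow(1)[OF assms] by simp
  show int: "integrable (Pn I) (\<lambda>z. kern \<pi> z i ^ 4)"
  proof (rule Bochner_Integration.integrable_bound[OF R])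
    show "(\<lambda>z. kern \<pi> z i ^ 4) \<in> borel_measurable (Pn I)" using assms by measurable
    show "AE z in Pn I. norm (kern \<pi> z i ^ 4) \<le> norm (8 * (\<psi> (z i) ^ 4 + (\<beta> (z i) * \<alpha> (z (\<pi> i))) ^ 4))"
      using order_trans[OF pow4_add_le abs_ge_self]
      by (intro AE_I2) (simp only: kern_def real_norm_def abs_of_nonneg zero_le_even_power even_numeral)
  qed
  have "(\<integral>z. kern \<pi> z i ^ 4 \<partial>Pn I) \<le> (\<integral>z. 8 * (\<psi> (z i) ^ 4 + (\<beta> (z i) * \<alpha> (z (\<pi> i))) ^ 4) \<partial>Pn I)"
    by (intro integral_mono int R) (auto simp only: kern_def pow4_add_le)
  also have "\<dots> = Ckern"
    using coord_integrable[OF inI(1)[OF assms] psi4] prod_pow[OF assms] coord_integral[OF inI(1)[OF assms], of "\<lambda>z. \<psi> z ^ 4"]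
    by (simp add: Ckern_def)
  finally show "(\<integral>z. kern \<pi> z i ^ 4 \<partial>Pn I) \<le> Ckern" .
qed

lemma kern_mean:
  assumes "i \<in> S"
  shows "(\<integral>z. kern \<pi> z i \<partial>Pn I) = 0" "integrable (Pn I) (\<lambda>z. kern \<pi> z i)"
proof -
  interpret P: prob_space "Pn I" by (rule Pn_prob)
  have "integrable (Pn I) (\<lambda>z. \<beta> (z i) * \<alpha> (z (\<pi> i)))"
    using inI[OF assms] by (intro P.integrable_lower_powers(1)[OF _ prod_pow(1)[OF assms]]) measurable
  moreover have "integrable (Pn I) (\<lambda>z. \<psi> (z i))"
    by (intro coord_integrable inI assms integrable_lower_powers(1)[OF psi_meas psi4])
  ultimately show "(\<integral>z. kern \<pi> z i \<partial>Pn I) = 0" "integrable (Pn I) (\<lambda>z. kern \<pi> z i)"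
    unfolding kern_def using prod_mean[OF assms] coord_integral[OF inI(1)[OF assms] psi_meas] psi0
    by simp_all
qed

lemma kern_depends: "depends_only {i, \<pi> i} X (\<lambda>z. kern \<pi> z i)"
  by (auto simp: depends_only_def kern_def)

text \<open>The terms of indices \<open>i\<close> and \<open>k\<close> share a coordinate only if
  \<open>k\<close> is \<open>i\<close>, \<open>\<pi> i\<close> or the preimage of \<open>i\<close>,
  since \<open>\<pi>\<close> is injective. The dependency graph thus has degree at most 3, counting
  \<open>i\<close> itself, whatever the cycle structure of \<open>\<pi>\<close>, and the bound is
  uniform in \<open>\<pi>\<close>.\<close>

lemma hc_fourth_moment:
  "integrable (Pn I) (\<lambda>z. hc S z \<pi> ^ 4)"
  "S \<noteq> {} \<Longrightarrow> (\<integral>z. hc S z \<pi> ^ 4 \<partial>Pn I) \<le> C4 / (real (card S))\<^sup>2"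
proof -
  let ?nb = "\<lambda>i k. k = i \<or> k = \<pi> i \<or> i = \<pi> k"
  have zero: "(\<integral>z. kern \<pi> z i * kern \<pi> z k * kern \<pi> z l * kern \<pi> z m \<partial>Pn I) = 0"
    if S: "i \<in> S" "k \<in> S" "l \<in> S" "m \<in> S" and nb: "\<not> ?nb i k" "\<not> ?nb i l" "\<not> ?nb i m" for i k l m
  proof -
    interpret P: prob_space "Pn I" by (rule Pn_prob)
    have G: "integrable (Pn I) (\<lambda>z. kern \<pi> z k * kern \<pi> z l * kern \<pi> z m)"
      using integrable_prod4(1)[of "\<lambda>z. kern \<pi> z k" "Pn I" "\<lambda>z. kern \<pi> z l" "\<lambda>z. kern \<pi> z m" "\<lambda>_. 1"] kern4(1) S
      by simp
    have "(\<integral>z. kern \<pi> z i * (kern \<pi> z k * kern \<pi> z l * kern \<pi> z m) \<partial>Pn I)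
      = (\<integral>z. kern \<pi> z i \<partial>Pn I) * (\<integral>z. kern \<pi> z k * kern \<pi> z l * kern \<pi> z m \<partial>Pn I)"
    proof (rule integral_PiM_disjoint_mult(2)[OF Zp finI, of "{i, \<pi> i}" "{k, \<pi> k, l, \<pi> l, m, \<pi> m}"])
      show "{i, \<pi> i} \<inter> {k, \<pi> k, l, \<pi> l, m, \<pi> m} = {}"
        using nb injD[OF der_facts(4)] by auto
      show "depends_only {k, \<pi> k, l, \<pi> l, m, \<pi> m} (space (Pn I)) (\<lambda>z. kern \<pi> z k * kern \<pi> z l * kern \<pi> z m)"
        by (auto simp: depends_only_def kern_def)
    qed (use G kern_mean kern_depends S inI in auto)
    then show ?thesis using kern_mean(1)[OF S(1)] by (simp add: mult.assoc)
  qed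
  have deg: "card {k\<in>S. ?nb i k} \<le> 3" if "i \<in> S" for i
  proof -
    have "{k\<in>S. ?nb i k} \<subseteq> {i, \<pi> i, inv \<pi> i}"
      using permutes_inverses[OF der_facts(1)] by auto
    then have "card {k\<in>S. ?nb i k} \<le> card {i, \<pi> i, inv \<pi> i}" by (intro card_mono) auto
    also have "\<dots> \<le> 3" by (intro card_insert_le_m1 order_trans[OF card_insert_le_m1]) auto
    finally show ?thesis .
  qed
  have F: "integrable (Pn I) (\<lambda>z. (\<Sum>i\<in>S. kern \<pi> z i)^4)"
    "(\<integral>z. (\<Sum>i\<in>S. kern \<pi> z i)^4 \<partial>Pn I) \<le> Ckern * (3 * real 3 ^ 2 + 4 * real 3 ^ 3) * real (card S) ^ 2"
    using fourth_moment_dependency_graph[of S "\<lambda>i z. kern \<pi> z i" "Pn I" Ckern ?nb 3, OF finS kern_meas kern4 _ deg zero]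
    by auto
  show "integrable (Pn I) (\<lambda>z. hc S z \<pi> ^ 4)"
    unfolding hc_def power_divide using F(1) by simp
  assume "S \<noteq> {}"
  then have c: "real (card S) > 0" using finS by (simp add: card_gt_0_iff)
  have "(\<integral>z. hc S z \<pi> ^ 4 \<partial>Pn I) = (\<integral>z. (\<Sum>i\<in>S. kern \<pi> z i)^4 \<partial>Pn I) / real (card S) ^ 4"
    unfolding hc_def power_divide by simp
  also have "\<dots> \<le> (C4 * real (card S) ^ 2) / real (card S) ^ 4"
    using F(2) by (intro divide_right_mono) (auto simp: C4_def)
  also have "\<dots> = C4 / (real (card S))\<^sup>2" using c by (simp add: eval_nat_numeral)
  finally show "(\<integral>z. hc S z \<pi> ^ 4 \<partial>Pn I) \<le> C4 / (real (card S))\<^sup>2" .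
qed

lemma hc_meas[measurable]: "(\<lambda>z. hc S z \<pi>) \<in> borel_measurable (Pn I)"
  unfolding hc_def by measurable

lemma hc_mean: "(\<integral>z. hc S z \<pi> \<partial>Pn I) = 0" "integrable (Pn I) (\<lambda>z. hc S z \<pi>)"
  unfolding hc_def using kern_mean by (simp_all add: Bochner_Integration.integral_sum)

lemma hc_square_integrable: "integrable (Pn I) (\<lambda>z. (hc S z \<pi>)\<^sup>2)"
  by (intro prob_space.integrable_lower_powers(2)[OF Pn_prob hc_meas hc_fourth_moment(1)])

text \<open>The linear part \<open>A\<close> and the bilinear part \<open>B\<close> are orthogonal,
  so the second moment of their sum is at least that of \<open>A\<close>, which is
  \<open>card S * var\<psi>\<close>. No information on \<open>B\<close> is required for this
  direction.\<close>

lemma hc_second_moment_ge: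
  assumes "S \<noteq> {}"
  shows "var\<psi> / real (card S) \<le> (\<integral>z. (hc S z \<pi>)\<^sup>2 \<partial>Pn I)"
proof -
  interpret P: prob_space "Pn I" by (rule Pn_prob)
  define A where "A z = (\<Sum>i\<in>S. \<psi> (z i))" for z :: "nat \<Rightarrow> 'z"
  define B where "B z = (\<Sum>i\<in>S. \<beta> (z i) * \<alpha> (z (\<pi> i)))" for z :: "nat \<Rightarrow> 'z"
  have c: "real (card S) > 0" using finS assms by (simp add: card_gt_0_iff)
  note lp = integrable_lower_powers
  have A2: "integrable (Pn I) (\<lambda>z. (A z)\<^sup>2)" "(\<integral>z. (A z)\<^sup>2 \<partial>Pn I) = real (card S) * var\<psi>"
  proof -
    let ?f = "\<lambda>i x. if i \<in> S then \<psi> x else 0"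
    have e: "A z = (\<Sum>i\<in>I. ?f i (z i))" for z
      unfolding A_def using SI finI by (simp add: sum.inter_restrict[symmetric] Int_absorb1)
    have i: "integrable Z (?f i)" "integrable Z (\<lambda>x. (?f i x)\<^sup>2)" for i
      using lp[OF psi_meas psi4] by (cases "i \<in> S"; simp)+
    note sq = integral_PiM_sum_square[of "\<lambda>_. Z" I ?f, OF Zp finI i]
    show "integrable (Pn I) (\<lambda>z. (A z)\<^sup>2)" unfolding e by (rule sq(1))
    have m: "(\<integral>x. ?f i x \<partial>Z) = 0" for i using psi0 by (cases "i \<in> S") auto
    have v: "(\<integral>x. (?f i x)\<^sup>2 \<partial>Z) = (if i \<in> S then var\<psi> else 0)" for i by (auto simp: var\<psi>_def)
    have "(\<integral>z. (\<Sum>i\<in>I. ?f i (z i))\<^sup>2 \<partial>Pn I) = (\<Sum>i\<in>I. (\<integral>x. (?f i x)\<^sup>2 \<partial>Z) - (\<integral>x. ?f i x \<partial>Z)\<^sup>2) + (\<Sum>i\<in>I. \<integral>x. ?f i x \<partial>Z)\<^sup>2"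
      by (rule sq(2))
    also have "\<dots> = (\<Sum>i\<in>I. if i \<in> S then var\<psi> else 0)" unfolding m v by simp
    also have "\<dots> = real (card S) * var\<psi>" using SI finI by (simp add: sum.inter_restrict[symmetric] Int_absorb1)
    finally show "(\<integral>z. (A z)\<^sup>2 \<partial>Pn I) = real (card S) * var\<psi>" unfolding e .
  qed
  \<comment> \<open>Among the three points \<open>k\<close>, \<open>i\<close>,
    \<open>\<pi> i\<close>, one always occurs alone with a centred function: \<open>i\<close>
    through \<open>\<beta>\<close> if \<open>k\<close> differs from \<open>i\<close>, and
    \<open>\<pi> i\<close> through \<open>\<alpha>\<close> if \<open>k\<close> equals
    \<open>i\<close>.\<close>
  have tri: "integrable (Pn I) (\<lambda>z. \<psi> (z k) * (\<beta> (z i) * \<alpha> (z (\<pi> i)))) \<and>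
      (\<integral>z. \<psi> (z k) * (\<beta> (z i) * \<alpha> (z (\<pi> i))) \<partial>Pn I) = 0" if "k \<in> S" "i \<in> S" for k i
  proof -
    have ab: "integrable (Pn I) (\<lambda>z. f (z a) * g (z b))"
      if "a \<in> I" "b \<in> I" "f \<in> borel_measurable Z" "g \<in> borel_measurable Z" "integrable Z (\<lambda>x. f x ^ 4)" "integrable Z (\<lambda>x. g x ^ 4)"
      for f g :: "'z \<Rightarrow> real" and a b
      using integrable_prod4(1)[of "\<lambda>z. f (z a)" "Pn I" "\<lambda>z. g (z b)" "\<lambda>_. 1" "\<lambda>_. 1"] that
        coord_integrable[of a I "\<lambda>x. f x ^ 4"] coord_integrable[of b I "\<lambda>x. g x ^ 4"] by simp
    note mem = inI[OF that(1)] inI[OF that(2)]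
    show ?thesis
    proof (cases "k = i")
      case False
      have "integrable (Pn I) (\<lambda>z. \<beta> (z i) * (\<psi> (z k) * \<alpha> (z (\<pi> i)))) \<and>
        (\<integral>z. \<beta> (z i) * (\<psi> (z k) * \<alpha> (z (\<pi> i))) \<partial>Pn I) = 0"
      proof -
        have d: "depends_only {k, \<pi> i} (space (Pn I)) (\<lambda>z. \<psi> (z k) * \<alpha> (z (\<pi> i)))" by (simp add: depends_only_def)
        have n: "i \<notin> {k, \<pi> i}" using der_facts(2)[OF that(2)] False by auto
        show ?thesis
          using coord_factor[OF finI mem(3) lp(1)[OF beta_meas beta4] ab[OF mem(1,4) psi_meas alpha_meas psi4 alpha4] d n] beta0
          by simp
      qed
      then show ?thesis by (simp add: mult_ac)
    next
      case True
      have "integrable (Pn I) (\<lambda>z. \<alpha> (z (\<pi> i)) * (\<psi> (z k) * \<beta> (z i))) \<and>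
        (\<integral>z. \<alpha> (z (\<pi> i)) * (\<psi> (z k) * \<beta> (z i)) \<partial>Pn I) = 0"
      proof -
        have d: "depends_only {i} (space (Pn I)) (\<lambda>z. \<psi> (z k) * \<beta> (z i))" using True by (simp add: depends_only_def)
        have n: "\<pi> i \<notin> {i}" using der_facts(2)[OF that(2)] by auto
        show ?thesis
          using coord_factor[OF finI mem(4) lp(1)[OF alpha_meas alpha4] ab[OF mem(1,3) psi_meas beta_meas psi4 beta4] d n] alpha0
          by simp
      qed
      then show ?thesis by (simp add: mult_ac)
    qed
  qed
  have ABs: "A z * B z = (\<Sum>k\<in>S. \<Sum>i\<in>S. \<psi> (z k) * (\<beta> (z i) * \<alpha> (z (\<pi> i))))" for z
    unfolding A_def B_def by (rule sum_product)
  have AB: "integrable (Pn I) (\<lambda>z. A z * B z)" "(\<integral>z. A z * B z \<partial>Pn I) = 0"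
    unfolding ABs using tri by (simp_all add: Bochner_Integration.integral_sum)
  have hcAB: "hc S z \<pi> = (A z + B z) / real (card S)" for z
    by (simp add: hc_def A_def B_def kern_def sum.distrib)
  have "var\<psi> / real (card S) = (\<integral>z. (A z)\<^sup>2 + 2 * (A z * B z) \<partial>Pn I) / (real (card S))\<^sup>2"
    using A2 AB c by (simp add: power2_eq_square)
  also have "\<dots> = (\<integral>z. ((A z)\<^sup>2 + 2 * (A z * B z)) / (real (card S))\<^sup>2 \<partial>Pn I)" by simp
  also have "\<dots> \<le> (\<integral>z. (hc S z \<pi>)\<^sup>2 \<partial>Pn I)"
    by (intro integral_mono hc_square_integrable) (use A2 AB c in \<open>auto simp: hcAB power_divide power2_sum intro!: divide_right_mono\<close>)
  finally show ?thesis .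
qed

end

end

section \<open>Averages over derangements and over subsets\<close>

context perm_kernel begin

definition EPi :: "nat set \<Rightarrow> ((nat \<Rightarrow> nat) \<Rightarrow> real) \<Rightarrow> real" where
  "EPi S f = (\<integral>\<pi>. f \<pi> \<partial>measure_pmf (pmf_of_set (derangements S)))"

text \<open>The variance of the kernel, \<open>\<zeta>\<^sub>\<gamma>\<close> of the paper.\<close>

definition zt :: "nat \<Rightarrow> real" where
  "zt \<gamma> = EPi {..<\<gamma>} (\<lambda>\<sigma>. \<integral>z. (hc {..<\<gamma>} z \<sigma>)\<^sup>2 \<partial>Pn {..<\<gamma>})"

lemma EPi_eq:
  assumes "finite S" "card S \<ge> 2"
  shows "EPi S f = (\<Sum>\<pi>\<in>derangements S. f \<pi>) / real (card (derangements S))"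
  unfolding EPi_def
  using integral_pmf_of_set[of "derangements S" f] derangements_nonempty[OF assms] finite_derangements[OF assms(1)] by simp

lemma card_derangements_pos:
  assumes "finite S" "card S \<ge> 2"
  shows "real (card (derangements S)) > 0"
  using derangements_nonempty[OF assms] finite_derangements[OF assms(1)] by (simp add: card_gt_0_iff)

lemma EPi_mono:
  assumes "finite S" "card S \<ge> 2" "\<And>\<pi>. \<pi> \<in> derangements S \<Longrightarrow> f \<pi> \<le> g \<pi>"
  shows "EPi S f \<le> EPi S g"
  unfolding EPi_eq[OF assms(1,2)] by (intro divide_right_mono sum_mono assms(3)) auto

lemma EPi_const:
  assumes "finite S" "card S \<ge> 2"
  shows "EPi S (\<lambda>_. c) = c"
  unfolding EPi_def by simp

lemma EPi_cong:
  assumes "finite S" "card S \<ge> 2" "\<And>\<pi>. \<pi> \<in> derangements S \<Longrightarrow> f \<pi> = g \<pi>"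
  shows "EPi S f = EPi S g"
  unfolding EPi_eq[OF assms(1,2)] using assms(3) by (simp cong: sum.cong)

lemma EPi_integral:
  assumes "finite S" "card S \<ge> 2" "\<And>\<pi>. \<pi> \<in> derangements S \<Longrightarrow> integrable M (\<lambda>z. f z \<pi>)"
  shows "integrable M (\<lambda>z. EPi S (f z))" "(\<integral>z. EPi S (f z) \<partial>M) = EPi S (\<lambda>\<pi>. \<integral>z. f z \<pi> \<partial>M)"
  unfolding EPi_eq[OF assms(1,2)] using assms(3) by (simp_all add: Bochner_Integration.integral_sum)

lemma EPi_square_le:
  assumes "finite S" "card S \<ge> 2"
  shows "(EPi S f)\<^sup>2 \<le> EPi S (\<lambda>\<pi>. (f \<pi>)\<^sup>2)"
proof -
  have fin: "finite (set_pmf (pmf_of_set (derangements S)))"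
    using set_pmf_of_set[OF derangements_nonempty[OF assms] finite_derangements[OF assms(1)]]
      finite_derangements[OF assms(1)] by simp
  show ?thesis
    unfolding EPi_def
    by (intro measure_pmf.square_integral_le integrable_measure_pmf_finite fin)
qed

text \<open>Renaming the points of \<open>S\<close> along a bijection with
  \<open>{..<\<gamma>}\<close> conjugates the derangements and leaves the product law invariant, so
  the averaged second moment depends on \<open>S\<close> only through its size.\<close>

lemma zt_reindex:
  assumes fI: "finite I" and SI: "S \<subseteq> I" and g: "card S = \<gamma>" "\<gamma> \<ge> 2"
  shows "EPi S (\<lambda>\<pi>. \<integral>z. (hc S z \<pi>)\<^sup>2 \<partial>Pn I) = zt \<gamma>"
proof -
  have fS: "finite S" using fI SI finite_subset by blast
  let ?A = "{..<\<gamma>}"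
  obtain b where b: "bij_betw b ?A S"
    using fS g(1) by (metis atLeast0LessThan ex_bij_betw_nat_finite)
  let ?m = "map_permutation ?A b"
  have bij: "bij_betw ?m (derangements ?A) (derangements S)" by (rule bij_betw_derangements[OF b])
  have eq: "(\<integral>z. (hc S z (?m \<sigma>))\<^sup>2 \<partial>Pn I) = (\<integral>z. (hc ?A z \<sigma>)\<^sup>2 \<partial>Pn ?A)" if s: "\<sigma> \<in> derangements ?A" for \<sigma>
  proof -
    let ?r = "\<lambda>z. \<lambda>i\<in>?A. z (b i)"
    have "hc S z (?m \<sigma>) = hc ?A (?r z) \<sigma>" for z
    proof -
      have "(\<Sum>i\<in>S. kern (?m \<sigma>) z i) = (\<Sum>i\<in>?A. kern (?m \<sigma>) z (b i))"
        by (rule sum.reindex_bij_betw[OF b, symmetric])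
      also have "\<dots> = (\<Sum>i\<in>?A. kern \<sigma> (?r z) i)"
      proof (rule sum.cong[OF refl])
        fix i assume i: "i \<in> ?A"
        have "?m \<sigma> (b i) = b (\<sigma> i)" using map_permutation_apply[of b ?A i \<sigma>] b i by (auto simp: bij_betw_def)
        moreover have "\<sigma> i \<in> ?A" using derangementsD(3)[OF s i] .
        ultimately show "kern (?m \<sigma>) z (b i) = kern \<sigma> (?r z) i" using i by (simp add: kern_def)
      qed
      finally show ?thesis using g by (simp add: hc_def)
    qed
    moreover have "(\<integral>z. (hc ?A (?r z) \<sigma>)\<^sup>2 \<partial>Pn I) = (\<integral>z. (hc ?A z \<sigma>)\<^sup>2 \<partial>Pn ?A)"
    proof -
      have [measurable]: "(\<lambda>z. hc ?A z \<sigma>) \<in> borel_measurable (Pn ?A)"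
        by (rule hc_meas) (use s in auto)
      have bA: "inj_on b ?A" "b \<in> ?A \<rightarrow> I" using b SI by (auto simp: bij_betw_def)
      have D: "distr (Pn I) (Pn ?A) ?r = Pn ?A"
        by (rule distr_PiM_reindex[OF Zp bA])
      have [measurable]: "?r \<in> measurable (Pn I) (Pn ?A)"
        using bA by (intro measurable_restrict measurable_component_singleton) auto
      have "(\<integral>z. (hc ?A z \<sigma>)\<^sup>2 \<partial>distr (Pn I) (Pn ?A) ?r) = (\<integral>z. (hc ?A (?r z) \<sigma>)\<^sup>2 \<partial>Pn I)"
        by (rule integral_distr) auto
      then show ?thesis unfolding D by simp
    qed
    ultimately show ?thesis by simp
  qed
  have "(\<Sum>\<pi>\<in>derangements S. \<integral>z. (hc S z \<pi>)\<^sup>2 \<partial>Pn I) = (\<Sum>\<sigma>\<in>derangements ?A. \<integral>z. (hc S z (?m \<sigma>))\<^sup>2 \<partial>Pn I)"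
    by (rule sum.reindex_bij_betw[OF bij, symmetric])
  also have "\<dots> = (\<Sum>\<sigma>\<in>derangements ?A. \<integral>z. (hc ?A z \<sigma>)\<^sup>2 \<partial>Pn ?A)"
    using eq by (intro sum.cong) auto
  finally show ?thesis
    unfolding zt_def using bij_betw_same_card[OF bij] g fS by (simp add: EPi_eq)
qed

lemma C4_nonneg: "C4 \<ge> 0"
  unfolding C4_def Ckern_def by (auto intro!: mult_nonneg_nonneg add_nonneg_nonneg Bochner_Integration.integral_nonneg)

lemma Cab_nonneg: "Cab \<ge> 0"
  unfolding Cab_def by (auto intro!: add_nonneg_nonneg Bochner_Integration.integral_nonneg)

lemma zt_ge: "\<gamma> \<ge> 2 \<Longrightarrow> var\<psi> / real \<gamma> \<le> zt \<gamma>"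
  unfolding zt_def
  using EPi_mono[of "{..<\<gamma>}" "\<lambda>_. var\<psi> / real \<gamma>" "\<lambda>\<sigma>. \<integral>z. (hc {..<\<gamma>} z \<sigma>)\<^sup>2 \<partial>Pn {..<\<gamma>}"]
    hc_second_moment_ge[of "{..<\<gamma>}" "{..<\<gamma>}"] EPi_const[of "{..<\<gamma>}" "var\<psi> / real \<gamma>"]
  by (auto simp: lessThan_empty_iff)

lemma EPi_fourth:
  assumes fI: "finite I" and SI: "S \<subseteq> I" and g: "card S = \<gamma>" "\<gamma> \<ge> 2"
  shows "integrable (Pn I) (\<lambda>z. EPi S (\<lambda>\<pi>. hc S z \<pi> ^ 4))"
    "(\<integral>z. EPi S (\<lambda>\<pi>. hc S z \<pi> ^ 4) \<partial>Pn I) \<le> C4 / (real \<gamma>)\<^sup>2"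
proof -
  have fS: "finite S" using fI SI finite_subset by blast
  have ne: "S \<noteq> {}" using g by auto
  have c2: "card S \<ge> 2" using g by simp
  note E = EPi_integral[OF fS c2, of "Pn I" "\<lambda>z \<pi>. hc S z \<pi> ^ 4", OF hc_fourth_moment(1)[OF fI SI]]
  show "integrable (Pn I) (\<lambda>z. EPi S (\<lambda>\<pi>. hc S z \<pi> ^ 4))" by (rule E(1))
  have "EPi S (\<lambda>\<pi>. \<integral>z. hc S z \<pi> ^ 4 \<partial>Pn I) \<le> EPi S (\<lambda>_. C4 / (real (card S))\<^sup>2)"
    by (intro EPi_mono fS c2 hc_fourth_moment(2)[OF fI SI _ ne])
  then show "(\<integral>z. EPi S (\<lambda>\<pi>. hc S z \<pi> ^ 4) \<partial>Pn I) \<le> C4 / (real \<gamma>)\<^sup>2"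
    using E(2) EPi_const[OF fS c2] g by simp
qed

lemma EPi_second:
  assumes fI: "finite I" and SI: "S \<subseteq> I" and g: "card S = \<gamma>" "\<gamma> \<ge> 2"
  shows "integrable (Pn I) (\<lambda>z. EPi S (\<lambda>\<pi>. (hc S z \<pi>)\<^sup>2))"
    "(\<integral>z. EPi S (\<lambda>\<pi>. (hc S z \<pi>)\<^sup>2) \<partial>Pn I) = zt \<gamma>"
    "integrable (Pn I) (\<lambda>z. (EPi S (\<lambda>\<pi>. (hc S z \<pi>)\<^sup>2))\<^sup>2)"
    "(\<integral>z. (EPi S (\<lambda>\<pi>. (hc S z \<pi>)\<^sup>2))\<^sup>2 \<partial>Pn I) \<le> C4 / (real \<gamma>)\<^sup>2"
proof -
  have fS: "finite S" using fI SI finite_subset by blast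
  have c2: "card S \<ge> 2" using g by simp
  note E = EPi_integral[OF fS c2, of "Pn I" "\<lambda>z \<pi>. (hc S z \<pi>)\<^sup>2", OF hc_square_integrable[OF fI SI]]
  show 1: "integrable (Pn I) (\<lambda>z. EPi S (\<lambda>\<pi>. (hc S z \<pi>)\<^sup>2))" by (rule E(1))
  show "(\<integral>z. EPi S (\<lambda>\<pi>. (hc S z \<pi>)\<^sup>2) \<partial>Pn I) = zt \<gamma>"
    using E(2) zt_reindex[OF assms] by simp
  have le: "(EPi S (\<lambda>\<pi>. (hc S z \<pi>)\<^sup>2))\<^sup>2 \<le> EPi S (\<lambda>\<pi>. hc S z \<pi> ^ 4)" for z
    using EPi_square_le[OF fS c2, of "\<lambda>\<pi>. (hc S z \<pi>)\<^sup>2"] by (simp add: power_mult[symmetric])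
  show 3: "integrable (Pn I) (\<lambda>z. (EPi S (\<lambda>\<pi>. (hc S z \<pi>)\<^sup>2))\<^sup>2)"
    by (rule Bochner_Integration.integrable_bound[OF EPi_fourth(1)[OF assms]])
      (use 1 le in \<open>auto intro: order_trans[OF _ abs_ge_self]\<close>)
  have "(\<integral>z. (EPi S (\<lambda>\<pi>. (hc S z \<pi>)\<^sup>2))\<^sup>2 \<partial>Pn I) \<le> (\<integral>z. EPi S (\<lambda>\<pi>. hc S z \<pi> ^ 4) \<partial>Pn I)"
    by (intro integral_mono 3 EPi_fourth(1)[OF assms] le)
  with EPi_fourth(2)[OF assms] show "(\<integral>z. (EPi S (\<lambda>\<pi>. (hc S z \<pi>)\<^sup>2))\<^sup>2 \<partial>Pn I) \<le> C4 / (real \<gamma>)\<^sup>2" by simp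
qed

text \<open>By Jensen, the square of the averaged second moment is at most the averaged fourth
  moment. Together with \<open>zt_ge\<close> this fixes the order of \<open>zt \<gamma>\<close> as
  \<open>1 / \<gamma>\<close>.\<close>

lemma zt_le:
  assumes "\<gamma> \<ge> 2"
  shows "zt \<gamma> \<le> sqrt C4 / real \<gamma>"
proof -
  have "(zt \<gamma>)\<^sup>2 \<le> C4 / (real \<gamma>)\<^sup>2"
    using prob_space.square_integral_le[OF Pn_prob EPi_second(1,3)[of "{..<\<gamma>}" "{..<\<gamma>}" \<gamma>]]
      EPi_second(2,4)[of "{..<\<gamma>}" "{..<\<gamma>}" \<gamma>] assms by simp
  then have "zt \<gamma> \<le> sqrt (C4 / (real \<gamma>)\<^sup>2)" by (rule real_le_rsqrt)
  then show ?thesis by (simp add: real_sqrt_divide)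
qed

context
  fixes n \<gamma> :: nat
  assumes g2: "2 \<le> \<gamma>" and gn: "\<gamma> \<le> n"
begin

text \<open>\<open>Del\<close> is the difference between the derangement-averaged complete U-statistic and its Hajek projection.\<close>

definition "VV z = (\<Sum>S\<in>subsets_of n \<gamma>. EPi S (\<lambda>\<pi>. (hc S z \<pi>)\<^sup>2)) / real (n choose \<gamma>)"
definition "WW z = (\<Sum>S\<in>subsets_of n \<gamma>. EPi S (\<lambda>\<pi>. hc S z \<pi> ^ 4)) / real (n choose \<gamma>)"
definition "LL z = (\<Sum>S\<in>subsets_of n \<gamma>. EPi S (hc S z)) / real (n choose \<gamma>)"
definition "Del z = LL z - (\<Sum>i<n. \<psi> (z i)) / real n"

lemma Nn_pos: "real (n choose \<gamma>) > 0" using gn by simp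

lemma subsets_facts: "S \<in> subsets_of n \<gamma> \<Longrightarrow> finite {..<n} \<and> S \<subseteq> {..<n} \<and> card S = \<gamma> \<and> \<gamma> \<ge> 2 \<and> finite S \<and> card S \<ge> 2"
  using subsets_ofD[of S n \<gamma>] g2 by auto

lemma VV_int: "integrable (Pn {..<n}) VV" "(\<integral>z. VV z \<partial>Pn {..<n}) = zt \<gamma>"
proof -
  have "integrable (Pn {..<n}) (\<lambda>z. EPi S (\<lambda>\<pi>. (hc S z \<pi>)\<^sup>2)) \<and> (\<integral>z. EPi S (\<lambda>\<pi>. (hc S z \<pi>)\<^sup>2) \<partial>Pn {..<n}) = zt \<gamma>"
    if "S \<in> subsets_of n \<gamma>" for S
    using EPi_second(1,2)[of "{..<n}" S \<gamma>] subsets_facts[OF that] by blast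
  then show "integrable (Pn {..<n}) VV" "(\<integral>z. VV z \<partial>Pn {..<n}) = zt \<gamma>"
    unfolding VV_def[abs_def] using Nn_pos by (simp_all add: Bochner_Integration.integral_sum card_subsets_of)
qed

lemma WW_int: "integrable (Pn {..<n}) WW" "(\<integral>z. WW z \<partial>Pn {..<n}) \<le> C4 / (real \<gamma>)\<^sup>2"
proof -
  have *: "integrable (Pn {..<n}) (\<lambda>z. EPi S (\<lambda>\<pi>. hc S z \<pi> ^ 4)) \<and> (\<integral>z. EPi S (\<lambda>\<pi>. hc S z \<pi> ^ 4) \<partial>Pn {..<n}) \<le> C4 / (real \<gamma>)\<^sup>2"
    if "S \<in> subsets_of n \<gamma>" for S
    using EPi_fourth[of "{..<n}" S \<gamma>] subsets_facts[OF that] by blast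
  then show "integrable (Pn {..<n}) WW"
    unfolding WW_def[abs_def] by simp
  have "(\<integral>z. WW z \<partial>Pn {..<n}) = (\<Sum>S\<in>subsets_of n \<gamma>. \<integral>z. EPi S (\<lambda>\<pi>. hc S z \<pi> ^ 4) \<partial>Pn {..<n}) / real (n choose \<gamma>)"
    unfolding WW_def using * by (simp add: Bochner_Integration.integral_sum)
  also have "\<dots> \<le> (\<Sum>S\<in>subsets_of n \<gamma>. C4 / (real \<gamma>)\<^sup>2) / real (n choose \<gamma>)"
    using * by (intro divide_right_mono sum_mono) auto
  also have "\<dots> = C4 / (real \<gamma>)\<^sup>2" using Nn_pos by (simp add: card_subsets_of)
  finally show "(\<integral>z. WW z \<partial>Pn {..<n}) \<le> C4 / (real \<gamma>)\<^sup>2" .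
qed

text \<open>Summands of disjoint subsets are independent and contribute nothing. A meeting pair
  contributes at most \<open>C4 / \<gamma>\<^sup>2\<close>, and the proportion of such pairs is at
  most \<open>\<gamma>\<^sup>2 / n\<close>, so the powers of \<open>\<gamma>\<close> cancel.\<close>

lemma VV_variance:
  "integrable (Pn {..<n}) (\<lambda>z. (VV z - zt \<gamma>)\<^sup>2)" "(\<integral>z. (VV z - zt \<gamma>)\<^sup>2 \<partial>Pn {..<n}) \<le> C4 / real n"
proof -
  interpret P: prob_space "Pn {..<n}" by (rule Pn_prob)
  let ?J = "subsets_of n \<gamma>"
  let ?N = "real (n choose \<gamma>)"
  define D where "D S z = EPi S (\<lambda>\<pi>. (hc S z \<pi>)\<^sup>2) - zt \<gamma>" for S and z :: "nat \<Rightarrow> 'z"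
  have D1: "integrable (Pn {..<n}) (D S)" "(\<integral>z. D S z \<partial>Pn {..<n}) = 0"
    and D2: "integrable (Pn {..<n}) (\<lambda>z. (D S z)\<^sup>2)" "(\<integral>z. (D S z)\<^sup>2 \<partial>Pn {..<n}) \<le> C4 / (real \<gamma>)\<^sup>2" if "S \<in> ?J" for S
  proof -
    have E: "integrable (Pn {..<n}) (\<lambda>z. EPi S (\<lambda>\<pi>. (hc S z \<pi>)\<^sup>2))"
      "(\<integral>z. EPi S (\<lambda>\<pi>. (hc S z \<pi>)\<^sup>2) \<partial>Pn {..<n}) = zt \<gamma>"
      "integrable (Pn {..<n}) (\<lambda>z. (EPi S (\<lambda>\<pi>. (hc S z \<pi>)\<^sup>2))\<^sup>2)"
      "(\<integral>z. (EPi S (\<lambda>\<pi>. (hc S z \<pi>)\<^sup>2))\<^sup>2 \<partial>Pn {..<n}) \<le> C4 / (real \<gamma>)\<^sup>2"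
      using EPi_second[of "{..<n}" S \<gamma>] subsets_facts[OF that] by blast+
    show "integrable (Pn {..<n}) (D S)" "(\<integral>z. D S z \<partial>Pn {..<n}) = 0"
      unfolding D_def[abs_def] using E(1,2) by (simp_all add: P.prob_space)
    have e: "(D S z)\<^sup>2 = (EPi S (\<lambda>\<pi>. (hc S z \<pi>)\<^sup>2))\<^sup>2 - 2 * zt \<gamma> * EPi S (\<lambda>\<pi>. (hc S z \<pi>)\<^sup>2) + (zt \<gamma>)\<^sup>2" for z
      by (simp add: D_def power2_diff algebra_simps)
    show "integrable (Pn {..<n}) (\<lambda>z. (D S z)\<^sup>2)" unfolding e using E by simp
    have "(\<integral>z. (D S z)\<^sup>2 \<partial>Pn {..<n}) = (\<integral>z. (EPi S (\<lambda>\<pi>. (hc S z \<pi>)\<^sup>2))\<^sup>2 \<partial>Pn {..<n}) - (zt \<gamma>)\<^sup>2"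
      unfolding e using E by (simp add: P.prob_space power2_eq_square)
    also have "\<dots> \<le> C4 / (real \<gamma>)\<^sup>2" using E(4) by (smt (verit) zero_le_power2)
    finally show "(\<integral>z. (D S z)\<^sup>2 \<partial>Pn {..<n}) \<le> C4 / (real \<gamma>)\<^sup>2" .
  qed
  have dep: "depends_only S X (D S)" if "S \<in> ?J" for S X
  proof -
    have "EPi S (\<lambda>\<pi>. (hc S x \<pi>)\<^sup>2) = EPi S (\<lambda>\<pi>. (hc S y \<pi>)\<^sup>2)" if xy: "\<forall>i\<in>S. x i = y i" for x y
    proof (rule EPi_cong)
      fix \<pi> assume "\<pi> \<in> derangements S"
      then have "hc S x \<pi> = hc S y \<pi>"
        unfolding hc_def kern_def using xy derangementsD(3)[of \<pi> S]
        by (intro arg_cong2[where f="(/)"] sum.cong refl) auto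
      then show "(hc S x \<pi>)\<^sup>2 = (hc S y \<pi>)\<^sup>2" by simp
    qed (use subsets_facts[OF \<open>S \<in> ?J\<close>] in auto)
    then show ?thesis unfolding depends_only_def D_def by auto
  qed
  have DD: "integrable (Pn {..<n}) (\<lambda>z. D S z * D T z) \<and>
     (\<integral>z. D S z * D T z \<partial>Pn {..<n}) \<le> C4 / (real \<gamma>)\<^sup>2 * (if S \<inter> T = {} then 0 else 1)" if ST: "S \<in> ?J" "T \<in> ?J" for S T
  proof (cases "S \<inter> T = {}")
    case True
    have SS: "S \<subseteq> {..<n}" using subsets_facts[OF ST(1)] by blast
    show ?thesis
      using integral_PiM_disjoint_mult[OF Zp finite_lessThan SS True D1(1)[OF ST(1)] dep[OF ST(1)] D1(1)[OF ST(2)] dep[OF ST(2)]]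
        D1(2)[OF ST(1)] True by simp
  next
    case False
    have le: "\<bar>D S z * D T z\<bar> \<le> ((D S z)\<^sup>2 + (D T z)\<^sup>2) / 2" for z
      using sum_squares_bound[of "\<bar>D S z\<bar>" "\<bar>D T z\<bar>"] by (simp add: abs_mult)
    have I: "integrable (Pn {..<n}) (\<lambda>z. ((D S z)\<^sup>2 + (D T z)\<^sup>2) / 2)" using D2(1) ST by simp
    have int: "integrable (Pn {..<n}) (\<lambda>z. D S z * D T z)"
    proof (rule Bochner_Integration.integrable_bound[OF I])
      show "(\<lambda>z. D S z * D T z) \<in> borel_measurable (Pn {..<n})"
        using D1(1)[OF ST(1)] D1(1)[OF ST(2)] by (intro borel_measurable_times borel_measurable_integrable)
      show "AE z in Pn {..<n}. norm (D S z * D T z) \<le> norm (((D S z)\<^sup>2 + (D T z)\<^sup>2) / 2)"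
        using order_trans[OF le abs_ge_self] by (intro AE_I2) (simp only: real_norm_def)
    qed
    have "(\<integral>z. D S z * D T z \<partial>Pn {..<n}) \<le> (\<integral>z. ((D S z)\<^sup>2 + (D T z)\<^sup>2) / 2 \<partial>Pn {..<n})"
      by (intro integral_mono int I order_trans[OF abs_ge_self le])
    also have "\<dots> = ((\<integral>z. (D S z)\<^sup>2 \<partial>Pn {..<n}) + (\<integral>z. (D T z)\<^sup>2 \<partial>Pn {..<n})) / 2" using D2(1) ST by simp
    also have "\<dots> \<le> C4 / (real \<gamma>)\<^sup>2" using D2(2)[OF ST(1)] D2(2)[OF ST(2)] by argo
    finally show ?thesis using int False by simp
  qed
  have Vd: "(VV z - zt \<gamma>)\<^sup>2 = (\<Sum>S\<in>?J. \<Sum>T\<in>?J. D S z * D T z) / ?N\<^sup>2" for z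
  proof -
    have "VV z - zt \<gamma> = (\<Sum>S\<in>?J. D S z) / ?N"
      using Nn_pos unfolding VV_def D_def by (simp add: sum_subtractf card_subsets_of diff_divide_distrib)
    then show ?thesis by (simp add: power_divide power2_eq_square sum_product)
  qed
  show "integrable (Pn {..<n}) (\<lambda>z. (VV z - zt \<gamma>)\<^sup>2)" unfolding Vd using DD by simp
  have n0: "n > 0" using g2 gn by simp
  have "(\<integral>z. (VV z - zt \<gamma>)\<^sup>2 \<partial>Pn {..<n}) = (\<Sum>S\<in>?J. \<Sum>T\<in>?J. \<integral>z. D S z * D T z \<partial>Pn {..<n}) / ?N\<^sup>2"
    unfolding Vd using DD by (simp add: Bochner_Integration.integral_sum)
  also have "\<dots> \<le> (\<Sum>S\<in>?J. \<Sum>T\<in>?J. C4 / (real \<gamma>)\<^sup>2 * (if S \<inter> T = {} then 0 else 1)) / ?N\<^sup>2"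
    using DD by (intro divide_right_mono sum_mono) auto
  also have "\<dots> = C4 / (real \<gamma>)\<^sup>2 * (\<Sum>S\<in>?J. \<Sum>T\<in>?J. if S \<inter> T = {} then 0 else 1) / ?N\<^sup>2"
    unfolding sum_distrib_left ..
  also have "\<dots> \<le> C4 / (real \<gamma>)\<^sup>2 * ((real \<gamma>)\<^sup>2 * ?N\<^sup>2 / real n) / ?N\<^sup>2"
    using card_meeting_pairs[of \<gamma> n] g2 n0 C4_nonneg by (intro divide_right_mono mult_left_mono) auto
  also have "\<dots> = C4 / real n" using g2 Nn_pos by simp
  finally show "(\<integral>z. (VV z - zt \<gamma>)\<^sup>2 \<partial>Pn {..<n}) \<le> C4 / real n" .
qed

text \<open>After the linear parts cancel, \<open>Del\<close> is a bilinear form in the values of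
  \<open>\<beta>\<close> and \<open>\<alpha>\<close> with nonnegative weights \<open>c\<close> of
  total mass 1 and zero diagonal. In its second moment only a pair of indices with itself or with
  its reversal survives. This leaves at most \<open>Cab\<close> times twice the largest weight,
  which is of order \<open>\<gamma> / n\<^sup>2\<close>.\<close>

lemma Del_second_moment:
  "Del \<in> borel_measurable (Pn {..<n})"
  "integrable (Pn {..<n}) (\<lambda>z. (Del z)\<^sup>2)" "(\<integral>z. (Del z)\<^sup>2 \<partial>Pn {..<n}) \<le> 2 * Cab * real \<gamma> / (real n)\<^sup>2"
proof -
  interpret P: prob_space "Pn {..<n}" by (rule Pn_prob)
  let ?J = "subsets_of n \<gamma>"
  let ?N = "real (n choose \<gamma>)"
  have n0: "n > 0" using g2 gn by simp
  \<comment> \<open>\<open>c i l\<close> is the probability of drawing the pair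
    \<open>(i, l)\<close> when a subset, a point \<open>i\<close> of it and a derangement are drawn
    uniformly and \<open>l\<close> is the image of \<open>i\<close>.\<close>
  define c where "c i l = (\<Sum>S\<in>?J. EPi S (\<lambda>\<pi>. if i \<in> S \<and> \<pi> i = l then 1 else 0)) / (?N * real \<gamma>)" for i l :: nat
  have c0: "c i l \<ge> 0" for i l
    unfolding c_def EPi_def by (intro divide_nonneg_nonneg sum_nonneg Bochner_Integration.integral_nonneg) auto
  \<comment> \<open>The expectation under this law of pairs, for a general integrand: the constant 1
    gives the total mass, and the products of \<open>\<beta>\<close> and \<open>\<alpha>\<close>
    give \<open>Del\<close>.\<close>
  have expand: "(\<Sum>i<n. \<Sum>l<n. c i l * x i l) = (\<Sum>S\<in>?J. EPi S (\<lambda>\<pi>. \<Sum>i\<in>S. x i (\<pi> i))) / (?N * real \<gamma>)" for x :: "nat \<Rightarrow> nat \<Rightarrow> real"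
  proof -
    have "(\<Sum>i<n. \<Sum>l<n. c i l * x i l)
      = (\<Sum>i<n. \<Sum>l<n. \<Sum>S\<in>?J. EPi S (\<lambda>\<pi>. if i \<in> S \<and> \<pi> i = l then 1 else 0) * x i l) / (?N * real \<gamma>)"
      unfolding c_def by (simp add: sum_divide_distrib sum_distrib_right)
    also have "(\<Sum>i<n. \<Sum>l<n. \<Sum>S\<in>?J. EPi S (\<lambda>\<pi>. if i \<in> S \<and> \<pi> i = l then 1 else 0) * x i l)
      = (\<Sum>S\<in>?J. \<Sum>i<n. \<Sum>l<n. EPi S (\<lambda>\<pi>. if i \<in> S \<and> \<pi> i = l then 1 else 0) * x i l)"
      by (subst (2) sum.swap, subst (1) sum.swap) (intro sum.cong refl)
    also have "\<dots> = (\<Sum>S\<in>?J. EPi S (\<lambda>\<pi>. \<Sum>i\<in>S. x i (\<pi> i)))"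
    proof (rule sum.cong[OF refl])
      fix S assume "S \<in> ?J"
      note S = subsets_facts[OF this]
      have "(\<Sum>i<n. \<Sum>l<n. EPi S (\<lambda>\<pi>. if i \<in> S \<and> \<pi> i = l then 1 else 0) * x i l)
        = (\<Sum>\<pi>\<in>derangements S. \<Sum>i<n. \<Sum>l<n. (if i \<in> S \<and> \<pi> i = l then 1 else 0) * x i l) / real (card (derangements S))"
      proof -
        have "(\<Sum>\<pi>\<in>derangements S. \<Sum>i<n. \<Sum>l<n. (if i \<in> S \<and> \<pi> i = l then 1 else 0) * x i l)
          = (\<Sum>i<n. \<Sum>l<n. \<Sum>\<pi>\<in>derangements S. (if i \<in> S \<and> \<pi> i = l then 1 else 0) * x i l)"
          by (subst sum.swap, rule sum.cong[OF refl], rule sum.swap)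
        then show ?thesis
          using S by (simp only: EPi_eq sum_divide_distrib sum_distrib_right) (simp add: sum_divide_distrib sum_distrib_right)
      qed
      also have "\<dots> = (\<Sum>\<pi>\<in>derangements S. \<Sum>i\<in>S. x i (\<pi> i)) / real (card (derangements S))"
      proof (rule arg_cong[where f = "\<lambda>u. u / _"], rule sum.cong[OF refl])
        fix \<pi> assume p: "\<pi> \<in> derangements S"
        have "(\<Sum>i<n. \<Sum>l<n. (if i \<in> S \<and> \<pi> i = l then 1 else 0) * x i l) = (\<Sum>i<n. if i \<in> S then x i (\<pi> i) else 0)"
        proof (rule sum.cong[OF refl])
          fix i assume "i \<in> {..<n}"
          show "(\<Sum>l<n. (if i \<in> S \<and> \<pi> i = l then 1 else 0) * x i l) = (if i \<in> S then x i (\<pi> i) else 0)"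
          proof (cases "i \<in> S")
            case True
            then have "\<pi> i < n" using derangementsD(3)[OF p] S by blast
            have "(\<Sum>l<n. (if i \<in> S \<and> \<pi> i = l then 1 else 0) * x i l) = (\<Sum>l<n. if \<pi> i = l then x i l else 0)"
              using True by (intro sum.cong) auto
            with True \<open>\<pi> i < n\<close> show ?thesis by simp
          qed simp
        qed
        also have "\<dots> = (\<Sum>i\<in>{..<n} \<inter> S. x i (\<pi> i))" by (subst sum.inter_restrict) auto
        also have "{..<n} \<inter> S = S" using S by blast
        finally show "(\<Sum>i<n. \<Sum>l<n. (if i \<in> S \<and> \<pi> i = l then 1 else 0) * x i l) = (\<Sum>i\<in>S. x i (\<pi> i))" .
      qed
      also have "\<dots> = EPi S (\<lambda>\<pi>. \<Sum>i\<in>S. x i (\<pi> i))" using S by (simp add: EPi_eq)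
      finally show "(\<Sum>i<n. \<Sum>l<n. EPi S (\<lambda>\<pi>. if i \<in> S \<and> \<pi> i = l then 1 else 0) * x i l) = EPi S (\<lambda>\<pi>. \<Sum>i\<in>S. x i (\<pi> i))" .
    qed
    finally show ?thesis .
  qed
  have csum: "(\<Sum>i<n. \<Sum>l<n. c i l) = 1"
  proof -
    have "(\<Sum>i<n. \<Sum>l<n. c i l * 1) = (\<Sum>S\<in>?J. EPi S (\<lambda>\<pi>. \<Sum>i\<in>S. 1)) / (?N * real \<gamma>)" by (rule expand)
    also have "\<dots> = (\<Sum>S\<in>?J. real \<gamma>) / (?N * real \<gamma>)"
      using subsets_facts by (intro arg_cong[where f = "\<lambda>u. u / _"] sum.cong refl) (simp add: EPi_const)
    also have "\<dots> = 1" using Nn_pos g2 by (simp add: card_subsets_of)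
    finally show ?thesis by simp
  qed
  \<comment> \<open>The absence of fixed points removes the products of \<open>\<beta>\<close> and
    \<open>\<alpha>\<close> at the same point, which need not have mean zero.\<close>
  have cii: "c i i = 0" for i
  proof -
    have "EPi S (\<lambda>\<pi>. if i \<in> S \<and> \<pi> i = i then 1 else 0) = 0" if "S \<in> ?J" for S
      using EPi_cong[of S "\<lambda>\<pi>. if i \<in> S \<and> \<pi> i = i then 1 else 0" "\<lambda>_. 0"] EPi_const[of S 0] subsets_facts[OF that] derangementsD(2)[of _ S i]
      by auto
    then show ?thesis by (simp add: c_def)
  qed
  \<comment> \<open>The pair \<open>(i, l)\<close> can only arise from a subset that contains both
    points.\<close>
  have cmax: "c i l \<le> real \<gamma> / (real n)\<^sup>2" if "i < n" "l < n" for i l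
  proof (cases "i = l")
    case False
    have "EPi S (\<lambda>\<pi>. if i \<in> S \<and> \<pi> i = l then 1 else 0) \<le> (if i \<in> S \<and> l \<in> S then 1 else 0)" if "S \<in> ?J" for S
    proof -
      have "EPi S (\<lambda>\<pi>. if i \<in> S \<and> \<pi> i = l then 1 else 0) \<le> EPi S (\<lambda>_. if i \<in> S \<and> l \<in> S then 1 else 0)"
        by (rule EPi_mono) (use subsets_facts[OF that] derangementsD(3)[of _ S i] in auto)
      then show ?thesis using EPi_const[of S] subsets_facts[OF that] by simp
    qed
    then have "(\<Sum>S\<in>?J. EPi S (\<lambda>\<pi>. if i \<in> S \<and> \<pi> i = l then 1 else 0)) \<le> (\<Sum>S\<in>?J. if i \<in> S \<and> l \<in> S then 1 else 0)"
      by (rule sum_mono)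
    also have "\<dots> = real (card {S\<in>?J. i \<in> S \<and> l \<in> S})"
      by (subst sum.inter_filter[symmetric]) (auto simp: finite_subsets_of)
    also have "\<dots> \<le> (real \<gamma>)\<^sup>2 * ?N / (real n)\<^sup>2"
      by (rule card_subsets_of_containing2[OF that False g2 gn])
    finally have "c i l \<le> ((real \<gamma>)\<^sup>2 * ?N / (real n)\<^sup>2) / (?N * real \<gamma>)"
      unfolding c_def using Nn_pos by (intro divide_right_mono) auto
    also have "\<dots> = real \<gamma> / (real n)\<^sup>2" using Nn_pos g2 by (simp add: power2_eq_square)
    finally show ?thesis .
  qed (simp add: cii)
  have Del_eq: "Del z = (\<Sum>i<n. \<Sum>l<n. c i l * (\<beta> (z i) * \<alpha> (z l)))" for z
  proof -
    have "EPi S (hc S z) = (\<Sum>i\<in>S. \<psi> (z i)) / real \<gamma> + EPi S (\<lambda>\<pi>. \<Sum>i\<in>S. \<beta> (z i) * \<alpha> (z (\<pi> i))) / real \<gamma>" if "S \<in> ?J" for S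
    proof -
      note S = subsets_facts[OF that]
      have "EPi S (hc S z) = (\<Sum>\<pi>\<in>derangements S. (\<Sum>i\<in>S. \<psi> (z i)) / real \<gamma> + (\<Sum>i\<in>S. \<beta> (z i) * \<alpha> (z (\<pi> i))) / real \<gamma>) / real (card (derangements S))"
        using S by (simp add: EPi_eq hc_def kern_def sum.distrib add_divide_distrib)
      also have "\<dots> = (\<Sum>i\<in>S. \<psi> (z i)) / real \<gamma> + EPi S (\<lambda>\<pi>. \<Sum>i\<in>S. \<beta> (z i) * \<alpha> (z (\<pi> i))) / real \<gamma>"
        using S card_derangements_pos[of S] by (simp add: EPi_eq sum.distrib add_divide_distrib sum_divide_distrib[symmetric])
      finally show ?thesis .
    qed
    then have "(\<Sum>S\<in>?J. EPi S (hc S z)) = (\<Sum>S\<in>?J. \<Sum>i\<in>S. \<psi> (z i)) / real \<gamma> + (\<Sum>S\<in>?J. EPi S (\<lambda>\<pi>. \<Sum>i\<in>S. \<beta> (z i) * \<alpha> (z (\<pi> i)))) / real \<gamma>"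
      by (simp add: sum.distrib sum_divide_distrib)
    then have "LL z = (\<Sum>S\<in>?J. \<Sum>i\<in>S. \<psi> (z i)) / (?N * real \<gamma>) + (\<Sum>S\<in>?J. EPi S (\<lambda>\<pi>. \<Sum>i\<in>S. \<beta> (z i) * \<alpha> (z (\<pi> i)))) / (?N * real \<gamma>)"
      by (simp add: LL_def add_divide_distrib mult.commute)
    also have "(\<Sum>S\<in>?J. \<Sum>i\<in>S. \<psi> (z i)) / (?N * real \<gamma>) = (\<Sum>i<n. \<psi> (z i)) / real n"
      using sum_over_subsets[of \<gamma> n "\<lambda>i. \<psi> (z i)"] g2 n0 Nn_pos by simp
    finally show ?thesis unfolding Del_def expand by simp
  qed
  let ?q = "\<lambda>i l k m z. \<beta> (z i) * \<alpha> (z l) * \<beta> (z k) * \<alpha> (z m)"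
  have q: "integrable (Pn {..<n}) (?q i l k m)" "\<bar>\<integral>z. ?q i l k m z \<partial>Pn {..<n}\<bar> \<le> Cab"
    if "i < n" "l < n" "k < n" "m < n" for i l k m
    using integrable_prod4[of "\<lambda>z. \<beta> (z i)" "Pn {..<n}" "\<lambda>z. \<alpha> (z l)" "\<lambda>z. \<beta> (z k)" "\<lambda>z. \<alpha> (z m)"] that
      coord_integrable[OF _ beta4, of _ "{..<n}"] coord_integrable[OF _ alpha4, of _ "{..<n}"]
      coord_integral[of _ "{..<n}" "\<lambda>x. \<beta> x ^ 4"] coord_integral[of _ "{..<n}" "\<lambda>x. \<alpha> x ^ 4"]
    by (auto simp: Cab_def)
  have tri: "integrable (Pn {..<n}) (\<lambda>z. f (z a) * g (z b) * h (z d))"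
    if "a < n" "b < n" "d < n" "f \<in> borel_measurable Z" "g \<in> borel_measurable Z" "h \<in> borel_measurable Z"
      "integrable Z (\<lambda>x. f x ^ 4)" "integrable Z (\<lambda>x. g x ^ 4)" "integrable Z (\<lambda>x. h x ^ 4)"
    for f g h :: "'z \<Rightarrow> real" and a b d
    using integrable_prod4(1)[of "\<lambda>z. f (z a)" "Pn {..<n}" "\<lambda>z. g (z b)" "\<lambda>z. h (z d)" "\<lambda>_. 1"] that
      coord_integrable[of a "{..<n}" "\<lambda>x. f x ^ 4"] coord_integrable[of b "{..<n}" "\<lambda>x. g x ^ 4"] coord_integrable[of d "{..<n}" "\<lambda>x. h x ^ 4"] by simp
  \<comment> \<open>If \<open>i\<close> does not recur among \<open>k\<close> and \<open>m\<close>,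
    its factor \<open>\<beta>\<close> is integrated out; if it does, the excluded coincidences force
    \<open>l\<close> to occur alone, and its factor \<open>\<alpha>\<close> is integrated
    out.\<close>
  have q0: "(\<integral>z. ?q i l k m z \<partial>Pn {..<n}) = 0"
    if i: "i < n" "l < n" "k < n" "m < n" "i \<noteq> l" "k \<noteq> m" and ne: "\<not> (k = i \<and> m = l)" "\<not> (k = l \<and> m = i)" for i l k m
  proof (cases "i = k \<or> i = m")
    case False
    have d: "depends_only {l, k, m} (space (Pn {..<n})) (\<lambda>z. \<alpha> (z l) * \<beta> (z k) * \<alpha> (z m))" by (simp add: depends_only_def)
    have "(\<integral>z. \<beta> (z i) * (\<alpha> (z l) * \<beta> (z k) * \<alpha> (z m)) \<partial>Pn {..<n}) = 0"
      using coord_factor(2)[OF finite_lessThan _ integrable_lower_powers(1)[OF beta_meas beta4]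
          tri[OF i(2,3,4) alpha_meas beta_meas alpha_meas alpha4 beta4 alpha4] d, of i] beta0 i False by simp
    then show ?thesis by (simp add: mult.assoc)
  next
    case True
    then have l: "l \<notin> {i, k, m}" using i ne by auto
    have d: "depends_only {i, k, m} (space (Pn {..<n})) (\<lambda>z. \<beta> (z i) * \<beta> (z k) * \<alpha> (z m))" by (simp add: depends_only_def)
    have "(\<integral>z. \<alpha> (z l) * (\<beta> (z i) * \<beta> (z k) * \<alpha> (z m)) \<partial>Pn {..<n}) = 0"
      using coord_factor(2)[OF finite_lessThan _ integrable_lower_powers(1)[OF alpha_meas alpha4]
          tri[OF i(1,3,4) beta_meas beta_meas alpha_meas beta4 beta4 alpha4] d l] alpha0 i by simp
    then show ?thesis by (simp add: mult_ac)
  qed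
  have Del2: "(Del z)\<^sup>2 = (\<Sum>i<n. \<Sum>l<n. \<Sum>k<n. \<Sum>m<n. c i l * c k m * ?q i l k m z)" for z
    unfolding Del_eq power2_eq_square sum_distrib_right sum_distrib_left
    by (intro sum.cong refl) (simp add: mult_ac)
  show "Del \<in> borel_measurable (Pn {..<n})"
    unfolding Del_eq[abs_def] by measurable
  show "integrable (Pn {..<n}) (\<lambda>z. (Del z)\<^sup>2)"
    unfolding Del2 by (intro Bochner_Integration.integrable_sum integrable_mult_right q) auto
  have "(\<integral>z. (Del z)\<^sup>2 \<partial>Pn {..<n}) = (\<Sum>i<n. \<Sum>l<n. \<Sum>k<n. \<Sum>m<n. c i l * c k m * (\<integral>z. ?q i l k m z \<partial>Pn {..<n}))"
  proof -
    have qi: "integrable (Pn {..<n}) (\<lambda>z. c i l * c k m * ?q i l k m z)"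
      if "i \<in> {..<n}" "l \<in> {..<n}" "k \<in> {..<n}" "m \<in> {..<n}" for i l k m
      using q(1)[of i l k m] that by (intro integrable_mult_right) auto
    show ?thesis
      unfolding Del2
      by (subst Bochner_Integration.integral_sum, (intro Bochner_Integration.integrable_sum qi; assumption), rule sum.cong[OF refl])+
        (rule integral_mult_right_zero)
  qed
  also have "\<dots> \<le> (\<Sum>i<n. \<Sum>l<n. \<Sum>k<n. \<Sum>m<n. c i l * Cab * (if k = i \<and> m = l then c i l else 0) + c i l * Cab * (if k = l \<and> m = i then c l i else 0))"
  proof (intro sum_mono)
    fix i l k m assume "i \<in> {..<n}" "l \<in> {..<n}" "k \<in> {..<n}" "m \<in> {..<n}"
    then have i: "i < n" "l < n" "k < n" "m < n" by auto
    have R: "0 \<le> c i l * Cab * (if k = i \<and> m = l then c i l else 0)" "0 \<le> c i l * Cab * (if k = l \<and> m = i then c l i else 0)"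
      using c0 Cab_nonneg by auto
    show "c i l * c k m * (\<integral>z. ?q i l k m z \<partial>Pn {..<n})
      \<le> c i l * Cab * (if k = i \<and> m = l then c i l else 0) + c i l * Cab * (if k = l \<and> m = i then c l i else 0)"
    proof (cases "i \<noteq> l \<and> k \<noteq> m")
      case False
      then have "c i l * c k m = 0" using cii[of i] cii[of k] by fastforce
      then show ?thesis using add_nonneg_nonneg[OF R] by (simp only: mult_zero_left)
    next
      case True
      show ?thesis
      proof (cases "(k = i \<and> m = l) \<or> (k = l \<and> m = i)")
        case False
        then have "(\<integral>z. ?q i l k m z \<partial>Pn {..<n}) = 0" using q0[OF i] True by blast
        then show ?thesis using add_nonneg_nonneg[OF R] by (simp only: mult_zero_right)
      next
        case kl: True
        have "c i l * c k m * (\<integral>z. ?q i l k m z \<partial>Pn {..<n}) \<le> c i l * c k m * Cab"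
          using q(2)[OF i] c0 by (intro mult_left_mono) auto
        also have "\<dots> \<le> c i l * Cab * (if k = i \<and> m = l then c i l else 0) + c i l * Cab * (if k = l \<and> m = i then c l i else 0)"
        proof (cases "k = i \<and> m = l")
          case True
          then have "c i l * c k m * Cab = c i l * Cab * (if k = i \<and> m = l then c i l else 0)" by simp
          with R(2) show ?thesis by linarith
        next
          case False
          with kl have "c i l * c k m * Cab = c i l * Cab * (if k = l \<and> m = i then c l i else 0)" by auto
          with R(1) show ?thesis by linarith
        qed
        finally show ?thesis .
      qed
    qed
  qed
  also have "\<dots> = (\<Sum>i<n. \<Sum>l<n. c i l * Cab * (c i l + c l i))"
  proof (intro sum.cong refl)
    fix i l assume "i \<in> {..<n}" "l \<in> {..<n}"
    then have i: "i < n" "l < n" by auto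
    have dbl: "(\<Sum>k<n. \<Sum>m<n. if k = a \<and> m = b then u else 0) = u" if "a < n" "b < n" for a b and u :: real
    proof -
      have "(\<Sum>k<n. \<Sum>m<n. if k = a \<and> m = b then u else 0) = (\<Sum>k<n. if k = a then u else 0)"
        using that by (intro sum.cong refl) (auto simp: sum.delta)
      then show ?thesis using that by simp
    qed
    show "(\<Sum>k<n. \<Sum>m<n. c i l * Cab * (if k = i \<and> m = l then c i l else 0) + c i l * Cab * (if k = l \<and> m = i then c l i else 0))
      = c i l * Cab * (c i l + c l i)"
      using dbl[of i l "c i l"] dbl[of l i "c l i"] i by (simp only: sum.distrib sum_distrib_left[symmetric] distrib_left)
  qed
  also have "\<dots> \<le> (\<Sum>i<n. \<Sum>l<n. c i l * (Cab * (2 * (real \<gamma> / (real n)\<^sup>2))))"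
  proof (intro sum_mono)
    fix i l assume "i \<in> {..<n}" "l \<in> {..<n}"
    then have "c i l + c l i \<le> 2 * (real \<gamma> / (real n)\<^sup>2)" using cmax[of i l] cmax[of l i] by auto
    then have "c i l * (Cab * (c i l + c l i)) \<le> c i l * (Cab * (2 * (real \<gamma> / (real n)\<^sup>2)))"
      by (intro mult_left_mono c0 Cab_nonneg)
    then show "c i l * Cab * (c i l + c l i) \<le> c i l * (Cab * (2 * (real \<gamma> / (real n)\<^sup>2)))" by (simp only: mult.assoc)
  qed
  also have "\<dots> = Cab * (2 * (real \<gamma> / (real n)\<^sup>2))"
    unfolding sum_distrib_right[symmetric] csum by simp
  finally show "(\<integral>z. (Del z)\<^sup>2 \<partial>Pn {..<n}) \<le> 2 * Cab * real \<gamma> / (real n)\<^sup>2" by (simp add: mult_ac)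
qed

text \<open>Feeds the passage from the linear statistic to the ratio, whose cost contains the
  squared conditional mean.\<close>

lemma LL_second_moment:
  "integrable (Pn {..<n}) (\<lambda>z. (LL z)\<^sup>2)"
  "(\<integral>z. (LL z)\<^sup>2 \<partial>Pn {..<n}) \<le> 2 * (var\<psi> / real n + 2 * Cab * real \<gamma> / (real n)\<^sup>2)"
proof -
  have n0: "n > 0" using g2 gn by simp
  let ?A = "\<lambda>z. \<Sum>i<n. \<psi> (z i)"
  note lp = integrable_lower_powers(1,2)[OF psi_meas psi4]
  note sq = integral_PiM_sum_square[of "\<lambda>_. Z" "{..<n}" "\<lambda>_. \<psi>", OF Zp finite_lessThan lp]
  have A: "integrable (Pn {..<n}) (\<lambda>z. (?A z)\<^sup>2)" "(\<integral>z. (?A z)\<^sup>2 \<partial>Pn {..<n}) = real n * var\<psi>"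
    using sq psi0 by (simp_all add: var\<psi>_def)
  have le: "(LL z)\<^sup>2 \<le> 2 * ((?A z)\<^sup>2 / (real n)\<^sup>2 + (Del z)\<^sup>2)" for z
  proof -
    have "LL z = ?A z / real n + Del z" by (simp add: Del_def)
    then show ?thesis
      using sum_squares_bound[of "?A z / real n" "Del z"] by (simp add: power2_sum power_divide)
  qed
  have I: "integrable (Pn {..<n}) (\<lambda>z. 2 * ((?A z)\<^sup>2 / (real n)\<^sup>2 + (Del z)\<^sup>2))"
    using A(1) Del_second_moment(2) by simp
  have "LL = (\<lambda>z. ?A z / real n + Del z)" by (simp add: Del_def fun_eq_iff)
  then have LLm: "LL \<in> borel_measurable (Pn {..<n})"
    using Del_second_moment(1) by simp
  show int: "integrable (Pn {..<n}) (\<lambda>z. (LL z)\<^sup>2)"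
  proof (rule Bochner_Integration.integrable_bound[OF I])
    show "(\<lambda>z. (LL z)\<^sup>2) \<in> borel_measurable (Pn {..<n})" using LLm by measurable
    show "AE z in Pn {..<n}. norm ((LL z)\<^sup>2) \<le> norm (2 * ((?A z)\<^sup>2 / (real n)\<^sup>2 + (Del z)\<^sup>2))"
      using order_trans[OF le abs_ge_self] by (intro AE_I2) (simp only: real_norm_def abs_power2)
  qed
  have "(\<integral>z. (LL z)\<^sup>2 \<partial>Pn {..<n}) \<le> (\<integral>z. 2 * ((?A z)\<^sup>2 / (real n)\<^sup>2 + (Del z)\<^sup>2) \<partial>Pn {..<n})"
    by (intro integral_mono int I le)
  also have "\<dots> = 2 * (var\<psi> / real n + (\<integral>z. (Del z)\<^sup>2 \<partial>Pn {..<n}))"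
    using A Del_second_moment(2) n0 by (simp add: power2_eq_square)
  also have "\<dots> \<le> 2 * (var\<psi> / real n + 2 * Cab * real \<gamma> / (real n)\<^sup>2)"
    using Del_second_moment(3) by (intro mult_left_mono add_left_mono) auto
  finally show "(\<integral>z. (LL z)\<^sup>2 \<partial>Pn {..<n}) \<le> 2 * (var\<psi> / real n + 2 * Cab * real \<gamma> / (real n)\<^sup>2)" .
qed

end

end

section \<open>The characteristic function of the incomplete U-statistic\<close>

lemma exp_minus_taylor1:
  fixes y :: real
  assumes "y \<ge> 0"
  shows "\<bar>exp (- y) - (1 - y)\<bar> \<le> y\<^sup>2"
proof -
  have "exp (- y) \<le> 1 / (1 + y)"
    using exp_ge_add_one_self[of y] assms by (simp add: exp_minus field_simps)
  also have "1 / (1 + y) \<le> 1 - y + y\<^sup>2"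
  proof -
    have "1 \<le> (1 - y + y\<^sup>2) * (1 + y)" using assms by (simp add: algebra_simps power2_eq_square)
    then show ?thesis using assms by (simp add: divide_le_eq)
  qed
  finally show ?thesis using exp_ge_add_one_self[of "- y"] by simp
qed

context perm_kernel begin

definition "c3 = (\<integral>z. \<bar>\<psi> z\<bar> ^ 3 \<partial>Z)"

text \<open>A quantitative central limit theorem at an arbitrary frequency \<open>x\<close>. The
  frequency used later is \<open>t / (n * s)\<close>, and its product with sqrt n need not converge,
  so a limit theorem at fixed frequency would not suffice. Both bases of the \<open>n\<close>-th
  powers have norm at most 1 and are compared with
  \<open>1 - x\<^sup>2 * var\<psi> / 2\<close>.\<close>

lemma iid_sum_char:
  "norm ((\<integral>z. iexp (x * (\<Sum>i<n. \<psi> (z i))) \<partial>Pn {..<n}) - complex_of_real (exp (- (real n * x\<^sup>2 * var\<psi> / 2))))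
    \<le> real n * (\<bar>x\<bar> ^ 3 * c3 + (x\<^sup>2 * var\<psi>)\<^sup>2)"
proof -
  interpret PP: product_prob_space "\<lambda>_. Z" "{..<n}" by (intro product_prob_spaceI Zp)
  define \<phi> where "\<phi> = (\<integral>z. iexp (x * \<psi> z) \<partial>Z)"
  have v0: "var\<psi> \<ge> 0" unfolding var\<psi>_def by simp
  have i1: "integrable Z (\<lambda>z. iexp (x * \<psi> z))" by (intro integrable_iexp; simp)
  have "iexp (x * (\<Sum>i<n. \<psi> (z i))) = (\<Prod>i<n. iexp (x * \<psi> (z i)))" for z :: "nat \<Rightarrow> 'z"
    by (simp add: exp_sum[symmetric] sum_distrib_left)
  then have 1: "(\<integral>z. iexp (x * (\<Sum>i<n. \<psi> (z i))) \<partial>Pn {..<n}) = \<phi> ^ n"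
    using PP.product_integral_prod[of "{..<n}" "\<lambda>_ z. iexp (x * \<psi> z)"] i1 by (simp add: \<phi>_def)
  have 2: "complex_of_real (exp (- (real n * x\<^sup>2 * var\<psi> / 2))) = complex_of_real (exp (- (x\<^sup>2 * var\<psi> / 2))) ^ n"
    unfolding of_real_power[symmetric] exp_of_nat_mult[symmetric] by (simp add: mult.assoc)
  have n1: "norm \<phi> \<le> 1"
  proof -
    have "norm \<phi> \<le> (\<integral>z. norm (iexp (x * \<psi> z)) \<partial>Z)" unfolding \<phi>_def by (rule integral_norm_bound)
    also have "\<dots> = (\<integral>z. 1 \<partial>Z)" by (intro Bochner_Integration.integral_cong refl) (simp only: norm_exp_i_times)
    finally show ?thesis by (simp add: prob_space)
  qed
  note lp = integrable_lower_powers[OF psi_meas psi4]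
  let ?r = "\<lambda>z. iexp (x * \<psi> z) - 1 - \<i> * complex_of_real (x * \<psi> z) + complex_of_real ((x * \<psi> z)\<^sup>2 / 2)"
  have ii: "integrable Z (\<lambda>z. \<i> * complex_of_real (x * \<psi> z))" "integrable Z (\<lambda>z. complex_of_real ((x * \<psi> z)\<^sup>2 / 2))"
    using lp(1,2) by (auto simp only: power_mult_distrib intro!: integrable_mult_right integrable_of_real integrable_divide)
  have eqr: "(\<integral>z. ?r z \<partial>Z) = \<phi> - complex_of_real (1 - x\<^sup>2 * var\<psi> / 2)"
  proof -
    have "(\<integral>z. ?r z \<partial>Z) = \<phi> - 1 - (\<integral>z. \<i> * complex_of_real (x * \<psi> z) \<partial>Z) + (\<integral>z. complex_of_real ((x * \<psi> z)\<^sup>2 / 2) \<partial>Z)"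
      using i1 ii by (simp only: Bochner_Integration.integral_add Bochner_Integration.integral_diff Bochner_Integration.integrable_diff
          integrable_const \<phi>_def lebesgue_integral_const prob_space scaleR_one)
    also have "(\<integral>z. \<i> * complex_of_real (x * \<psi> z) \<partial>Z) = 0"
      using psi0 by (simp only: integral_mult_right_zero integral_complex_of_real) simp
    also have "(\<integral>z. complex_of_real ((x * \<psi> z)\<^sup>2 / 2) \<partial>Z) = complex_of_real (x\<^sup>2 * var\<psi> / 2)"
      by (simp only: integral_complex_of_real) (simp add: power_mult_distrib var\<psi>_def)
    finally show ?thesis by simp
  qed
  have "norm (\<phi> - complex_of_real (1 - x\<^sup>2 * var\<psi> / 2)) \<le> (\<integral>z. norm (?r z) \<partial>Z)"
    unfolding eqr[symmetric] by (rule integral_norm_bound)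
  also have "\<dots> \<le> (\<integral>z. \<bar>x\<bar> ^ 3 * \<bar>\<psi> z\<bar> ^ 3 \<partial>Z)"
  proof (rule integral_mono)
    show "integrable Z (\<lambda>z. norm (?r z))" using i1 ii by auto
    show "norm (?r z) \<le> \<bar>x\<bar> ^ 3 * \<bar>\<psi> z\<bar> ^ 3" for z
      using iexp_taylor2[of "x * \<psi> z"] by (simp only: abs_mult power_mult_distrib)
  qed (use lp in auto)
  finally have a: "norm (\<phi> - complex_of_real (1 - x\<^sup>2 * var\<psi> / 2)) \<le> \<bar>x\<bar> ^ 3 * c3" by (simp add: c3_def)
  have b: "norm (complex_of_real (exp (- (x\<^sup>2 * var\<psi> / 2))) - complex_of_real (1 - x\<^sup>2 * var\<psi> / 2)) \<le> (x\<^sup>2 * var\<psi>)\<^sup>2"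
  proof -
    have y: "x\<^sup>2 * var\<psi> / 2 \<ge> 0" using v0 by simp
    have "norm (complex_of_real (exp (- (x\<^sup>2 * var\<psi> / 2))) - complex_of_real (1 - x\<^sup>2 * var\<psi> / 2)) \<le> (x\<^sup>2 * var\<psi> / 2)\<^sup>2"
      using exp_minus_taylor1[OF y] by (simp only: of_real_diff[symmetric] norm_of_real)
    also have "\<dots> \<le> (x\<^sup>2 * var\<psi>)\<^sup>2" using v0 by (intro power_mono) auto
    finally show ?thesis .
  qed
  have "norm (\<phi> ^ n - complex_of_real (exp (- (x\<^sup>2 * var\<psi> / 2))) ^ n)
      \<le> real n * norm (\<phi> - complex_of_real (exp (- (x\<^sup>2 * var\<psi> / 2))))"
    by (rule norm_power_diff) (use n1 v0 in \<open>auto simp: norm_of_real\<close>)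
  also have "\<dots> \<le> real n * (\<bar>x\<bar> ^ 3 * c3 + (x\<^sup>2 * var\<psi>)\<^sup>2)"
    using a b norm_triangle_ineq4[of "\<phi> - complex_of_real (1 - x\<^sup>2 * var\<psi> / 2)" "complex_of_real (exp (- (x\<^sup>2 * var\<psi> / 2))) - complex_of_real (1 - x\<^sup>2 * var\<psi> / 2)"]
    by (intro mult_left_mono) auto
  finally show ?thesis unfolding 1 2 .
qed

text \<open>The terms, in order: two for random versus expected sample size
  (\<open>\<delta>\<close>), one for the product versus the exponential, two for the Taylor
  remainder (\<open>\<delta>'\<close>), one for \<open>Del\<close>, one for the fluctuation of
  \<open>VV\<close>, and two for the i.i.d. sum of \<open>\<psi>\<close>.\<close>

definition err :: "real \<Rightarrow> nat \<Rightarrow> nat \<Rightarrow> real \<Rightarrow> real \<Rightarrow> real \<Rightarrow> real" where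
  "err t n \<gamma> M \<delta> \<delta>' = \<bar>t\<bar> * \<delta> * (2 + 2 * (1 + 2 * Cab * (real \<gamma> / real n) / var\<psi>)) + 2 / (\<delta>\<^sup>2 * M)
    + exp 2 * t\<^sup>2 * sqrt C4 * (real \<gamma> / real n) / var\<psi> + \<delta>' * t\<^sup>2 + t ^ 4 * C4 / (\<delta>' * M * var\<psi>\<^sup>2)
    + \<bar>t\<bar> * sqrt (2 * Cab * (real \<gamma> / real n) / var\<psi>) + t\<^sup>2 * sqrt C4 * (real \<gamma> / sqrt (real n)) / (2 * var\<psi>)
    + \<bar>t\<bar> ^ 3 / var\<psi> * c3 / sqrt (real n * var\<psi>) + t ^ 4 / real n"

context
  fixes n \<gamma> :: nat and M s \<theta> t \<delta> \<delta>' :: real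
  assumes g2: "2 \<le> \<gamma>" and gn: "\<gamma> \<le> n"
    and M0: "0 < M" and MN: "M \<le> real (n choose \<gamma>)"
    and v0: "var\<psi> > 0" and s_def: "s = sqrt (var\<psi> / real n + zt \<gamma> / M)"
    and d: "0 < \<delta>" "\<delta> \<le> 1/2" and d': "0 < \<delta>'"
begin

abbreviation "J \<equiv> subsets_of n \<gamma>"
abbreviation "N \<equiv> real (n choose \<gamma>)"
abbreviation "DP \<equiv> \<lambda>S. pmf_of_set (derangements S)"
abbreviation "Om \<equiv> PiM J (\<lambda>S. measure_pmf (pair_pmf (bernoulli_pmf (M / N)) (DP S)))"
abbreviation "stat z \<omega> \<equiv> ((\<Sum>S\<in>J. if fst (\<omega> S) then \<theta> + hc S z (snd (\<omega> S)) else 0) / real (card {S\<in>J. fst (\<omega> S)}) - \<theta>) / s"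

lemma binom_pos: "N > 0" using gn by simp

lemma n_pos: "n > 0" using g2 gn by simp

lemma bernoulli_sampling_subsets: "bernoulli_sampling J DP (M / N)"
proof
  show "J \<noteq> {}" using card_subsets_of[of n \<gamma>] gn by (metis binomial_eq_0_iff card.empty not_le)
  show "finite (set_pmf (DP S))" if "S \<in> J" for S
    using derangements_nonempty[of S] finite_derangements[of S] subsets_ofD[OF that] g2 by (simp add: set_pmf_of_set)
qed (use finite_subsets_of M0 MN binom_pos in auto)

lemma zt_pos: "zt \<gamma> > 0"
proof -
  have "0 < var\<psi> / real \<gamma>" using v0 g2 by simp
  also have "\<dots> \<le> zt \<gamma>" by (rule zt_ge[OF g2])
  finally show ?thesis .
qed

lemma scale_facts: "s\<^sup>2 = var\<psi> / real n + zt \<gamma> / M" "s > 0"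
proof -
  have "0 < var\<psi> / real n + zt \<gamma> / M"
    using v0 zt_pos n_pos M0 by (intro add_pos_pos divide_pos_pos) auto
  then show "s\<^sup>2 = var\<psi> / real n + zt \<gamma> / M" "s > 0" unfolding s_def by simp_all
qed

text \<open>This and the next two bounds compare the squared scale with its two parts. They are
  chosen so that no relation between \<open>n\<close> and \<open>M\<close> is involved.\<close>

lemma zt_le_scale: "zt \<gamma> / (M * s\<^sup>2) \<le> 1"
proof -
  have "zt \<gamma> / M \<le> s\<^sup>2" unfolding scale_facts(1) using v0 by simp
  then show ?thesis using M0 scale_facts(2) by (simp add: divide_le_eq mult_ac)
qed

lemma inverse_scale_le_n: "1 / s\<^sup>2 \<le> real n / var\<psi>"
proof -
  have "var\<psi> / real n \<le> s\<^sup>2" unfolding scale_facts(1) using zt_pos M0 by simp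
  then have "1 / s\<^sup>2 \<le> 1 / (var\<psi> / real n)" using v0 n_pos scale_facts(2) by (intro divide_left_mono) auto
  then show ?thesis by simp
qed

text \<open>The factor \<open>\<gamma>\<close> comes from the lower bound \<open>zt_ge\<close>.
  Multiplied by the \<open>1 / sqrt n\<close> fluctuation of \<open>VV\<close>, it produces the
  quantity \<open>\<gamma> / sqrt n\<close>.\<close>

lemma inverse_scale_le_gamma: "1 / (M * s\<^sup>2) \<le> real \<gamma> / var\<psi>"
proof -
  have "var\<psi> / real \<gamma> \<le> M * s\<^sup>2"
  proof -
    have "var\<psi> / real \<gamma> \<le> zt \<gamma>" by (rule zt_ge[OF g2])
    also have "\<dots> \<le> M * s\<^sup>2" unfolding scale_facts(1) using v0 M0 by (simp add: distrib_left)
    finally show ?thesis .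
  qed
  then have "1 / (M * s\<^sup>2) \<le> 1 / (var\<psi> / real \<gamma>)" using v0 g2 scale_facts(2) M0 by (intro divide_left_mono) auto
  then show ?thesis by simp
qed

text \<open>For frozen data \<open>z\<close>, the \<open>mean\<close> of the sampling locale becomes
  \<open>LL\<close>, \<open>VV\<close> and \<open>WW\<close> for the kernel and its second and
  fourth powers; the two sampling estimates are then chained.\<close>

lemma stat_conditional_char:
  "norm ((\<integral>\<omega>. iexp (t * stat z \<omega>) \<partial>Om)
      - exp (\<i> * complex_of_real (t * LL n \<gamma> z / s) - complex_of_real (t\<^sup>2 * VV n \<gamma> z / (2 * M * s\<^sup>2))))
    \<le> \<bar>t\<bar> * \<delta> * (1 + VV n \<gamma> z / (M * s\<^sup>2) + (LL n \<gamma> z)\<^sup>2 / s\<^sup>2) + 2 / (\<delta>\<^sup>2 * M)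
      + (exp 2 * (M / N) + \<delta>') * t\<^sup>2 * VV n \<gamma> z / (M * s\<^sup>2) + t ^ 4 * WW n \<gamma> z / (\<delta>' * M ^ 3 * s ^ 4)"
proof -
  interpret B: bernoulli_sampling J DP "M / N" by (rule bernoulli_sampling_subsets)
  have MM: "M / N * real (card J) = M" using binom_pos by (simp add: card_subsets_of)
  have mV: "B.mean (\<lambda>S y. (hc S z y)\<^sup>2) = VV n \<gamma> z"
    unfolding B.mean_def VV_def[OF g2 gn] EPi_def card_subsets_of ..
  have mW: "B.mean (\<lambda>S y. hc S z y ^ 4) = WW n \<gamma> z"
    unfolding B.mean_def WW_def[OF g2 gn] EPi_def card_subsets_of ..
  have mL: "B.mean (\<lambda>S y. hc S z y) = LL n \<gamma> z"
    unfolding B.mean_def LL_def[OF g2 gn] EPi_def card_subsets_of ..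
  note b1 = B.iexp_ratio_approx[OF scale_facts(2) d, of t \<theta> "\<lambda>S. hc S z", unfolded MM mV mW mL B.\<Omega>_def B.ratio_def]
  note b2 = B.iexp_linear_stat_approx[OF scale_facts(2) d', of t "\<lambda>S. hc S z", unfolded MM mV mW mL B.\<Omega>_def]
  show ?thesis
    by (rule order_trans[OF norm_diff_triangle_le[OF b1 b2]]) (simp only: power_divide add.assoc order_refl)
qed

text \<open>The conditional estimate is integrated over the data. \<open>F\<close> is any measurable
  version of the statistic: the decomposition of the regression kernel holds only where the
  covariates lie in the cube and the labels are derangements, hence the almost sure
  hypothesis.\<close>

lemma stat_char_bound:
  fixes F :: "(nat \<Rightarrow> 'z) \<times> (nat set \<Rightarrow> bool \<times> (nat \<Rightarrow> nat)) \<Rightarrow> real"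
  assumes F[measurable]: "F \<in> borel_measurable (Pn {..<n} \<Otimes>\<^sub>M Om)"
    and Feq: "AE z in Pn {..<n}. AE \<omega> in Om. F (z, \<omega>) = stat z \<omega>"
  shows "norm ((\<integral>x. iexp (t * F x) \<partial>(Pn {..<n} \<Otimes>\<^sub>M Om)) - complex_of_real (exp (- (t\<^sup>2 / 2)))) \<le> err t n \<gamma> M \<delta> \<delta>'"
proof -
  interpret B: bernoulli_sampling J DP "M / N" by (rule bernoulli_sampling_subsets)
  interpret P: prob_space "Pn {..<n}" by (rule Pn_prob)
  interpret O: prob_space Om by (rule B.Om.prob_space_axioms[unfolded B.\<Omega>_def])
  interpret PO: pair_prob_space "Pn {..<n}" Om ..
  let ?V = "VV n \<gamma>" and ?W = "WW n \<gamma>" and ?L = "LL n \<gamma>" and ?D = "Del n \<gamma>"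
  note Vi = VV_int[OF g2 gn] and Wi = WW_int[OF g2 gn] and Vv = VV_variance[OF g2 gn] and Di = Del_second_moment[OF g2 gn]
    and Li = LL_second_moment[OF g2 gn]
  \<comment> \<open>The frequency at which the sum of the \<open>\<psi> (z i)\<close> enters when
    \<open>LL / s\<close> is replaced by its projection.\<close>
  define x where "x = t / (real n * s)"
  define K where "K z = (\<integral>\<omega>. iexp (t * F (z, \<omega>)) \<partial>Om)" for z
  \<comment> \<open>The intermediate target: \<open>Del\<close> is dropped from \<open>LL\<close>
    and \<open>VV\<close> is replaced by \<open>zt \<gamma>\<close>. What remains is the i.i.d.
    factor times a constant Gaussian factor.\<close>
  define G where "G z = exp (\<i> * complex_of_real (x * (\<Sum>i<n. \<psi> (z i))) - complex_of_real (t\<^sup>2 * zt \<gamma> / (2 * M * s\<^sup>2)))" for z :: "nat \<Rightarrow> 'z"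
  define e where "e z = \<bar>t\<bar> * \<delta> * (1 + ?V z / (M * s\<^sup>2) + (?L z)\<^sup>2 / s\<^sup>2) + 2 / (\<delta>\<^sup>2 * M)
      + (exp 2 * (M / N) + \<delta>') * t\<^sup>2 * ?V z / (M * s\<^sup>2) + t ^ 4 * ?W z / (\<delta>' * M ^ 3 * s ^ 4)
      + (\<bar>t\<bar> * \<bar>?D z\<bar> / s + t\<^sup>2 * \<bar>?V z - zt \<gamma>\<bar> / (2 * M * s\<^sup>2))" for z
  have Iexp: "integrable (Pn {..<n} \<Otimes>\<^sub>M Om) (\<lambda>x. iexp (t * F x))"
    by (intro PO.P.integrable_iexp; simp)
  have KF: "(\<integral>x. iexp (t * F x) \<partial>(Pn {..<n} \<Otimes>\<^sub>M Om)) = (\<integral>z. K z \<partial>Pn {..<n})"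
    unfolding K_def using PO.integral_fst'[OF Iexp] by simp
  have Kint: "integrable (Pn {..<n}) K"
    unfolding K_def[abs_def] using PO.integrable_fst'[OF Iexp] by simp
  have Geq: "G = (\<lambda>z. iexp (x * (\<Sum>i<n. \<psi> (z i))) * complex_of_real (exp (- (t\<^sup>2 * zt \<gamma> / (2 * M * s\<^sup>2)))))"
    unfolding G_def exp_of_real[symmetric] exp_add[symmetric] by simp
  have Gint: "integrable (Pn {..<n}) G"
  proof -
    have "integrable (Pn {..<n}) (\<lambda>z. iexp (x * (\<Sum>i<n. \<psi> (z i))))" by (intro P.integrable_iexp; simp)
    then show ?thesis unfolding Geq by (intro integrable_mult_left)
  qed
  have V0: "?V z \<ge> 0" for z
    unfolding VV_def[OF g2 gn] EPi_def by (intro divide_nonneg_nonneg sum_nonneg) auto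
  have le: "AE z in Pn {..<n}. norm (K z - G z) \<le> e z"
    using Feq AE_space
  proof eventually_elim
    case (elim z)
    have [measurable]: "(\<lambda>\<omega>. F (z, \<omega>)) \<in> borel_measurable Om" using elim(2) by measurable
    have mst: "stat z \<in> borel_measurable Om"
      using B.ratio_measurable[of "\<lambda>S \<pi>. \<theta> + hc S z \<pi>"] unfolding B.ratio_def[abs_def] B.\<Omega>_def by measurable
    have Kz: "K z = (\<integral>\<omega>. iexp (t * stat z \<omega>) \<partial>Om)"
      unfolding K_def
    proof (rule integral_cong_AE)
      show "(\<lambda>\<omega>. iexp (t * stat z \<omega>)) \<in> borel_measurable Om" using mst by measurable
      show "AE \<omega> in Om. iexp (t * F (z, \<omega>)) = iexp (t * stat z \<omega>)" using elim(1) by eventually_elim simp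
    qed measurable
    note b1 = stat_conditional_char[of z, folded Kz]
    let ?E = "exp (\<i> * complex_of_real (t * ?L z / s) - complex_of_real (t\<^sup>2 * ?V z / (2 * M * s\<^sup>2)))"
    have "norm (?E - G z) \<le> norm ((\<i> * complex_of_real (t * ?L z / s) - complex_of_real (t\<^sup>2 * ?V z / (2 * M * s\<^sup>2)))
       - (\<i> * complex_of_real (x * (\<Sum>i<n. \<psi> (z i))) - complex_of_real (t\<^sup>2 * zt \<gamma> / (2 * M * s\<^sup>2))))"
      unfolding G_def by (rule norm_exp_diff_le) (use V0[of z] zt_pos M0 in \<open>auto simp del: of_real_divide of_real_mult of_real_power\<close>)
    also have "(\<i> * complex_of_real (t * ?L z / s) - complex_of_real (t\<^sup>2 * ?V z / (2 * M * s\<^sup>2)))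
       - (\<i> * complex_of_real (x * (\<Sum>i<n. \<psi> (z i))) - complex_of_real (t\<^sup>2 * zt \<gamma> / (2 * M * s\<^sup>2)))
       = \<i> * complex_of_real (t * ?L z / s - x * (\<Sum>i<n. \<psi> (z i))) - complex_of_real (t\<^sup>2 * ?V z / (2 * M * s\<^sup>2) - t\<^sup>2 * zt \<gamma> / (2 * M * s\<^sup>2))"
      unfolding of_real_diff right_diff_distrib by (simp only: algebra_simps)
    also have "t * ?L z / s - x * (\<Sum>i<n. \<psi> (z i)) = t * ?D z / s"
      unfolding Del_def[OF g2 gn] x_def using scale_facts(2) n_pos by (simp add: field_simps)
    also have "t\<^sup>2 * ?V z / (2 * M * s\<^sup>2) - t\<^sup>2 * zt \<gamma> / (2 * M * s\<^sup>2) = t\<^sup>2 * (?V z - zt \<gamma>) / (2 * M * s\<^sup>2)"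
      by (simp add: diff_divide_distrib right_diff_distrib)
    also have "norm (\<i> * complex_of_real (t * ?D z / s) - complex_of_real (t\<^sup>2 * (?V z - zt \<gamma>) / (2 * M * s\<^sup>2)))
      \<le> \<bar>t * ?D z / s\<bar> + \<bar>t\<^sup>2 * (?V z - zt \<gamma>) / (2 * M * s\<^sup>2)\<bar>"
      using norm_triangle_ineq4[of "\<i> * complex_of_real (t * ?D z / s)" "complex_of_real (t\<^sup>2 * (?V z - zt \<gamma>) / (2 * M * s\<^sup>2))"]
      by (simp only: norm_mult norm_ii norm_of_real mult_1)
    also have "\<dots> = \<bar>t\<bar> * \<bar>?D z\<bar> / s + t\<^sup>2 * \<bar>?V z - zt \<gamma>\<bar> / (2 * M * s\<^sup>2)"
      using scale_facts(2) M0 by (simp add: abs_mult)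
    finally have b2: "norm (?E - G z) \<le> \<bar>t\<bar> * \<bar>?D z\<bar> / s + t\<^sup>2 * \<bar>?V z - zt \<gamma>\<bar> / (2 * M * s\<^sup>2)" .
    show "norm (K z - G z) \<le> e z"
      unfolding e_def by (rule norm_diff_triangle_le[OF b1 b2])
  qed
  have Dabs: "integrable (Pn {..<n}) ?D" "(\<integral>z. \<bar>?D z\<bar> \<partial>Pn {..<n}) \<le> sqrt (2 * Cab * real \<gamma> / (real n)\<^sup>2)"
  proof -
    show I: "integrable (Pn {..<n}) ?D"
      by (rule P.square_integrable_imp_integrable[OF Di(1,2)])
    have "(\<integral>z. \<bar>?D z\<bar> \<partial>Pn {..<n})\<^sup>2 \<le> (\<integral>z. \<bar>?D z\<bar>\<^sup>2 \<partial>Pn {..<n})"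
      by (rule P.square_integral_le) (use I Di(2) in auto)
    also have "\<dots> \<le> 2 * Cab * real \<gamma> / (real n)\<^sup>2" using Di(3) by simp
    finally show "(\<integral>z. \<bar>?D z\<bar> \<partial>Pn {..<n}) \<le> sqrt (2 * Cab * real \<gamma> / (real n)\<^sup>2)" by (rule real_le_rsqrt)
  qed
  have Vabs: "(\<integral>z. \<bar>?V z - zt \<gamma>\<bar> \<partial>Pn {..<n}) \<le> sqrt (C4 / real n)"
  proof -
    have "(\<integral>z. \<bar>?V z - zt \<gamma>\<bar> \<partial>Pn {..<n})\<^sup>2 \<le> (\<integral>z. \<bar>?V z - zt \<gamma>\<bar>\<^sup>2 \<partial>Pn {..<n})"
      by (rule P.square_integral_le) (use Vi(1) Vv(1) in auto)
    also have "\<dots> \<le> C4 / real n" using Vv(2) by simp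
    finally show ?thesis by (rule real_le_rsqrt)
  qed
  have eint: "integrable (Pn {..<n}) e"
    unfolding e_def[abs_def] using Vi(1) Wi(1) Li(1) Dabs(1) by auto
  define b1 where "b1 = \<bar>t\<bar> * \<delta> * (1 + zt \<gamma> / (M * s\<^sup>2) + (\<integral>z. (?L z)\<^sup>2 \<partial>Pn {..<n}) / s\<^sup>2)"
  define b3 where "b3 = (exp 2 * (M / N) + \<delta>') * t\<^sup>2 * zt \<gamma> / (M * s\<^sup>2)"
  define b4 where "b4 = t ^ 4 * (\<integral>z. ?W z \<partial>Pn {..<n}) / (\<delta>' * M ^ 3 * s ^ 4)"
  define b5 where "b5 = \<bar>t\<bar> * (\<integral>z. \<bar>?D z\<bar> \<partial>Pn {..<n}) / s"
  define b6 where "b6 = t\<^sup>2 * (\<integral>z. \<bar>?V z - zt \<gamma>\<bar> \<partial>Pn {..<n}) / (2 * M * s\<^sup>2)"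
  have e_int: "(\<integral>z. e z \<partial>Pn {..<n}) = b1 + 2 / (\<delta>\<^sup>2 * M) + b3 + b4 + (b5 + b6)"
    unfolding e_def b1_def b3_def b4_def b5_def b6_def using Vi Wi(1) Li(1) Dabs(1) by (simp add: P.prob_space)
  have B1: "b1 \<le> \<bar>t\<bar> * \<delta> * (2 + 2 * (1 + 2 * Cab * (real \<gamma> / real n) / var\<psi>))"
  proof -
    have "(\<integral>z. (?L z)\<^sup>2 \<partial>Pn {..<n}) * (1 / s\<^sup>2) \<le> (2 * (var\<psi> / real n + 2 * Cab * real \<gamma> / (real n)\<^sup>2)) * (real n / var\<psi>)"
      using Cab_nonneg v0 by (intro mult_mono Li(2) inverse_scale_le_n) auto
    also have "\<dots> = 2 * (1 + 2 * Cab * (real \<gamma> / real n) / var\<psi>)"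
      using v0 n_pos by (simp add: field_simps power2_eq_square)
    finally have "(\<integral>z. (?L z)\<^sup>2 \<partial>Pn {..<n}) / s\<^sup>2 \<le> 2 * (1 + 2 * Cab * (real \<gamma> / real n) / var\<psi>)" by simp
    then show ?thesis unfolding b1_def using zt_le_scale d by (intro mult_left_mono) auto
  qed
  have B3: "b3 \<le> exp 2 * t\<^sup>2 * sqrt C4 * (real \<gamma> / real n) / var\<psi> + \<delta>' * t\<^sup>2"
  proof -
    \<comment> \<open>Only the square is used, which is where \<open>2 \<le> \<gamma>\<close>
      enters. It beats the factor \<open>M / N\<close>: one power of \<open>n / \<gamma>\<close> is
      lost to \<open>1 / s\<^sup>2\<close> and \<open>zt \<gamma>\<close>, and one remains.\<close>
    have Nge: "(real n / real \<gamma>)\<^sup>2 \<le> N"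
    proof -
      have "(real n / real \<gamma>)\<^sup>2 \<le> (real n / real \<gamma>) ^ \<gamma>"
        using g2 gn by (intro power_increasing) auto
      also have "\<dots> \<le> N" using binomial_ge_n_over_k_pow_k[OF gn, where 'a = real] by simp
      finally show ?thesis .
    qed
    have "1 / N \<le> 1 / (real n / real \<gamma>)\<^sup>2"
      using Nge n_pos g2 binom_pos by (intro divide_left_mono) auto
    then have N1: "1 / N \<le> (real \<gamma> / real n)\<^sup>2" by (simp add: power_divide)
    have "M / N * (zt \<gamma> / (M * s\<^sup>2)) = zt \<gamma> * (1 / N) * (1 / s\<^sup>2)" using M0 by simp
    also have "\<dots> \<le> (sqrt C4 / real \<gamma>) * (real \<gamma> / real n)\<^sup>2 * (real n / var\<psi>)"
      using zt_pos C4_nonneg by (intro mult_mono zt_le g2 N1 inverse_scale_le_n mult_nonneg_nonneg) auto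
    also have "\<dots> = sqrt C4 * (real \<gamma> / real n) / var\<psi>"
      using n_pos g2 v0 by (simp add: field_simps power2_eq_square)
    finally have q: "M / N * (zt \<gamma> / (M * s\<^sup>2)) \<le> sqrt C4 * (real \<gamma> / real n) / var\<psi>" .
    have "b3 = exp 2 * t\<^sup>2 * (M / N * (zt \<gamma> / (M * s\<^sup>2))) + \<delta>' * t\<^sup>2 * (zt \<gamma> / (M * s\<^sup>2))"
    proof -
      have "(e * q + d) * u * z / w = e * u * (q * (z / w)) + d * u * (z / w)" for e q d u z w :: real
        by (simp add: distrib_right add_divide_distrib)
      then show ?thesis unfolding b3_def .
    qed
    also have "\<dots> \<le> exp 2 * t\<^sup>2 * (sqrt C4 * (real \<gamma> / real n) / var\<psi>) + \<delta>' * t\<^sup>2 * 1"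
      using d' by (intro add_mono mult_left_mono q zt_le_scale) auto
    finally show ?thesis by (simp add: mult.assoc)
  qed
  have B4: "b4 \<le> t ^ 4 * C4 / (\<delta>' * M * var\<psi>\<^sup>2)"
  proof -
    have W0: "(\<integral>z. ?W z \<partial>Pn {..<n}) \<ge> 0"
      unfolding WW_def[OF g2 gn] EPi_def by (intro Bochner_Integration.integral_nonneg divide_nonneg_nonneg sum_nonneg) auto
    have "b4 = t ^ 4 / (\<delta>' * M) * ((\<integral>z. ?W z \<partial>Pn {..<n}) * (1 / (M * s\<^sup>2))\<^sup>2)"
      unfolding b4_def by (simp add: power_divide power_mult_distrib eval_nat_numeral mult_ac)
    also have "\<dots> \<le> t ^ 4 / (\<delta>' * M) * (C4 / (real \<gamma>)\<^sup>2 * (real \<gamma> / var\<psi>)\<^sup>2)"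
      using d' M0 C4_nonneg by (intro mult_left_mono mult_mono Wi(2) power_mono inverse_scale_le_gamma) auto
    also have "\<dots> = t ^ 4 * C4 / (\<delta>' * M * var\<psi>\<^sup>2)" using g2 by (simp add: power_divide)
    finally show ?thesis .
  qed
  have B5: "b5 \<le> \<bar>t\<bar> * sqrt (2 * Cab * (real \<gamma> / real n) / var\<psi>)"
  proof -
    have s1: "1 / s = sqrt (1 / s\<^sup>2)" using scale_facts(2) by (simp add: real_sqrt_divide)
    have "(\<integral>z. \<bar>?D z\<bar> \<partial>Pn {..<n}) * (1 / s) \<le> sqrt (2 * Cab * real \<gamma> / (real n)\<^sup>2) * sqrt (real n / var\<psi>)"
      unfolding s1 by (intro mult_mono Dabs(2) real_sqrt_le_mono inverse_scale_le_n) (use Cab_nonneg in auto)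
    also have "\<dots> = sqrt (2 * Cab * (real \<gamma> / real n) / var\<psi>)"
      unfolding real_sqrt_mult[symmetric] using n_pos by (simp add: power2_eq_square)
    finally have "\<bar>t\<bar> * ((\<integral>z. \<bar>?D z\<bar> \<partial>Pn {..<n}) * (1 / s)) \<le> \<bar>t\<bar> * sqrt (2 * Cab * (real \<gamma> / real n) / var\<psi>)"
      by (intro mult_left_mono) auto
    then show ?thesis unfolding b5_def by simp
  qed
  have B6: "b6 \<le> t\<^sup>2 * sqrt C4 * (real \<gamma> / sqrt (real n)) / (2 * var\<psi>)"
  proof -
    have "b6 = t\<^sup>2 / 2 * ((\<integral>z. \<bar>?V z - zt \<gamma>\<bar> \<partial>Pn {..<n}) * (1 / (M * s\<^sup>2)))"
      unfolding b6_def by (simp add: mult_ac)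
    also have "\<dots> \<le> t\<^sup>2 / 2 * (sqrt (C4 / real n) * (real \<gamma> / var\<psi>))"
      using C4_nonneg M0 by (intro mult_left_mono mult_mono Vabs inverse_scale_le_gamma) auto
    also have "\<dots> = t\<^sup>2 * sqrt C4 * (real \<gamma> / sqrt (real n)) / (2 * var\<psi>)" by (simp add: real_sqrt_divide mult_ac)
    finally show ?thesis .
  qed
  have KG: "norm ((\<integral>z. K z \<partial>Pn {..<n}) - (\<integral>z. G z \<partial>Pn {..<n})) \<le> (\<integral>z. e z \<partial>Pn {..<n})"
  proof -
    have "norm ((\<integral>z. K z \<partial>Pn {..<n}) - (\<integral>z. G z \<partial>Pn {..<n})) = norm (\<integral>z. K z - G z \<partial>Pn {..<n})"
      using Kint Gint by simp
    also have "\<dots> \<le> (\<integral>z. norm (K z - G z) \<partial>Pn {..<n})" by (rule integral_norm_bound)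
    also have "\<dots> \<le> (\<integral>z. e z \<partial>Pn {..<n})"
      by (rule integral_mono_AE) (use Kint Gint eint le in auto)
    finally show ?thesis .
  qed
  have G1: "norm ((\<integral>z. G z \<partial>Pn {..<n}) - complex_of_real (exp (- (t\<^sup>2 / 2))))
     \<le> \<bar>t\<bar> ^ 3 / var\<psi> * c3 / sqrt (real n * var\<psi>) + t ^ 4 / real n"
  proof -
    let ?c = "t\<^sup>2 * zt \<gamma> / (2 * M * s\<^sup>2)"
    have sum: "real n * x\<^sup>2 * var\<psi> / 2 + ?c = t\<^sup>2 / 2"
    proof -
      have "real n * x\<^sup>2 * var\<psi> / 2 = t\<^sup>2 / 2 * ((var\<psi> / real n) / s\<^sup>2)"
        unfolding x_def power_divide power_mult_distrib using n_pos by (simp add: power2_eq_square)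
      moreover have "?c = t\<^sup>2 / 2 * ((zt \<gamma> / M) / s\<^sup>2)" by simp
      ultimately have "real n * x\<^sup>2 * var\<psi> / 2 + ?c = t\<^sup>2 / 2 * (s\<^sup>2 / s\<^sup>2)"
        unfolding scale_facts(1) by (simp only: distrib_left add_divide_distrib)
      then show ?thesis using scale_facts(2) by simp
    qed
    have ex: "exp (- (t\<^sup>2 / 2)) = exp (- (real n * x\<^sup>2 * var\<psi> / 2)) * exp (- ?c)"
      unfolding exp_add[symmetric] sum[symmetric] by simp
    have "(\<integral>z. G z \<partial>Pn {..<n}) - complex_of_real (exp (- (t\<^sup>2 / 2)))
      = ((\<integral>z. iexp (x * (\<Sum>i<n. \<psi> (z i))) \<partial>Pn {..<n}) - complex_of_real (exp (- (real n * x\<^sup>2 * var\<psi> / 2)))) * complex_of_real (exp (- ?c))"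
      unfolding ex Geq of_real_mult left_diff_distrib integral_mult_left_zero ..
    then have "norm ((\<integral>z. G z \<partial>Pn {..<n}) - complex_of_real (exp (- (t\<^sup>2 / 2))))
      = norm ((\<integral>z. iexp (x * (\<Sum>i<n. \<psi> (z i))) \<partial>Pn {..<n}) - complex_of_real (exp (- (real n * x\<^sup>2 * var\<psi> / 2)))) * exp (- ?c)"
      by (simp only: norm_mult norm_of_real abs_exp_cancel)
    also have "\<dots> \<le> norm ((\<integral>z. iexp (x * (\<Sum>i<n. \<psi> (z i))) \<partial>Pn {..<n}) - complex_of_real (exp (- (real n * x\<^sup>2 * var\<psi> / 2)))) * 1"
      using zt_pos M0 by (intro mult_left_mono) auto
    also have "\<dots> \<le> real n * (\<bar>x\<bar> ^ 3 * c3 + (x\<^sup>2 * var\<psi>)\<^sup>2)"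
      using iid_sum_char[of n x] by simp
    \<comment> \<open>The cube is split so that \<open>n * x\<^sup>2\<close> stays bounded and the
      remaining factor has order \<open>1 / sqrt n\<close>.\<close>
    also have "\<dots> = (real n * x\<^sup>2) * \<bar>x\<bar> * c3 + real n * (x\<^sup>2 * var\<psi>)\<^sup>2"
      by (simp add: distrib_left power3_eq_cube power2_eq_square)
    also have "\<dots> \<le> (t\<^sup>2 / var\<psi>) * (\<bar>t\<bar> / sqrt (real n * var\<psi>)) * c3 + real n * (t\<^sup>2 / real n)\<^sup>2"
    proof -
      have x2: "x\<^sup>2 \<le> t\<^sup>2 / (real n * var\<psi>)"
      proof -
        have "x\<^sup>2 = t\<^sup>2 / (real n)\<^sup>2 * (1 / s\<^sup>2)" by (simp add: x_def power_divide power_mult_distrib)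
        also have "\<dots> \<le> t\<^sup>2 / (real n)\<^sup>2 * (real n / var\<psi>)" by (intro mult_left_mono inverse_scale_le_n) auto
        finally show ?thesis using n_pos by (simp add: power2_eq_square)
      qed
      have "\<bar>x\<bar> \<le> sqrt (t\<^sup>2 / (real n * var\<psi>))" using x2 by (simp add: real_le_rsqrt)
      then have xa: "\<bar>x\<bar> \<le> \<bar>t\<bar> / sqrt (real n * var\<psi>)" by (simp add: real_sqrt_divide)
      have "real n * x\<^sup>2 \<le> real n * (t\<^sup>2 / (real n * var\<psi>))" by (intro mult_left_mono x2) auto
      then have nx: "real n * x\<^sup>2 \<le> t\<^sup>2 / var\<psi>" using n_pos by simp
      have "x\<^sup>2 * var\<psi> \<le> t\<^sup>2 / (real n * var\<psi>) * var\<psi>" using v0 by (intro mult_right_mono x2) auto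
      then have xv: "x\<^sup>2 * var\<psi> \<le> t\<^sup>2 / real n" using v0 by simp
      have c30: "c3 \<ge> 0" unfolding c3_def by (intro Bochner_Integration.integral_nonneg) auto
      show ?thesis
        using v0 c30 by (intro add_mono mult_mono nx xa mult_left_mono power_mono xv) auto
    qed
    also have "\<dots> = \<bar>t\<bar> ^ 3 / var\<psi> * c3 / sqrt (real n * var\<psi>) + t ^ 4 / real n"
    proof -
      have "\<bar>t\<bar> ^ 3 = t\<^sup>2 * \<bar>t\<bar>" by (simp add: power3_eq_cube power2_eq_square)
      moreover have "real n * (t\<^sup>2 / real n)\<^sup>2 = t ^ 4 / real n" using n_pos by (simp add: power2_eq_square power4_eq_xxxx)
      ultimately show ?thesis by simp
    qed
    finally show ?thesis .
  qed
  have "norm ((\<integral>z. K z \<partial>Pn {..<n}) - complex_of_real (exp (- (t\<^sup>2 / 2))))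
    \<le> (b1 + 2 / (\<delta>\<^sup>2 * M) + b3 + b4 + (b5 + b6)) + (\<bar>t\<bar> ^ 3 / var\<psi> * c3 / sqrt (real n * var\<psi>) + t ^ 4 / real n)"
    using norm_diff_triangle_le[OF KG G1] unfolding e_int .
  also have "\<dots> \<le> err t n \<gamma> M \<delta> \<delta>'"
    unfolding err_def using B1 B3 B4 B5 B6 by linarith
  finally show ?thesis unfolding KF .
qed

end

end

context perm_kernel begin

text \<open>The choices \<open>\<delta> = M powr (-1/4)\<close> and
  \<open>\<delta>' = M powr (-1/2)\<close>, written with square roots, make \<open>\<delta>\<close>,
  \<open>1 / (\<delta>\<^sup>2 * M)\<close>, \<open>\<delta>'\<close> and
  \<open>1 / (\<delta>' * M)\<close> vanish together.\<close>

lemma err_tendsto_0: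
  assumes v0: "var\<psi> > 0" and M: "filterlim M at_top sequentially"
    and g: "(\<lambda>n. real (\<gamma> n) / sqrt (real n)) \<longlonglongrightarrow> 0"
  shows "(\<lambda>n. err t n (\<gamma> n) (M n) (sqrt (1 / sqrt (M n))) (1 / sqrt (M n))) \<longlonglongrightarrow> 0"
proof -
  \<comment> \<open>For positive \<open>M n\<close>, all dependence on \<open>M\<close> is through
    \<open>y\<close>: \<open>\<delta>\<close> is \<open>sqrt y\<close>, while
    \<open>\<delta>'\<close>, \<open>1 / (\<delta>\<^sup>2 * M)\<close> and
    \<open>1 / (\<delta>' * M)\<close> all equal \<open>y\<close>.\<close>
  define y where "y n = 1 / sqrt (M n)" for n
  have y: "y \<longlonglongrightarrow> 0"
  proof -
    have "filterlim (\<lambda>n. sqrt (M n)) at_top sequentially" by (rule filterlim_compose[OF sqrt_at_top M])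
    then have "(\<lambda>n. inverse (sqrt (M n))) \<longlonglongrightarrow> 0" by (rule tendsto_inverse_0_at_top)
    then show ?thesis by (simp add: y_def[abs_def] inverse_eq_divide)
  qed
  have sy: "(\<lambda>n. sqrt (y n)) \<longlonglongrightarrow> 0" using tendsto_real_sqrt[OF y] by simp
  have n: "(\<lambda>n. 1 / real n) \<longlonglongrightarrow> 0" by (rule lim_1_over_n)
  have sn: "(\<lambda>n. 1 / sqrt (real n)) \<longlonglongrightarrow> 0" using tendsto_real_sqrt[OF n] by (simp add: real_sqrt_divide)
  have gn: "(\<lambda>n. real (\<gamma> n) / real n) \<longlonglongrightarrow> 0"
  proof -
    have "(\<lambda>n. real (\<gamma> n) / sqrt (real n) * (1 / sqrt (real n))) \<longlonglongrightarrow> 0 * 0" by (rule tendsto_mult[OF g sn])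
    then show ?thesis by simp
  qed
  define E where "E n = \<bar>t\<bar> * sqrt (y n) * (2 + 2 * (1 + 2 * Cab * (real (\<gamma> n) / real n) / var\<psi>)) + 2 * y n
    + exp 2 * t\<^sup>2 * sqrt C4 * (real (\<gamma> n) / real n) / var\<psi> + y n * t\<^sup>2 + t ^ 4 * C4 / var\<psi>\<^sup>2 * y n
    + \<bar>t\<bar> * sqrt (2 * Cab * (real (\<gamma> n) / real n) / var\<psi>) + t\<^sup>2 * sqrt C4 * (real (\<gamma> n) / sqrt (real n)) / (2 * var\<psi>)
    + \<bar>t\<bar> ^ 3 / var\<psi> * c3 / sqrt var\<psi> * (1 / sqrt (real n)) + t ^ 4 * (1 / real n)" for n
  have "E \<longlonglongrightarrow> \<bar>t\<bar> * 0 * (2 + 2 * (1 + 2 * Cab * 0 / var\<psi>)) + 2 * 0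
    + exp 2 * t\<^sup>2 * sqrt C4 * 0 / var\<psi> + 0 * t\<^sup>2 + t ^ 4 * C4 / var\<psi>\<^sup>2 * 0
    + \<bar>t\<bar> * sqrt (2 * Cab * 0 / var\<psi>) + t\<^sup>2 * sqrt C4 * 0 / (2 * var\<psi>)
    + \<bar>t\<bar> ^ 3 / var\<psi> * c3 / sqrt var\<psi> * 0 + t ^ 4 * 0"
    unfolding E_def[abs_def] using v0 by (intro tendsto_intros y sy n sn gn g) auto
  then have E0: "E \<longlonglongrightarrow> 0" by simp
  have "eventually (\<lambda>n. M n > 0) sequentially" using M by (simp add: filterlim_at_top_dense)
  then have "eventually (\<lambda>n. E n = err t n (\<gamma> n) (M n) (sqrt (1 / sqrt (M n))) (1 / sqrt (M n))) sequentially"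
  proof eventually_elim
    case (elim n)
    have "(sqrt (1 / sqrt (M n)))\<^sup>2 * M n = sqrt (M n)" "1 / sqrt (M n) * M n = sqrt (M n)"
      using elim by (simp_all add: real_div_sqrt)
    then show ?case unfolding E_def err_def y_def by (simp add: real_sqrt_mult mult_ac)
  qed
  then show ?thesis by (rule Lim_transform_eventually[OF E0])
qed

end

section \<open>The additive regression model\<close>

text \<open>Two functions are involved because the regression kernel \<open>f\<close> is jointly
  measurable, while the formula \<open>h\<close> for it holds only almost surely in the data and
  only for labels in \<open>D\<close>.\<close>

lemma integral_pair_pmf_of_set:
  fixes f :: "'a \<times> 'b \<Rightarrow> real"
  assumes M: "prob_space M" and D: "finite D" "D \<noteq> {}"
    and f[measurable]: "f \<in> borel_measurable (M \<Otimes>\<^sub>M measure_pmf (pmf_of_set D))"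
    and h: "\<And>\<pi>. \<pi> \<in> D \<Longrightarrow> integrable M (\<lambda>z. h z \<pi>)"
    and eq: "AE z in M. \<forall>\<pi>\<in>D. f (z, \<pi>) = h z \<pi>"
  shows "(\<integral>x. f x \<partial>(M \<Otimes>\<^sub>M measure_pmf (pmf_of_set D))) = (\<Sum>\<pi>\<in>D. \<integral>z. h z \<pi> \<partial>M) / real (card D)"
proof -
  let ?P = "measure_pmf (pmf_of_set D)"
  interpret M: prob_space M by fact
  interpret P: prob_space ?P by (rule measure_pmf.prob_space_axioms)
  interpret PP: pair_prob_space M ?P ..
  have int: "(\<integral>y. k y \<partial>?P) = (\<Sum>\<pi>\<in>D. k \<pi>) / real (card D)" for k :: "'b \<Rightarrow> real"
    by (rule integral_pmf_of_set[OF D(2,1)])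
  have fin: "finite (set_pmf (pmf_of_set D))" using D by simp
  have fi: "integrable (M \<Otimes>\<^sub>M ?P) f"
  proof (rule PP.Fubini_integrable)
    have "integrable M (\<lambda>z. (\<Sum>\<pi>\<in>D. \<bar>h z \<pi>\<bar>) / real (card D))" using h by auto
    moreover have "(\<lambda>x. \<integral>y. norm (f (x, y)) \<partial>?P) \<in> borel_measurable M" by measurable
    moreover have "AE x in M. (\<Sum>\<pi>\<in>D. \<bar>h x \<pi>\<bar>) / real (card D) = (\<integral>y. norm (f (x, y)) \<partial>?P)"
      using eq by eventually_elim (simp add: int)
    ultimately show "integrable M (\<lambda>x. \<integral>y. norm (f (x, y)) \<partial>?P)"
      using integrable_cong_AE_imp by blast
    show "AE x in M. integrable ?P (\<lambda>y. f (x, y))" by (simp add: integrable_measure_pmf_finite fin)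
  qed measurable
  have "(\<integral>x. f x \<partial>(M \<Otimes>\<^sub>M ?P)) = (\<integral>x. (\<integral>y. f (x, y) \<partial>?P) \<partial>M)"
    using PP.integral_fst'[OF fi] by simp
  also have "\<dots> = (\<integral>x. (\<Sum>\<pi>\<in>D. h x \<pi>) / real (card D) \<partial>M)"
  proof (rule integral_cong_AE)
    show "AE x in M. (\<integral>y. f (x, y) \<partial>?P) = (\<Sum>\<pi>\<in>D. h x \<pi>) / real (card D)"
      using eq by eventually_elim (simp add: int)
    show "(\<lambda>x. (\<Sum>\<pi>\<in>D. h x \<pi>) / real (card D)) \<in> borel_measurable M" using h by (auto intro!: borel_measurable_integrable)
  qed measurable
  also have "\<dots> = (\<Sum>\<pi>\<in>D. \<integral>z. h z \<pi> \<partial>M) / real (card D)" using h by (simp add: Bochner_Integration.integral_sum)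
  finally show ?thesis .
qed

locale additive_model =
  fixes p j :: nat and \<mu> :: "real measure" and mt :: "(nat \<Rightarrow> real) \<Rightarrow> real"
    and m :: "nat \<Rightarrow> real \<Rightarrow> real" and K :: real
  assumes j: "j < p"
    and mt_meas: "mt \<in> borel_measurable (PiM {..<p} (\<lambda>_. lborel))"
    and eps_prob: "prob_space \<mu>" and eps_sets: "sets \<mu> = sets borel"
    and eps_mean: "integrable \<mu> (\<lambda>e. e)" "(\<integral>e. e \<partial>\<mu>) = 0"
    and eps_var: "integrable \<mu> (\<lambda>e. e\<^sup>2)" "(\<integral>e. e\<^sup>2 \<partial>\<mu>) > 0"
    and additive: "\<And>x. (\<forall>l<p. x l \<in> {0..1}) \<Longrightarrow> mt x = (\<Sum>l<p. m l (x l))"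
    and bounded: "\<And>x. (\<forall>l<p. x l \<in> {0..1}) \<Longrightarrow> \<bar>mt x\<bar> \<le> K"
    and eps4: "integrable \<mu> (\<lambda>e. e ^ 4)"
    and mj_meas[measurable]: "m j \<in> borel_measurable borel"
    and var_mj: "var_of (uniform_measure lborel {0..1::real}) (m j) > 0"
begin

abbreviation "U \<equiv> uniform_measure lborel {0..1::real}"
abbreviation "Z \<equiv> Zlaw p \<mu>"

definition "mbar = (\<integral>u. m j u \<partial>U)"
text \<open>Set to \<open>0\<close> outside the unit interval, so that it is bounded everywhere and not just almost surely.\<close>

definition "g u = (if u \<in> {0..1} then m j u - mbar else 0)"
definition "\<tau>2 = (\<integral>u. (g u)\<^sup>2 \<partial>U)"
definition "\<sigma>2 = (\<integral>e. e\<^sup>2 \<partial>\<mu>)"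
definition "\<theta> = 2 * \<tau>2"
definition "af z = g (fst z j)" for z :: "(nat \<Rightarrow> real) \<times> real"
definition "\<psi> z = 2 * (af z)\<^sup>2 + 2 * snd z * af z - \<theta>"
definition "\<beta> z = - 2 * (af z + snd z)"
definition "good x \<longleftrightarrow> (\<forall>l<p. x l \<in> {0..1::real})" for x :: "nat \<Rightarrow> real"

lemma U_prob: "prob_space U" by (rule prob_space_uniform_measure) auto

lemma U_sets[measurable_cong]: "sets U = sets borel" by simp

lemma U_AE: "AE u in U. u \<in> {0..1}"
  by (rule AE_uniform_measureI) auto

lemma mu_sets[measurable_cong]: "sets \<mu> = sets borel" by (rule eps_sets)

lemma X_prob: "prob_space (Xlaw p)" unfolding Xlaw_def by (intro prob_space_PiM U_prob)

lemma X_sets[measurable_cong]: "sets (Xlaw p) = sets (PiM {..<p} (\<lambda>_. borel))"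
  unfolding Xlaw_def by (intro sets_PiM_cong) auto

lemma mt_meas'[measurable]: "mt \<in> borel_measurable (PiM {..<p} (\<lambda>_. borel))"
proof -
  have "sets (PiM {..<p} (\<lambda>_. lborel)) = sets (PiM {..<p} (\<lambda>_. borel :: real measure))" by (intro sets_PiM_cong) auto
  then show ?thesis using mt_meas measurable_cong_sets by blast
qed

lemma Z_prob: "prob_space Z"
proof -
  interpret X: prob_space "Xlaw p" by (rule X_prob)
  interpret e: prob_space \<mu> by (rule eps_prob)
  interpret P: pair_prob_space "Xlaw p" \<mu> ..
  show ?thesis unfolding Zlaw_def by (rule P.prob_space_axioms)
qed

lemma Z_sets[measurable_cong]: "sets Z = sets (PiM {..<p} (\<lambda>_. borel) \<Otimes>\<^sub>M borel)"
  unfolding Zlaw_def by (intro sets_pair_measure_cong X_sets mu_sets)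

lemma mj_diff: "u \<in> {0..1} \<Longrightarrow> v \<in> {0..1} \<Longrightarrow> good x \<Longrightarrow> mt (x(j := u)) - mt (x(j := v)) = m j u - m j v"
proof -
  assume a: "u \<in> {0..1}" "v \<in> {0..1}" "good x"
  have e: "mt (x(j := w)) = m j w + (\<Sum>l\<in>{..<p} - {j}. m l (x l))" if "w \<in> {0..1}" for w
  proof -
    have "mt (x(j := w)) = (\<Sum>l<p. m l ((x(j := w)) l))" by (rule additive) (use a that in \<open>auto simp: good_def\<close>)
    also have "\<dots> = m j ((x(j := w)) j) + (\<Sum>l\<in>{..<p} - {j}. m l ((x(j := w)) l))" using j by (subst sum.remove[of _ j]) auto
    also have "(\<Sum>l\<in>{..<p} - {j}. m l ((x(j := w)) l)) = (\<Sum>l\<in>{..<p} - {j}. m l (x l))" by (intro sum.cong) auto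
    finally show ?thesis by (simp only: fun_upd_same)
  qed
  show ?thesis using e[OF a(1)] e[OF a(2)] by simp
qed

text \<open>The bound \<open>K\<close> is on the sum of the components, and these are determined
  only up to additive constants. Two values of \<open>mt\<close> at points that differ in coordinate
  \<open>j\<close> alone bound the oscillation of \<open>m j\<close>, and the value at 0 fixes the
  constant.\<close>

lemma mj_bounded: "u \<in> {0..1} \<Longrightarrow> \<bar>m j u\<bar> \<le> \<bar>m j 0\<bar> + 2 * K"
proof -
  assume u: "u \<in> {0..1}"
  have z: "good (\<lambda>_. 0)" by (simp add: good_def)
  have "\<bar>mt ((\<lambda>_. 0)(j := w))\<bar> \<le> K" if "w \<in> {0..1}" for w using that by (intro bounded) auto
  from this[OF u] this[of 0] mj_diff[OF u, of 0, OF _ z] show ?thesis by auto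
qed

lemma g_meas[measurable]: "g \<in> borel_measurable borel" unfolding g_def[abs_def] by measurable

definition "B = \<bar>m j 0\<bar> + 2 * K + \<bar>mbar\<bar>"

lemma g_bounded: "\<bar>g u\<bar> \<le> B"
  using mj_bounded[of u] mj_bounded[of 0] by (auto simp: g_def B_def)

lemma B_nonneg: "B \<ge> 0" using g_bounded[of 0] by linarith

lemma U_int_bdd: "f \<in> borel_measurable borel \<Longrightarrow> (\<And>u. \<bar>f u\<bar> \<le> C) \<Longrightarrow> integrable U f" for f :: "real \<Rightarrow> real"
  by (rule finite_measure.integrable_const_bound[where B = C])
    (use prob_space.finite_measure[OF U_prob] in auto)

lemma g_int: "integrable U g" "integrable U (\<lambda>u. (g u)\<^sup>2)"
proof -
  show "integrable U g" by (rule U_int_bdd[of _ B]) (auto simp: g_bounded)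
  show "integrable U (\<lambda>u. (g u)\<^sup>2)"
    by (rule U_int_bdd[of _ "B\<^sup>2"]) (auto simp: abs_le_square_iff[symmetric] intro: order_trans[OF g_bounded])
qed

lemma mj_int: "integrable U (m j)"
  by (rule finite_measure.integrable_const_bound[where B = "\<bar>m j 0\<bar> + 2 * K"])
    (use prob_space.finite_measure[OF U_prob] U_AE mj_bounded in auto)

lemma g_mean: "(\<integral>u. g u \<partial>U) = 0"
proof -
  interpret U: prob_space U by (rule U_prob)
  have "(\<integral>u. g u \<partial>U) = (\<integral>u. m j u - mbar \<partial>U)"
    by (rule integral_cong_AE) (use U_AE in \<open>auto simp: g_def\<close>)
  also have "\<dots> = 0" using mj_int U.prob_space by (simp add: mbar_def)
  finally show ?thesis .
qed

lemma tau_pos: "\<tau>2 > 0"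
proof -
  have "\<tau>2 = (\<integral>u. (m j u - mbar)\<^sup>2 \<partial>U)"
    unfolding \<tau>2_def by (rule integral_cong_AE) (use U_AE in \<open>auto simp: g_def\<close>)
  then show ?thesis using var_mj by (simp add: var_of_def mbar_def)
qed

lemma sigma_pos: "\<sigma>2 > 0" using eps_var(2) by (simp add: \<sigma>2_def)

lemma af_meas[measurable]: "af \<in> borel_measurable Z"
proof -
  have "(\<lambda>z. fst z j) \<in> measurable (PiM {..<p} (\<lambda>_. borel) \<Otimes>\<^sub>M borel) borel"
    using j by (intro measurable_compose[OF measurable_fst measurable_component_singleton]) auto
  then have "(\<lambda>z. fst z j) \<in> measurable Z borel" using measurable_cong_sets[OF Z_sets refl] by blast
  then show ?thesis unfolding af_def[abs_def] by measurable
qed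

lemma snd_meas[measurable]: "(\<lambda>z. snd z) \<in> borel_measurable Z"
proof -
  have "snd \<in> borel_measurable (PiM {..<p} (\<lambda>_. borel :: real measure) \<Otimes>\<^sub>M (borel :: real measure))" by (rule measurable_snd)
  then show ?thesis using measurable_cong_sets[OF Z_sets refl] by blast
qed

lemma Z_prod:
  fixes f h :: "real \<Rightarrow> real"
  assumes f: "f \<in> borel_measurable borel" "integrable U (\<lambda>u. f (g u))" and h: "integrable \<mu> h"
  shows "integrable Z (\<lambda>z. f (af z) * h (snd z))" "(\<integral>z. f (af z) * h (snd z) \<partial>Z) = (\<integral>u. f (g u) \<partial>U) * (\<integral>e. h e \<partial>\<mu>)"
proof -
  have fm: "(\<lambda>u. f (g u)) \<in> borel_measurable U" using f(2) by auto
  have jm: "j \<in> {..<p}" using j by simp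
  have X: "integrable (Xlaw p) (\<lambda>x. f (g (x j)))" "(\<integral>x. f (g (x j)) \<partial>Xlaw p) = (\<integral>u. f (g u) \<partial>U)"
    unfolding Xlaw_def using integral_PiM_component[of "{..<p}" "\<lambda>_. U" j "\<lambda>u. f (g u)"] U_prob jm fm f(2) by auto
  show "integrable Z (\<lambda>z. f (af z) * h (snd z))"
    "(\<integral>z. f (af z) * h (snd z) \<partial>Z) = (\<integral>u. f (g u) \<partial>U) * (\<integral>e. h e \<partial>\<mu>)"
    unfolding Zlaw_def af_def using integral_pair_mult[OF X_prob eps_prob X(1) h] X(2) by auto
qed

lemma one_mu: "integrable \<mu> (\<lambda>_. 1 :: real)" "(\<integral>e. 1 \<partial>\<mu>) = (1::real)"
proof -
  interpret e: prob_space \<mu> by (rule eps_prob)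
  show "integrable \<mu> (\<lambda>_. 1 :: real)" "(\<integral>e. 1 \<partial>\<mu>) = (1::real)" using e.prob_space by auto
qed

lemma one_U: "integrable U (\<lambda>_. c :: real)" "(\<integral>u. c \<partial>U) = (c::real)"
proof -
  interpret U: prob_space U by (rule U_prob)
  show "integrable U (\<lambda>_. c :: real)" "(\<integral>e. c \<partial>U) = (c::real)" using U.prob_space by auto
qed

lemma g_poly_int: "integrable U (\<lambda>u. (c * (g u)\<^sup>2 - d) * g u)"
proof (rule U_int_bdd[of _ "(\<bar>c\<bar> * B\<^sup>2 + \<bar>d\<bar>) * B"])
  show "\<bar>(c * (g u)\<^sup>2 - d) * g u\<bar> \<le> (\<bar>c\<bar> * B\<^sup>2 + \<bar>d\<bar>) * B" for u
  proof -
    have "(g u)\<^sup>2 \<le> B\<^sup>2" using g_bounded[of u] by (simp add: abs_le_square_iff[symmetric] B_nonneg)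
    then have "\<bar>c\<bar> * (g u)\<^sup>2 \<le> \<bar>c\<bar> * B\<^sup>2" by (intro mult_left_mono) auto
    then have "\<bar>c * (g u)\<^sup>2 - d\<bar> \<le> \<bar>c\<bar> * B\<^sup>2 + \<bar>d\<bar>"
      using abs_triangle_ineq4[of "c * (g u)\<^sup>2" d] by (simp add: abs_mult)
    then show ?thesis unfolding abs_mult using g_bounded[of u] by (intro mult_mono) auto
  qed
qed measurable

lemma af_bounded: "\<bar>af z\<bar> \<le> B" unfolding af_def by (rule g_bounded)

lemma e_int: "integrable Z (\<lambda>z. snd z ^ 4)" "integrable Z (\<lambda>z. snd z)" "(\<integral>z. snd z \<partial>Z) = 0"
  using Z_prod[of "\<lambda>_. 1", OF _ one_U(1) eps4] Z_prod[of "\<lambda>_. 1", OF _ one_U(1) eps_mean(1)] eps_mean(2) by simp_all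

lemma a_int: "integrable Z af" "(\<integral>z. af z \<partial>Z) = 0" "integrable Z (\<lambda>z. (af z)\<^sup>2)" "(\<integral>z. (af z)\<^sup>2 \<partial>Z) = \<tau>2"
  using Z_prod[of "\<lambda>x. x", OF _ g_int(1) one_mu(1)] Z_prod[of "\<lambda>x. x\<^sup>2", OF _ g_int(2) one_mu(1)] g_mean one_mu(2)
  by (simp_all add: \<tau>2_def)

lemma ae_int: "integrable Z (\<lambda>z. af z * snd z)" "(\<integral>z. af z * snd z \<partial>Z) = 0"
  using Z_prod[of "\<lambda>x. x", OF _ g_int(1) eps_mean(1)] g_mean by simp_all

lemma a4_int: "integrable Z (\<lambda>z. af z ^ 4)"
proof (rule finite_measure.integrable_const_bound[where B = "B ^ 4"])
  show "finite_measure Z" using prob_space.finite_measure[OF Z_prob] .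
  show "AE z in Z. norm (af z ^ 4) \<le> B ^ 4"
    using power_mono[OF af_bounded abs_ge_zero, of _ 4] by (intro AE_I2) (simp add: power_abs)
qed measurable

lemma psi_meas[measurable]: "\<psi> \<in> borel_measurable Z" unfolding \<psi>_def[abs_def] by measurable
lemma beta_meas[measurable]: "\<beta> \<in> borel_measurable Z" unfolding \<beta>_def[abs_def] by measurable

lemma beta4: "integrable Z (\<lambda>z. \<beta> z ^ 4)"
proof (rule Bochner_Integration.integrable_bound)
  show "integrable Z (\<lambda>z. 16 * (8 * (af z ^ 4 + snd z ^ 4)))" using a4_int e_int by auto
  show "AE z in Z. norm (\<beta> z ^ 4) \<le> norm (16 * (8 * (af z ^ 4 + snd z ^ 4)))"
  proof (intro AE_I2)
    fix z
    have "\<beta> z ^ 4 = 16 * (af z + snd z) ^ 4" unfolding \<beta>_def power_mult_distrib by simp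
    also have "\<dots> \<le> 16 * (8 * (af z ^ 4 + snd z ^ 4))" by (intro mult_left_mono pow4_add_le) auto
    finally show "norm (\<beta> z ^ 4) \<le> norm (16 * (8 * (af z ^ 4 + snd z ^ 4)))" by simp
  qed
qed measurable

lemma psi4: "integrable Z (\<lambda>z. \<psi> z ^ 4)"
proof (rule Bochner_Integration.integrable_bound)
  interpret Z: prob_space Z by (rule Z_prob)
  let ?R = "\<lambda>z. 8 * ((2 * B\<^sup>2 + \<bar>\<theta>\<bar>) ^ 4 + 16 * B ^ 4 * snd z ^ 4)"
  show "integrable Z ?R" using e_int by auto
  show "AE z in Z. norm (\<psi> z ^ 4) \<le> norm (?R z)"
  proof (intro AE_I2)
    fix z
    have 1: "\<bar>2 * (af z)\<^sup>2 - \<theta>\<bar> \<le> 2 * B\<^sup>2 + \<bar>\<theta>\<bar>"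
    proof -
      have "(af z)\<^sup>2 \<le> B\<^sup>2" using af_bounded[of z] by (simp add: abs_le_square_iff[symmetric] B_nonneg)
      then show ?thesis using abs_triangle_ineq4[of "2 * (af z)\<^sup>2" \<theta>] by simp
    qed
    have "\<psi> z ^ 4 = ((2 * (af z)\<^sup>2 - \<theta>) + 2 * snd z * af z) ^ 4" by (simp add: \<psi>_def algebra_simps)
    also have "\<dots> \<le> 8 * ((2 * (af z)\<^sup>2 - \<theta>) ^ 4 + (2 * snd z * af z) ^ 4)" by (rule pow4_add_le)
    also have "\<dots> \<le> ?R z"
    proof (intro mult_left_mono add_mono)
      show "(2 * (af z)\<^sup>2 - \<theta>) ^ 4 \<le> (2 * B\<^sup>2 + \<bar>\<theta>\<bar>) ^ 4"
        using power_mono[OF 1, of 4] by (simp add: power_even_abs)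
      have "af z ^ 4 \<le> B ^ 4" using power_mono[OF af_bounded[of z], of 4] by (simp add: power_even_abs)
      then have "16 * snd z ^ 4 * af z ^ 4 \<le> 16 * snd z ^ 4 * B ^ 4" by (intro mult_left_mono) auto
      then show "(2 * snd z * af z) ^ 4 \<le> 16 * B ^ 4 * snd z ^ 4" by (simp add: power_mult_distrib mult_ac)
    qed auto
    finally show "norm (\<psi> z ^ 4) \<le> norm (?R z)" by simp
  qed
qed measurable

lemma psi0: "(\<integral>z. \<psi> z \<partial>Z) = 0"
proof -
  interpret Z: prob_space Z by (rule Z_prob)
  have e: "\<psi> z = 2 * (af z)\<^sup>2 + 2 * (af z * snd z) - \<theta>" for z by (simp add: \<psi>_def)
  show ?thesis unfolding e using a_int ae_int Z.prob_space by (simp add: \<theta>_def)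
qed

lemma beta0: "(\<integral>z. \<beta> z \<partial>Z) = 0"
  unfolding \<beta>_def using a_int e_int by simp

sublocale perm_kernel Z \<psi> af \<beta>
proof (intro perm_kernel.intro perm_kernel_axioms.intro)
qed (use Z_prob psi4 a4_int beta4 psi0 a_int beta0 in auto)

text \<open>The cross term is linear in the noise and integrates to 0, and the square of the pure
  covariate part is dropped. Positivity comes from the noise term
  \<open>4 * \<tau>2 * \<sigma>2\<close>, which survives even if the squared centred component is
  almost surely constant.\<close>

lemma var_psi_pos: "var\<psi> > 0"
proof -
  let ?P = "\<lambda>z. (2 * (af z)\<^sup>2 - \<theta>)\<^sup>2"
  let ?Q = "\<lambda>z. (2 * (af z)\<^sup>2 - \<theta>) * af z * snd z"
  let ?R = "\<lambda>z. (af z)\<^sup>2 * (snd z)\<^sup>2"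
  have e: "(\<psi> z)\<^sup>2 = ?P z + 4 * ?Q z + 4 * ?R z" for z
    by (simp add: \<psi>_def power2_eq_square algebra_simps)
  have Q: "integrable Z ?Q" "(\<integral>z. ?Q z \<partial>Z) = 0"
    using Z_prod[of "\<lambda>x. (2 * x\<^sup>2 - \<theta>) * x", OF _ g_poly_int eps_mean(1)] eps_mean(2) by simp_all
  have R: "integrable Z ?R" "(\<integral>z. ?R z \<partial>Z) = \<tau>2 * \<sigma>2"
    using Z_prod[of "\<lambda>x. x\<^sup>2", OF _ g_int(2) eps_var(1)] by (simp_all add: \<tau>2_def \<sigma>2_def)
  have i: "integrable Z (\<lambda>z. (\<psi> z)\<^sup>2)" by (rule integrable_lower_powers(2)[OF psi_meas psi4])
  have "(\<integral>z. 4 * ?Q z + 4 * ?R z \<partial>Z) \<le> (\<integral>z. (\<psi> z)\<^sup>2 \<partial>Z)"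
    by (rule integral_mono) (use Q R i e in auto)
  then have "4 * (\<tau>2 * \<sigma>2) \<le> var\<psi>" unfolding var\<psi>_def using Q R by simp
  moreover have "\<tau>2 * \<sigma>2 > 0" using tau_pos sigma_pos by simp
  ultimately show ?thesis by linarith
qed

lemma good_AE: "AE z in Z. good (fst z)"
proof -
  interpret X: prob_space "Xlaw p" by (rule X_prob)
  interpret e: prob_space \<mu> by (rule eps_prob)
  interpret P: pair_prob_space "Xlaw p" \<mu> ..
  have "AE x in Xlaw p. \<forall>l\<in>{..<p}. x l \<in> {0..1}"
    unfolding Xlaw_def using U_prob U_AE by (intro AE_finite_allI AE_PiM_component) auto
  then have 1: "AE x in Xlaw p. good x" by eventually_elim (auto simp: good_def)
  have [measurable]: "Measurable.pred (Xlaw p) good"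
  proof -
    have "Measurable.pred (PiM {..<p} (\<lambda>_. borel)) (\<lambda>x. \<forall>l\<in>{..<p}. x l \<in> {0..1::real})" by measurable
    moreover have "good = (\<lambda>x. \<forall>l\<in>{..<p}. x l \<in> {0..1})" by (auto simp: good_def fun_eq_iff)
    ultimately show ?thesis by (simp add: measurable_cong_sets[OF X_sets refl])
  qed
  show ?thesis unfolding Zlaw_def
    by (rule P.AE_pair_measure) (use 1 in \<open>auto\<close>)
qed

lemma good_AE_Pn: "finite I \<Longrightarrow> AE z in Pn I. \<forall>i\<in>I. good (fst (z i))"
  using Z_prob good_AE by (intro AE_finite_allI AE_PiM_component[where P = "\<lambda>z. good (fst z)"]) auto

lemma mt_diff: "good x \<Longrightarrow> u \<in> {0..1} \<Longrightarrow> mt x - mt (x(j := u)) = g (x j) - g u"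
proof -
  assume a: "good x" "u \<in> {0..1}"
  have xj: "x j \<in> {0..1}" using a j by (auto simp: good_def)
  then have "mt (x(j := x j)) - mt (x(j := u)) = m j (x j) - m j u" using a by (intro mj_diff)
  then show ?thesis using xj a by (simp add: g_def)
qed

text \<open>With a, a' the centred components at \<open>i\<close> and \<open>\<pi> i\<close>, the
  summand is (a - a')^2 + 2 e (a - a'). Replacing the square of a' by that of a changes no sum over
  \<open>S\<close>, since \<open>\<pi>\<close> permutes \<open>S\<close>; what results has no term
  that depends on \<open>\<pi> i\<close> alone.\<close>

lemma hker_eq:
  assumes p: "\<pi> \<in> derangements S" and S: "finite S" "S \<noteq> {}" and gd: "\<forall>i\<in>S. good (fst (z i))"
  shows "hker mt j S z \<pi> = \<theta> + hc S z \<pi>"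
proof -
  have t: "(Yof mt (z i) - mt ((fst (z i))(j := fst (z (\<pi> i)) j)))\<^sup>2 - (Yof mt (z i) - mt (fst (z i)))\<^sup>2
     = \<theta> + kern \<pi> z i + ((af (z (\<pi> i)))\<^sup>2 - (af (z i))\<^sup>2)" if i: "i \<in> S" for i
  proof -
    have pi: "\<pi> i \<in> S" using derangementsD(3)[OF p i] .
    have u: "fst (z (\<pi> i)) j \<in> {0..1}" using gd pi j by (auto simp: good_def)
    have "mt (fst (z i)) - mt ((fst (z i))(j := fst (z (\<pi> i)) j)) = af (z i) - af (z (\<pi> i))"
      using mt_diff[OF _ u] gd i by (simp add: af_def)
    then have y1: "Yof mt (z i) - mt ((fst (z i))(j := fst (z (\<pi> i)) j)) = snd (z i) + (af (z i) - af (z (\<pi> i)))"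
      by (simp add: Yof_def)
    have y2: "Yof mt (z i) - mt (fst (z i)) = snd (z i)" by (simp add: Yof_def)
    show ?thesis unfolding y1 y2 by (simp add: kern_def \<psi>_def \<beta>_def power2_eq_square algebra_simps)
  qed
  have perm: "(\<Sum>i\<in>S. (af (z (\<pi> i)))\<^sup>2) = (\<Sum>i\<in>S. (af (z i))\<^sup>2)"
    using sum.permute[OF derangementsD(1)[OF p], of "\<lambda>i. (af (z i))\<^sup>2"] by (simp add: comp_def)
  have c: "real (card S) > 0" using S by (simp add: card_gt_0_iff)
  have "(\<Sum>i\<in>S. (Yof mt (z i) - mt ((fst (z i))(j := fst (z (\<pi> i)) j)))\<^sup>2 - (Yof mt (z i) - mt (fst (z i)))\<^sup>2)
     = (\<Sum>i\<in>S. \<theta> + kern \<pi> z i + ((af (z (\<pi> i)))\<^sup>2 - (af (z i))\<^sup>2))"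
    using t by (intro sum.cong) auto
  also have "\<dots> = real (card S) * \<theta> + (\<Sum>i\<in>S. kern \<pi> z i)"
    unfolding sum.distrib sum_subtractf perm by simp
  finally show ?thesis unfolding hker_def hc_def using c by (simp add: field_simps)
qed

end

section \<open>Variances, target and statistic of the model in terms of the abstract kernel\<close>

context additive_model begin

lemma mt_upd_measurable:
  assumes [measurable]: "f \<in> measurable A (PiM {..<p} (\<lambda>_. borel))" "h \<in> borel_measurable A"
  shows "(\<lambda>x. mt ((f x)(j := h x))) \<in> borel_measurable A"
proof -
  have "(\<lambda>x. (f x)(j := h x)) \<in> measurable A (PiM {..<p} (\<lambda>_. borel))"
    by (rule measurable_fun_upd[where J = "{..<p}"]) (use j assms in auto)
  then show ?thesis by (rule measurable_compose) (rule mt_meas')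
qed

lemma fst_coord_measurable:
  assumes "i \<in> I"
  shows "(\<lambda>z. fst (z i)) \<in> measurable (Pn I) (PiM {..<p} (\<lambda>_. borel))"
    "(\<lambda>z. snd (z i)) \<in> borel_measurable (Pn I)"
    "(\<lambda>z. fst (z i) j) \<in> borel_measurable (Pn I)"
proof -
  have c: "(\<lambda>z. z i) \<in> measurable (Pn I) Z" using assms by (rule measurable_component_singleton)
  have "fst \<in> measurable Z (PiM {..<p} (\<lambda>_. borel))"
    using measurable_cong_sets[OF Z_sets refl] measurable_fst by blast
  with c show 1: "(\<lambda>z. fst (z i)) \<in> measurable (Pn I) (PiM {..<p} (\<lambda>_. borel))" by (rule measurable_compose)
  show "(\<lambda>z. snd (z i)) \<in> borel_measurable (Pn I)" by (rule measurable_compose[OF c snd_meas])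
  show "(\<lambda>z. fst (z i) j) \<in> borel_measurable (Pn I)"
    using measurable_compose[OF 1 measurable_component_singleton[of j]] j by simp
qed

text \<open>The difficulty is the evaluation of the data at the random index \<open>fq x i\<close>.
  The index takes countably many values, so it suffices to fix it as a constant \<open>k\<close> and
  treat each value separately.\<close>

lemma hker_measurable:
  assumes SI: "S \<subseteq> I"
    and z: "fz \<in> measurable A (Pn I)" and q: "fq \<in> measurable A (count_space UNIV)"
  shows "(\<lambda>x. hker mt j S (fz x) (fq x)) \<in> borel_measurable A"
proof -
  have main: "(\<lambda>x. mt ((fst (fz x i))(j := fst (fz x (fq x i)) j))) \<in> borel_measurable A" if i: "i \<in> S" for i
  proof (rule measurable_compose_countable[where g = "\<lambda>x. fq x i" and f = "\<lambda>k x. mt ((fst (fz x i))(j := fst (fz x k) j))"])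
    have iI: "i \<in> I" using i SI by blast
    show "(\<lambda>x. fq x i) \<in> measurable A (count_space UNIV)"
      by (rule measurable_compose[OF q]) simp
    fix k
    have "(\<lambda>x. fst (fz x k) j) \<in> borel_measurable A"
    proof (cases "k \<in> I")
      case True
      show ?thesis by (rule measurable_compose[OF z fst_coord_measurable(3)[OF True]])
    next
      \<comment> \<open>Outside \<open>I\<close> a point of the product space takes the value
        \<open>undefined\<close>, so the map is constant on the space.\<close>
      case False
      have "fst (fz x k) j = fst (undefined :: (nat \<Rightarrow> real) \<times> real) j" if "x \<in> space A" for x
        using measurable_space[OF z that] False by (auto simp: space_PiM PiE_def extensional_def)
      then show ?thesis by (subst measurable_cong) auto
    qed
    then show "(\<lambda>x. mt ((fst (fz x i))(j := fst (fz x k) j))) \<in> borel_measurable A"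
      by (intro mt_upd_measurable measurable_compose[OF z fst_coord_measurable(1)[OF iI]])
  qed
  have [measurable]: "(\<lambda>x. mt (fst (fz x i))) \<in> borel_measurable A" "(\<lambda>x. snd (fz x i)) \<in> borel_measurable A" if "i \<in> S" for i
    using that SI measurable_compose[OF measurable_compose[OF z fst_coord_measurable(1)] mt_meas', of i]
      measurable_compose[OF z fst_coord_measurable(2), of i] by auto
  note main[measurable]
  show ?thesis unfolding hker_def Yof_def by measurable
qed

lemma finite_set_pmf_D: "finite S \<Longrightarrow> card S \<ge> 2 \<Longrightarrow> finite (derangements S) \<and> derangements S \<noteq> {}"
  using finite_derangements derangements_nonempty by blast

lemma kernel_measurable:
  "(\<lambda>x. hker mt j {..<\<gamma>} (fst x) (snd x)) \<in> borel_measurable (kernel_space p \<mu> \<gamma>)"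
proof (rule hker_measurable[OF order_refl])
  show "fst \<in> measurable (kernel_space p \<mu> \<gamma>) (Pn {..<\<gamma>})" unfolding kernel_space_def by (rule measurable_fst)
  have "snd \<in> measurable (kernel_space p \<mu> \<gamma>) (measure_pmf (pmf_of_set (derangements {..<\<gamma>})))"
    unfolding kernel_space_def by (rule measurable_snd)
  then show "snd \<in> measurable (kernel_space p \<mu> \<gamma>) (count_space UNIV)" by simp
qed

lemma zeta_eq:
  assumes "\<gamma> \<ge> 2"
  shows "zeta p \<mu> mt j \<gamma> = zt \<gamma>"
proof -
  let ?A = "{..<\<gamma>}"
  let ?D = "derangements ?A"
  have D: "finite ?D" "?D \<noteq> {}" using finite_set_pmf_D[of ?A] assms by auto
  have D0: "real (card ?D) > 0" using D by (simp add: card_gt_0_iff)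
  have ne: "?A \<noteq> {}" using assms by (auto simp: lessThan_empty_iff)
  have hm: "(\<lambda>x. hker mt j ?A (fst x) (snd x)) \<in> borel_measurable (Pn ?A \<Otimes>\<^sub>M measure_pmf (pmf_of_set ?D))"
    using kernel_measurable[of \<gamma>] by (simp add: kernel_space_def)
  have eq: "AE z in Pn ?A. \<forall>\<pi>\<in>?D. hker mt j ?A z \<pi> = \<theta> + hc ?A z \<pi>"
    using good_AE_Pn[OF finite_lessThan[of \<gamma>]] by eventually_elim (use hker_eq ne in blast)
  interpret P: prob_space "Pn ?A" by (rule Pn_prob)
  have mean: "(\<integral>x. hker mt j ?A (fst x) (snd x) \<partial>kernel_space p \<mu> \<gamma>) = \<theta>"
  proof -
    have "(\<integral>x. hker mt j ?A (fst x) (snd x) \<partial>(Pn ?A \<Otimes>\<^sub>M measure_pmf (pmf_of_set ?D))) = (\<Sum>\<pi>\<in>?D. \<integral>z. \<theta> + hc ?A z \<pi> \<partial>Pn ?A) / real (card ?D)"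
    proof (rule integral_pair_pmf_of_set[OF Pn_prob D hm])
      show "integrable (Pn ?A) (\<lambda>z. \<theta> + hc ?A z \<pi>)" if "\<pi> \<in> ?D" for \<pi>
        using hc_mean(2)[OF finite_lessThan order_refl that] by simp
      show "AE z in Pn ?A. \<forall>\<pi>\<in>?D. hker mt j ?A (fst (z, \<pi>)) (snd (z, \<pi>)) = \<theta> + hc ?A z \<pi>" using eq by simp
    qed
    also have "(\<Sum>\<pi>\<in>?D. \<integral>z. \<theta> + hc ?A z \<pi> \<partial>Pn ?A) = (\<Sum>\<pi>\<in>?D. \<theta>)"
      using hc_mean[OF finite_lessThan order_refl] P.prob_space by (intro sum.cong) auto
    finally show ?thesis using D0 by (simp add: kernel_space_def)
  qed
  have "zeta p \<mu> mt j \<gamma> = (\<integral>x. (hker mt j ?A (fst x) (snd x) - \<theta>)\<^sup>2 \<partial>(Pn ?A \<Otimes>\<^sub>M measure_pmf (pmf_of_set ?D)))"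
    unfolding zeta_def var_of_def split_beta' mean by (simp add: kernel_space_def)
  also have "\<dots> = (\<Sum>\<pi>\<in>?D. \<integral>z. (hc ?A z \<pi>)\<^sup>2 \<partial>Pn ?A) / real (card ?D)"
  proof (rule integral_pair_pmf_of_set[OF Pn_prob D])
    show "(\<lambda>x. (hker mt j ?A (fst x) (snd x) - \<theta>)\<^sup>2) \<in> borel_measurable (Pn ?A \<Otimes>\<^sub>M measure_pmf (pmf_of_set ?D))"
      using hm by measurable
    show "integrable (Pn ?A) (\<lambda>z. (hc ?A z \<pi>)\<^sup>2)" if "\<pi> \<in> ?D" for \<pi>
      by (rule hc_square_integrable[OF finite_lessThan order_refl that])
    show "AE z in Pn ?A. \<forall>\<pi>\<in>?D. (hker mt j ?A (fst (z, \<pi>)) (snd (z, \<pi>)) - \<theta>)\<^sup>2 = (hc ?A z \<pi>)\<^sup>2"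
      using eq by eventually_elim auto
  qed
  also have "\<dots> = zt \<gamma>" unfolding zt_def using assms by (simp add: EPi_eq)
  finally show ?thesis .
qed

text \<open>Index 0 carries the conditioned data point. It meets the others in two coupling terms,
  its own and that of its preimage under \<open>\<pi>\<close>; in each the partner is a different
  random point with centred factor. Thus only \<open>\<psi> z1\<close> survives, for every
  derangement.\<close>

lemma hc_update_mean:
  assumes g: "\<gamma> \<ge> 2" and p: "\<pi> \<in> derangements {..<\<gamma>}"
  shows "integrable (Pn {1..<\<gamma>}) (\<lambda>z. hc {..<\<gamma>} (z(0 := z1)) \<pi>)"
    "(\<integral>z. hc {..<\<gamma>} (z(0 := z1)) \<pi> \<partial>Pn {1..<\<gamma>}) = \<psi> z1 / real \<gamma>"
proof -
  let ?I = "{1..<\<gamma>}"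
  interpret P: prob_space "Pn ?I" by (rule Pn_prob)
  note lp = integrable_lower_powers(1)
  note ia = lp[OF af_meas a4_int] and ib = lp[OF beta_meas beta4] and ip = lp[OF psi_meas psi4]
  have k: "integrable (Pn ?I) (\<lambda>z. kern \<pi> (z(0 := z1)) i) \<and> (\<integral>z. kern \<pi> (z(0 := z1)) i \<partial>Pn ?I) = (if i = 0 then \<psi> z1 else 0)"
    if i: "i < \<gamma>" for i
  proof (cases "i = 0")
    case True
    have pi: "\<pi> 0 < \<gamma>" "\<pi> 0 \<noteq> 0" using derangementsD(2,3)[OF p, of 0] i True by auto
    then have m: "\<pi> 0 \<in> ?I" by auto
    have "kern \<pi> (z(0 := z1)) i = \<psi> z1 + \<beta> z1 * af (z (\<pi> 0))" for z using True pi by (simp add: kern_def)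
    then show ?thesis
      using coord_integrable[OF m ia] coord_integral[OF m af_meas] a_int(2) True P.prob_space by (simp del: One_nat_def)
  next
    case False
    then have iI: "i \<in> ?I" using i by auto
    have pi: "\<pi> i < \<gamma>" "\<pi> i \<noteq> i" using derangementsD(2,3)[OF p, of i] i by auto
    have 1: "integrable (Pn ?I) (\<lambda>z. \<psi> (z i))" "(\<integral>z. \<psi> (z i) \<partial>Pn ?I) = 0"
      using coord_integrable[OF iI ip] coord_integral[OF iI psi_meas] psi0 by auto
    show ?thesis
    proof (cases "\<pi> i = 0")
      case True
      have "kern \<pi> (z(0 := z1)) i = \<psi> (z i) + \<beta> (z i) * af z1" for z using True False by (simp add: kern_def)
      then show ?thesis
        using 1 coord_integrable[OF iI ib] coord_integral[OF iI beta_meas] beta0 False by simp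
    next
      case F2: False
      then have m: "\<pi> i \<in> ?I" using pi by auto
      have d: "depends_only {\<pi> i} (space (Pn ?I)) (\<lambda>z. af (z (\<pi> i)))" by (simp add: depends_only_def)
      have n: "i \<notin> {\<pi> i}" using pi by auto
      have fin: "finite ?I" by simp
      note cf = coord_factor[OF fin iI ib coord_integrable[OF m ia] d n]
      have "kern \<pi> (z(0 := z1)) i = \<psi> (z i) + \<beta> (z i) * af (z (\<pi> i))" for z using F2 False by (simp add: kern_def)
      then show ?thesis using 1 cf beta0 False by simp
    qed
  qed
  show "integrable (Pn ?I) (\<lambda>z. hc {..<\<gamma>} (z(0 := z1)) \<pi>)"
    unfolding hc_def by (intro integrable_divide Bochner_Integration.integrable_sum) (use k in auto)
  have "(\<integral>z. hc {..<\<gamma>} (z(0 := z1)) \<pi> \<partial>Pn ?I) = (\<integral>z. (\<Sum>i<\<gamma>. kern \<pi> (z(0 := z1)) i) \<partial>Pn ?I) / real \<gamma>"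
    unfolding hc_def integral_divide_zero card_lessThan ..
  also have "(\<integral>z. (\<Sum>i<\<gamma>. kern \<pi> (z(0 := z1)) i) \<partial>Pn ?I) = (\<Sum>i<\<gamma>. \<integral>z. kern \<pi> (z(0 := z1)) i \<partial>Pn ?I)"
    by (rule Bochner_Integration.integral_sum) (use k in auto)
  also have "\<dots> = (\<Sum>i<\<gamma>. if i = 0 then \<psi> z1 else 0)" using k by (intro sum.cong) auto
  also have "(\<Sum>i<\<gamma>. if i = 0 then \<psi> z1 else 0) = \<psi> z1" using g by simp
  finally show "(\<integral>z. hc {..<\<gamma>} (z(0 := z1)) \<pi> \<partial>Pn ?I) = \<psi> z1 / real \<gamma>" .
qed

lemma update_measurable:
  fixes \<gamma> :: nat
  assumes "\<gamma> \<ge> 2"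
  shows "(\<lambda>x. (fst (snd x))(0 := fst x)) \<in> measurable (Z \<Otimes>\<^sub>M (Pn {1..<\<gamma>} \<Otimes>\<^sub>M Q)) (Pn {..<\<gamma>})"
proof (rule measurable_fun_upd[where J = "{1..<\<gamma>}"])
  show "{..<\<gamma>} = {1..<\<gamma>} \<union> {0}" using assms by auto
qed measurable

lemma cond_h1_measurable:
  assumes "\<gamma> \<ge> 2"
  shows "cond_h1 p \<mu> mt j \<gamma> \<in> borel_measurable Z"
    "z1 \<in> space Z \<Longrightarrow> (\<lambda>x. hker mt j {..<\<gamma>} ((fst x)(0 := z1)) (snd x)) \<in> borel_measurable (Pn {1..<\<gamma>} \<Otimes>\<^sub>M measure_pmf (pmf_of_set (derangements {..<\<gamma>})))"
proof -
  let ?Q = "measure_pmf (pmf_of_set (derangements {..<\<gamma>}))"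
  interpret P: prob_space "Pn {1..<\<gamma>}" by (rule Pn_prob)
  interpret Q: prob_space ?Q by (rule measure_pmf.prob_space_axioms)
  interpret PQ: pair_prob_space "Pn {1..<\<gamma>}" ?Q ..
  have m: "(\<lambda>x. hker mt j {..<\<gamma>} ((fst (snd x))(0 := fst x)) (snd (snd x))) \<in> borel_measurable (Z \<Otimes>\<^sub>M (Pn {1..<\<gamma>} \<Otimes>\<^sub>M ?Q))"
  proof (rule hker_measurable[OF order_refl update_measurable[OF assms]])
    have "(\<lambda>x. snd (snd x)) \<in> measurable (Z \<Otimes>\<^sub>M (Pn {1..<\<gamma>} \<Otimes>\<^sub>M ?Q)) ?Q" by measurable
    then show "(\<lambda>x. snd (snd x)) \<in> measurable (Z \<Otimes>\<^sub>M (Pn {1..<\<gamma>} \<Otimes>\<^sub>M ?Q)) (count_space UNIV)" by simp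
  qed
  have "(\<lambda>z1. \<integral>x. hker mt j {..<\<gamma>} ((fst x)(0 := z1)) (snd x) \<partial>(Pn {1..<\<gamma>} \<Otimes>\<^sub>M ?Q)) \<in> borel_measurable Z"
    by (rule PQ.borel_measurable_lebesgue_integral) (use m in \<open>simp add: split_beta'\<close>)
  then show "cond_h1 p \<mu> mt j \<gamma> \<in> borel_measurable Z"
    unfolding cond_h1_def[abs_def] split_beta' .
  assume z1: "z1 \<in> space Z"
  show "(\<lambda>x. hker mt j {..<\<gamma>} ((fst x)(0 := z1)) (snd x)) \<in> borel_measurable (Pn {1..<\<gamma>} \<Otimes>\<^sub>M ?Q)"
    using measurable_compose[OF measurable_Pair1'[OF z1] m] by simp
qed

lemma zeta1_eq:
  assumes g: "\<gamma> \<ge> 2"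
  shows "zeta1 p \<mu> mt j \<gamma> = var\<psi> / (real \<gamma>)\<^sup>2"
proof -
  let ?D = "derangements {..<\<gamma>}"
  have D: "finite ?D" "?D \<noteq> {}" using finite_set_pmf_D[of "{..<\<gamma>}"] g by auto
  have D0: "real (card ?D) > 0" using D by (simp add: card_gt_0_iff)
  have ne: "{..<\<gamma>} \<noteq> {}" using g by (auto simp: lessThan_empty_iff)
  interpret P: prob_space "Pn {1..<\<gamma>}" by (rule Pn_prob)
  have c: "AE z1 in Z. cond_h1 p \<mu> mt j \<gamma> z1 = \<theta> + \<psi> z1 / real \<gamma>"
    using good_AE AE_space
  proof eventually_elim
    case (elim z1)
    have "cond_h1 p \<mu> mt j \<gamma> z1 = (\<integral>x. hker mt j {..<\<gamma>} ((fst x)(0 := z1)) (snd x) \<partial>(Pn {1..<\<gamma>} \<Otimes>\<^sub>M measure_pmf (pmf_of_set ?D)))"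
      unfolding cond_h1_def split_beta' ..
    also have "\<dots> = (\<Sum>\<pi>\<in>?D. \<integral>z. \<theta> + hc {..<\<gamma>} (z(0 := z1)) \<pi> \<partial>Pn {1..<\<gamma>}) / real (card ?D)"
    proof (rule integral_pair_pmf_of_set[OF Pn_prob D cond_h1_measurable(2)[OF g elim(2)]])
      show "integrable (Pn {1..<\<gamma>}) (\<lambda>z. \<theta> + hc {..<\<gamma>} (z(0 := z1)) \<pi>)" if "\<pi> \<in> ?D" for \<pi>
        using hc_update_mean(1)[OF g that] by (simp del: One_nat_def)
      have fin: "finite {1..<\<gamma>}" by simp
      show "AE z in Pn {1..<\<gamma>}. \<forall>\<pi>\<in>?D. hker mt j {..<\<gamma>} ((fst (z, \<pi>))(0 := z1)) (snd (z, \<pi>)) = \<theta> + hc {..<\<gamma>} (z(0 := z1)) \<pi>"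
        using good_AE_Pn[OF fin]
      proof eventually_elim
        case (elim z)
        have "\<forall>i\<in>{..<\<gamma>}. good (fst ((z(0 := z1)) i))" using elim \<open>good (fst z1)\<close> by auto
        then show ?case using hker_eq[OF _ finite_lessThan ne] by simp
      qed
    qed
    also have "(\<Sum>\<pi>\<in>?D. \<integral>z. \<theta> + hc {..<\<gamma>} (z(0 := z1)) \<pi> \<partial>Pn {1..<\<gamma>}) = (\<Sum>\<pi>\<in>?D. \<theta> + \<psi> z1 / real \<gamma>)"
      using hc_update_mean[OF g] P.prob_space by (intro sum.cong) (auto simp del: One_nat_def)
    finally show ?case using D0 by simp
  qed
  note cm = cond_h1_measurable(1)[OF g]
  have ip: "integrable Z \<psi>" by (rule integrable_lower_powers(1)[OF psi_meas psi4])
  have "(\<integral>z. cond_h1 p \<mu> mt j \<gamma> z \<partial>Z) = (\<integral>z. \<theta> + \<psi> z / real \<gamma> \<partial>Z)"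
    by (rule integral_cong_AE[OF cm _ c]) measurable
  also have "\<dots> = \<theta>" using ip psi0 prob_space by simp
  finally have mean: "(\<integral>z. cond_h1 p \<mu> mt j \<gamma> z \<partial>Z) = \<theta>" .
  have "zeta1 p \<mu> mt j \<gamma> = (\<integral>z. (\<psi> z / real \<gamma>)\<^sup>2 \<partial>Z)"
    unfolding zeta1_def var_of_def mean
  proof (rule integral_cong_AE)
    show "(\<lambda>z. (cond_h1 p \<mu> mt j \<gamma> z - \<theta>)\<^sup>2) \<in> borel_measurable Z" using cm by measurable
    show "AE z in Z. (cond_h1 p \<mu> mt j \<gamma> z - \<theta>)\<^sup>2 = (\<psi> z / real \<gamma>)\<^sup>2" using c by eventually_elim simp
  qed measurable
  then show ?thesis by (simp add: power_divide var\<psi>_def)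
qed

text \<open>The replacement error is the noise plus the difference of two independent copies of the
  centred component. These three are uncorrelated, so the mean square is
  \<open>\<sigma>2 + 2 * \<tau>2\<close>.\<close>

lemma Ij_eq: "Ij p \<mu> mt j = \<theta>"
proof -
  interpret U: prob_space U by (rule U_prob)
  interpret ZU: pair_prob_space Z U ..
  have fm: "fst \<in> measurable Z (PiM {..<p} (\<lambda>_. borel))"
    using measurable_cong_sets[OF Z_sets refl] measurable_fst by blast
  have ff: "(\<lambda>x. fst (fst x)) \<in> measurable (Z \<Otimes>\<^sub>M U) (PiM {..<p} (\<lambda>_. borel))"
    by (rule measurable_compose[OF measurable_fst fm])
  have [measurable]: "(\<lambda>x. snd (fst x)) \<in> borel_measurable (Z \<Otimes>\<^sub>M U)" "(\<lambda>x. snd x) \<in> borel_measurable (Z \<Otimes>\<^sub>M U)"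
    "(\<lambda>x. af (fst x)) \<in> borel_measurable (Z \<Otimes>\<^sub>M U)" by measurable
  have [measurable]: "(\<lambda>x. mt ((fst (fst x))(j := snd x))) \<in> borel_measurable (Z \<Otimes>\<^sub>M U)"
    by (rule mt_upd_measurable[OF ff]) measurable
  have [measurable]: "(\<lambda>x. mt (fst (fst x))) \<in> borel_measurable (Z \<Otimes>\<^sub>M U)"
    by (rule measurable_compose[OF ff mt_meas'])
  have AEg: "AE x in Z \<Otimes>\<^sub>M U. good (fst (fst x)) \<and> snd x \<in> {0..1}"
  proof (rule ZU.AE_pair_measure)
    have "Measurable.pred (PiM {..<p} (\<lambda>_. borel)) (\<lambda>x. \<forall>l\<in>{..<p}. x l \<in> {0..1::real})" by measurable
    moreover have "good = (\<lambda>x. \<forall>l\<in>{..<p}. x l \<in> {0..1})" by (auto simp: good_def fun_eq_iff)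
    ultimately have "Measurable.pred (PiM {..<p} (\<lambda>_. borel)) good" by simp
    then have [measurable]: "Measurable.pred (Z \<Otimes>\<^sub>M U) (\<lambda>x. good (fst (fst x)))" by (rule measurable_compose[OF ff])
    show "{x \<in> space (Z \<Otimes>\<^sub>M U). good (fst (fst x)) \<and> snd x \<in> {0..1}} \<in> sets (Z \<Otimes>\<^sub>M U)" by measurable
    show "AE z in Z. AE u in U. good (fst (fst (z, u))) \<and> snd (z, u) \<in> {0..1}"
      using good_AE
    proof eventually_elim
      case (elim z)
      show ?case using U_AE by eventually_elim (simp add: elim)
    qed
  qed
  have "(\<integral>x. (Yof mt (fst x) - mt ((fst (fst x))(j := snd x)))\<^sup>2 \<partial>(Z \<Otimes>\<^sub>M U))
     = (\<integral>x. (snd (fst x) + af (fst x) - g (snd x))\<^sup>2 \<partial>(Z \<Otimes>\<^sub>M U))"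
  proof (rule integral_cong_AE)
    show "(\<lambda>x. (Yof mt (fst x) - mt ((fst (fst x))(j := snd x)))\<^sup>2) \<in> borel_measurable (Z \<Otimes>\<^sub>M U)"
      unfolding Yof_def by measurable
    show "AE x in Z \<Otimes>\<^sub>M U. (Yof mt (fst x) - mt ((fst (fst x))(j := snd x)))\<^sup>2 = (snd (fst x) + af (fst x) - g (snd x))\<^sup>2"
      using AEg
    proof eventually_elim
      case (elim x)
      then have "mt (fst (fst x)) - mt ((fst (fst x))(j := snd x)) = af (fst x) - g (snd x)"
        unfolding af_def by (intro mt_diff) auto
      then have "Yof mt (fst x) - mt ((fst (fst x))(j := snd x)) = snd (fst x) + af (fst x) - g (snd x)"
        by (simp add: Yof_def)
      then show ?case by simp
    qed
  qed measurable
  also have "\<dots> = \<sigma>2 + \<tau>2 + \<tau>2"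
  proof -
    have e2: "integrable Z (\<lambda>z. (snd z)\<^sup>2)" "(\<integral>z. (snd z)\<^sup>2 \<partial>Z) = \<sigma>2"
      using Z_prod[of "\<lambda>_. 1", OF _ one_U(1) eps_var(1)] by (simp_all add: \<sigma>2_def)
    have i1: "integrable Z (\<lambda>z. (snd z + af z)\<^sup>2)" "(\<integral>z. (snd z + af z)\<^sup>2 \<partial>Z) = \<sigma>2 + \<tau>2"
    proof -
      have e: "(snd z + af z)\<^sup>2 = (snd z)\<^sup>2 + (af z)\<^sup>2 + 2 * (af z * snd z)" for z :: "(nat \<Rightarrow> real) \<times> real"
        by (simp add: power2_sum)
      show "integrable Z (\<lambda>z. (snd z + af z)\<^sup>2)" "(\<integral>z. (snd z + af z)\<^sup>2 \<partial>Z) = \<sigma>2 + \<tau>2"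
        unfolding e using e2 a_int ae_int by simp_all
    qed
    have i2: "integrable Z (\<lambda>z. snd z + af z)" "(\<integral>z. snd z + af z \<partial>Z) = 0"
      using e_int a_int by simp_all
    note pm = integral_pair_mult[OF Z_prob U_prob]
    have e: "(snd (fst x) + af (fst x) - g (snd x))\<^sup>2
       = (snd (fst x) + af (fst x))\<^sup>2 * 1 + 1 * (g (snd x))\<^sup>2 - 2 * ((snd (fst x) + af (fst x)) * g (snd x))" for x
      by (simp add: power2_diff)
    have oneZ: "integrable Z (\<lambda>_. 1 :: real)" "(\<integral>z. 1 \<partial>Z) = (1 :: real)" using prob_space by auto
    note p1 = pm[OF i1(1) one_U(1)[of 1]] and p2 = pm[OF oneZ(1) g_int(2)] and p3 = pm[OF i2(1) g_int(1)]
    show ?thesis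
      unfolding e
      using p1 p2 p3 i1(2) i2(2) g_mean one_U(2)[of 1] oneZ(2) by (simp add: \<tau>2_def)
  qed
  finally show ?thesis unfolding Ij_def split_beta' by (simp add: \<theta>_def \<sigma>2_def)
qed

lemma I_incomplete_measurable:
  "I_incomplete mt j n \<gamma> \<in> borel_measurable (incomplete_space p \<mu> n \<gamma> M)"
proof -
  let ?N = "incomplete_space p \<mu> n \<gamma> M"
  let ?J = "subsets_of n \<gamma>"
  have z: "fst \<in> measurable ?N (Pn {..<n})" unfolding incomplete_space_def by (rule measurable_fst)
  have c: "(\<lambda>\<omega>. snd \<omega> S) \<in> measurable ?N (count_space UNIV)" if "S \<in> ?J" for S
  proof -
    have "(\<lambda>\<omega>. snd \<omega> S) \<in> measurable ?N (measure_pmf (pair_pmf (bernoulli_pmf (M / real (n choose \<gamma>))) (pmf_of_set (derangements S))))"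
      unfolding incomplete_space_def by (rule measurable_compose[OF measurable_snd measurable_component_singleton[OF that]])
    then show ?thesis by simp
  qed
  have [measurable]: "(\<lambda>\<omega>. hker mt j S (fst \<omega>) (snd (snd \<omega> S))) \<in> borel_measurable ?N" if "S \<in> ?J" for S
    by (rule hker_measurable[OF _ z measurable_compose[OF c[OF that]]]) (use subsets_ofD[OF that] in auto)
  have [measurable]: "Measurable.pred ?N (\<lambda>\<omega>. fst (snd \<omega> S))" if "S \<in> ?J" for S
    using measurable_compose[OF c[OF that], of fst "count_space UNIV"] by simp
  have card: "real (card {S\<in>?J. fst (snd \<omega> S)}) = (\<Sum>S\<in>?J. if fst (snd \<omega> S) then 1 else 0)"
    for \<omega> :: "(nat \<Rightarrow> (nat \<Rightarrow> real) \<times> real) \<times> (nat set \<Rightarrow> bool \<times> (nat \<Rightarrow> nat))"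
    using finite_subsets_of by (subst sum.inter_filter[symmetric]) auto
  show ?thesis unfolding I_incomplete_def[abs_def] card by measurable
qed

lemma incomplete_prob: "prob_space (incomplete_space p \<mu> n \<gamma> M)"
proof -
  interpret A: prob_space "Pn {..<n}" by (rule Pn_prob)
  interpret B: prob_space "PiM (subsets_of n \<gamma>) (\<lambda>S. measure_pmf (pair_pmf (bernoulli_pmf (M / real (n choose \<gamma>))) (pmf_of_set (derangements S))))"
    by (intro prob_space_PiM measure_pmf.prob_space_axioms)
  interpret P: pair_prob_space "Pn {..<n}" "PiM (subsets_of n \<gamma>) (\<lambda>S. measure_pmf (pair_pmf (bernoulli_pmf (M / real (n choose \<gamma>))) (pmf_of_set (derangements S))))" ..
  show ?thesis unfolding incomplete_space_def by (rule P.prob_space_axioms)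
qed

text \<open>The threshold 16 is what makes \<open>sqrt (1 / sqrt M)\<close> at most 1/2, as the
  comparison of the random with the expected sample size demands.\<close>

lemma I_incomplete_char_bound:
  assumes g2: "2 \<le> \<gamma>" and gn: "\<gamma> \<le> n" and M: "16 \<le> M" "M \<le> real (n choose \<gamma>)"
    and s: "s = sqrt ((real \<gamma>)\<^sup>2 * zeta1 p \<mu> mt j \<gamma> / real n + zeta p \<mu> mt j \<gamma> / M)"
  shows "norm ((\<integral>\<omega>. iexp (t * ((I_incomplete mt j n \<gamma> \<omega> - Ij p \<mu> mt j) / s)) \<partial>incomplete_space p \<mu> n \<gamma> M)
    - complex_of_real (exp (- (t\<^sup>2 / 2)))) \<le> err t n \<gamma> M (sqrt (1 / sqrt M)) (1 / sqrt M)"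
proof -
  have M0: "0 < M" using M by simp
  have s': "s = sqrt (var\<psi> / real n + zt \<gamma> / M)"
    unfolding s zeta_eq[OF g2] zeta1_eq[OF g2] using g2 by simp
  have sM: "4 \<le> sqrt M" using M(1) by (simp add: real_le_rsqrt)
  have "1 / sqrt M \<le> 1 / 4" using sM M0 by (intro divide_left_mono) auto
  then have "sqrt (1 / sqrt M) \<le> sqrt ((1 / 2)\<^sup>2)" by (intro real_sqrt_le_mono) (simp add: power2_eq_square)
  then have d: "0 < sqrt (1 / sqrt M)" "sqrt (1 / sqrt M) \<le> 1 / 2" "0 < 1 / sqrt M" using M0 by auto
  note F = stat_char_bound[OF g2 gn M0 M(2) var_psi_pos s' d, of "\<lambda>\<omega>. (I_incomplete mt j n \<gamma> \<omega> - Ij p \<mu> mt j) / s" \<theta> t,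
      folded incomplete_space_def]
  show ?thesis
  proof (rule F)
    show "(\<lambda>\<omega>. (I_incomplete mt j n \<gamma> \<omega> - Ij p \<mu> mt j) / s) \<in> borel_measurable (incomplete_space p \<mu> n \<gamma> M)"
      using I_incomplete_measurable by measurable
    let ?J = "subsets_of n \<gamma>"
    let ?P = "\<lambda>S. measure_pmf (pair_pmf (bernoulli_pmf (M / real (n choose \<gamma>))) (pmf_of_set (derangements S)))"
    \<comment> \<open>The label space contains all functions, whereas \<open>hker_eq\<close> speaks
      of derangements; almost surely every drawn label is one.\<close>
    have pos: "AE \<omega> in PiM ?J ?P. \<forall>S\<in>?J. snd (\<omega> S) \<in> derangements S"
    proof (intro AE_finite_allI finite_subsets_of)
      fix S assume S: "S \<in> ?J"
      have "finite (derangements S) \<and> derangements S \<noteq> {}"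
        using finite_set_pmf_D[of S] subsets_ofD[OF S] g2 by auto
      then have "AE x in ?P S. snd x \<in> derangements S"
        by (auto simp: AE_measure_pmf_iff)
      then show "AE \<omega> in PiM ?J ?P. snd (\<omega> S) \<in> derangements S"
        by (intro AE_PiM_component[where P = "\<lambda>x. snd x \<in> derangements S"] S measure_pmf.prob_space_axioms)
    qed
    show "AE z in Pn {..<n}. AE \<omega> in PiM ?J ?P.
      (I_incomplete mt j n \<gamma> (z, \<omega>) - Ij p \<mu> mt j) / s =
      ((\<Sum>S\<in>?J. if fst (\<omega> S) then \<theta> + hc S z (snd (\<omega> S)) else 0) / real (card {S \<in> ?J. fst (\<omega> S)}) - \<theta>) / s"
      using good_AE_Pn[OF finite_lessThan[of n]]
    proof eventually_elim
      case (elim z)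
      show ?case using pos
      proof eventually_elim
        case (elim \<omega>)
        have "hker mt j S z (snd (\<omega> S)) = \<theta> + hc S z (snd (\<omega> S))" if S: "S \<in> ?J" for S
        proof (rule hker_eq)
          show "snd (\<omega> S) \<in> derangements S" using elim S by blast
          show "finite S" using subsets_ofD[OF S] by blast
          show "S \<noteq> {}" using subsets_ofD[OF S] g2 by auto
          show "\<forall>i\<in>S. good (fst (z i))" using \<open>\<forall>i\<in>{..<n}. good (fst (z i))\<close> subsets_ofD[OF S] by blast
        qed
        then have "(\<Sum>S\<in>?J. if fst (\<omega> S) then hker mt j S z (snd (\<omega> S)) else 0) = (\<Sum>S\<in>?J. if fst (\<omega> S) then \<theta> + hc S z (snd (\<omega> S)) else 0)"
          by (intro sum.cong) auto
        then show ?case unfolding I_incomplete_def Ij_eq fst_conv snd_conv by (simp only:)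
      qed
    qed
  qed
qed

end

section \<open>Convergence in distribution by Levy continuity\<close>

theorem theorem3:
  fixes p j :: nat
    and \<mu> :: "real measure"
    and mt :: "(nat \<Rightarrow> real) \<Rightarrow> real"
    and m :: "nat \<Rightarrow> real \<Rightarrow> real"
    and K :: real
    and \<gamma> :: "nat \<Rightarrow> nat"
    and M :: "nat \<Rightarrow> real"
  assumes p: "1 \<le> p" and j: "j < p"
    and mt_meas: "mt \<in> borel_measurable (PiM {..<p} (\<lambda>_. lborel))"
    and eps_prob: "prob_space \<mu>" and eps_sets: "sets \<mu> = sets borel"
    and eps_mean: "integrable \<mu> (\<lambda>e. e) \<and> (\<integral>e. e \<partial>\<mu>) = 0"
    and eps_var: "integrable \<mu> (\<lambda>e. e\<^sup>2) \<and> (\<integral>e. e\<^sup>2 \<partial>\<mu>) > 0"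
    and additive: "\<And>x. (\<forall>l<p. x l \<in> {0..1}) \<Longrightarrow> mt x = (\<Sum>l<p. m l (x l))"
    and K: "K > 0" and bounded: "\<And>x. (\<forall>l<p. x l \<in> {0..1}) \<Longrightarrow> \<bar>mt x\<bar> \<le> K"
    and eps4: "integrable \<mu> (\<lambda>e. e ^ 4)"
    and mj_meas: "m j \<in> borel_measurable borel"
    and var_mj: "var_of (uniform_measure lborel {0..1::real}) (m j) > 0"
    and gamma_size: "eventually (\<lambda>n. 2 \<le> \<gamma> n \<and> \<gamma> n < n) sequentially"
    and M_size: "eventually (\<lambda>n. 0 < M n \<and> M n \<le> real (n choose \<gamma> n)) sequentially"
    and gamma_inf: "filterlim \<gamma> at_top sequentially"
    and gamma_sqrt: "(\<lambda>n. real (\<gamma> n) / sqrt (real n)) \<longlonglongrightarrow> 0"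
    and M_inf: "filterlim M at_top sequentially"
  shows "weak_conv_m
     (\<lambda>n. distr (incomplete_space p \<mu> n (\<gamma> n) (M n)) borel
        (\<lambda>\<omega>. (I_incomplete mt j n (\<gamma> n) \<omega> - Ij p \<mu> mt j)
            / sqrt ((real (\<gamma> n))\<^sup>2 * zeta1 p \<mu> mt j (\<gamma> n) / real n
                    + zeta p \<mu> mt j (\<gamma> n) / M n)))
     std_normal_distribution"
proof -
  interpret additive_model p j \<mu> mt m K
    by (rule additive_model.intro[OF j mt_meas eps_prob eps_sets conjunct1[OF eps_mean] conjunct2[OF eps_mean]
        conjunct1[OF eps_var] conjunct2[OF eps_var] additive bounded eps4 mj_meas var_mj])
  let ?s = "\<lambda>n. sqrt ((real (\<gamma> n))\<^sup>2 * zeta1 p \<mu> mt j (\<gamma> n) / real n + zeta p \<mu> mt j (\<gamma> n) / M n)"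
  let ?S = "\<lambda>n. incomplete_space p \<mu> n (\<gamma> n) (M n)"
  let ?F = "\<lambda>n \<omega>. (I_incomplete mt j n (\<gamma> n) \<omega> - Ij p \<mu> mt j) / ?s n"
  have Fm: "?F n \<in> borel_measurable (?S n)" for n
    using I_incomplete_measurable[of n "\<gamma> n" "M n"] by measurable
  show ?thesis
  proof (rule levy_continuity)
    show "real_distribution (distr (?S n) borel (?F n))" for n
      by (rule prob_space.real_distribution_distr[OF incomplete_prob Fm])
    show "real_distribution std_normal_distribution" by (rule real_dist_normal_dist)
    fix t
    have ch: "char (distr (?S n) borel (?F n)) t = (\<integral>\<omega>. iexp (t * ?F n \<omega>) \<partial>?S n)" for n
      unfolding char_def by (rule integral_distr[OF Fm]) measurable
    have "eventually (\<lambda>n. M n \<ge> 16) sequentially" using M_inf by (simp add: filterlim_at_top)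
    then have "eventually (\<lambda>n. norm (char (distr (?S n) borel (?F n)) t - complex_of_real (exp (- (t\<^sup>2 / 2))))
      \<le> err t n (\<gamma> n) (M n) (sqrt (1 / sqrt (M n))) (1 / sqrt (M n))) sequentially"
      using gamma_size M_size
    proof eventually_elim
      case (elim n)
      then show ?case unfolding ch by (intro I_incomplete_char_bound) auto
    qed
    then have "(\<lambda>n. char (distr (?S n) borel (?F n)) t - complex_of_real (exp (- (t\<^sup>2 / 2)))) \<longlonglongrightarrow> 0"
      by (rule Lim_null_comparison) (rule err_tendsto_0[OF var_psi_pos M_inf gamma_sqrt])
    then show "(\<lambda>n. char (distr (?S n) borel (?F n)) t) \<longlonglongrightarrow> char std_normal_distribution t"
      unfolding char_std_normal_distribution by (simp add: LIM_zero_iff)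
  qed
qed

end
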